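(* Let $u\in\mathcal{A}_S$ be symmetric and assume that $$\Bigl|u\bigl(\ell,\tfrac12\bigr)-u\bigl(\ell,-\tfrac12\bigr)\Bigr|=1.$$ Then $u$ is cylindrical.
   Context: Let $\ell>0$, $I=(-\tfrac12,\tfrac12)$, $S=(0,\ell)\times I\subset\mathbb{R}^2$. $W^{2,2}_{\mathrm{iso}}(S)$ is the set of $u\in W^{2,2}(S,\mathbb{R}^3)\cap W^{1,\infty}(S,\mathbb{R}^3)$ with $(\nabla u)^T\nabla u=\mathrm{Id}$ (the $2\times2$ identity) a.e.; such maps extend continuously to $\overline S$. The class of clamped isometric deformations is $$\mathcal{A}_S=\{u\in W^{2,2}_{\mathrm{iso}}(S): u(x)=(x_1,x_2,0)\text{ and }\nabla u=(e_1|e_2)\text{ in the trace sense on }\{0\}\times I\}.$$ A deformation $u:S\to\mathbb{R}^3$ is called symmetric if $u(x_1,x_2)=\bigl(u_1(x_1,-x_2),\,-u_2(x_1,-x_2),\,u_3(x_1,-x_2)\bigr)$ for all $(x_1,x_2)\in S$, and cylindrical if $u(x_1,x_2)=(u_1(x_1,0),\,x_2,\,u_3(x_1,0))$ for all $(x_1,x_2)\in S$. *)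

theory Defs
  imports "HOL-Analysis.Analysis"
begin

section \<open>Sobolev functions on open subsets of Euclidean space\<close>

definition pderivative :: "'n \<Rightarrow> (real ^ 'n \<Rightarrow> 'b) \<Rightarrow> real ^ 'n \<Rightarrow> 'b::real_normed_vector"
  where "pderivative i f x = frechet_derivative f (at x) (axis i 1)"

primrec Ck :: "nat \<Rightarrow> (real ^ 'n \<Rightarrow> 'b::real_normed_vector) \<Rightarrow> bool"
  where
    "Ck 0 f = continuous_on UNIV f"
  | "Ck (Suc k) f = (f differentiable_on UNIV \<and> (\<forall>i. Ck k (pderivative i f)))"

definition smooth :: "(real ^ 'n \<Rightarrow> 'b::real_normed_vector) \<Rightarrow> bool"
  where "smooth f \<longleftrightarrow> (\<forall>k. Ck k f)"

definition test_function :: "(real ^ 'n) set \<Rightarrow> (real ^ 'n \<Rightarrow> real) \<Rightarrow> bool"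
  where "test_function S \<phi> \<longleftrightarrow>
    smooth \<phi> \<and> compact (closure {x. \<phi> x \<noteq> 0}) \<and> closure {x. \<phi> x \<noteq> 0} \<subseteq> S"

definition locally_integrable :: "(real ^ 'n) set \<Rightarrow> (real ^ 'n \<Rightarrow> 'b::euclidean_space) \<Rightarrow> bool"
  where "locally_integrable S f \<longleftrightarrow>
    (\<forall>K. compact K \<and> K \<subseteq> S \<longrightarrow> integrable (lebesgue_on K) f)"

definition has_weak_partial ::
  "(real ^ 'n) set \<Rightarrow> 'n \<Rightarrow> (real ^ 'n \<Rightarrow> 'b::euclidean_space) \<Rightarrow> (real ^ 'n \<Rightarrow> 'b) \<Rightarrow> bool"
  where "has_weak_partial S i f g \<longleftrightarrow>
    locally_integrable S f \<and> locally_integrable S g \<and>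
    (\<forall>\<phi>. test_function S \<phi> \<longrightarrow>
      (LINT x|lebesgue_on S. pderivative i \<phi> x *\<^sub>R f x) = - (LINT x|lebesgue_on S. \<phi> x *\<^sub>R g x))"

definition L2 :: "(real ^ 'n) set \<Rightarrow> (real ^ 'n \<Rightarrow> 'b::euclidean_space) \<Rightarrow> bool"
  where "L2 S f \<longleftrightarrow>
    f \<in> borel_measurable (lebesgue_on S) \<and> integrable (lebesgue_on S) (\<lambda>x. (norm (f x))\<^sup>2)"

definition Linf :: "(real ^ 'n) set \<Rightarrow> (real ^ 'n \<Rightarrow> 'b::euclidean_space) \<Rightarrow> bool"
  where "Linf S f \<longleftrightarrow>
    f \<in> borel_measurable (lebesgue_on S) \<and> (\<exists>C. AE x in lebesgue_on S. norm (f x) \<le> C)"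

definition W12 :: "(real ^ 'n) set \<Rightarrow> (real ^ 'n \<Rightarrow> 'b::euclidean_space) \<Rightarrow> bool"
  where "W12 S f \<longleftrightarrow> L2 S f \<and> (\<forall>i. \<exists>g. has_weak_partial S i f g \<and> L2 S g)"

definition W22 :: "(real ^ 'n) set \<Rightarrow> (real ^ 'n \<Rightarrow> 'b::euclidean_space) \<Rightarrow> bool"
  where "W22 S f \<longleftrightarrow> L2 S f \<and> (\<forall>i. \<exists>g. has_weak_partial S i f g \<and> W12 S g)"

definition W1inf :: "(real ^ 'n) set \<Rightarrow> (real ^ 'n \<Rightarrow> 'b::euclidean_space) \<Rightarrow> bool"
  where "W1inf S f \<longleftrightarrow> Linf S f \<and> (\<forall>i. \<exists>g. has_weak_partial S i f g \<and> Linf S g)"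

text \<open>The gradient of a map into \<open>real ^ 'm\<close> is the matrix whose \<open>i\<close>-th column is the
  \<open>i\<close>-th weak partial derivative; it is determined only up to a null set.\<close>

definition has_weak_gradient ::
  "(real ^ 'n) set \<Rightarrow> (real ^ 'n \<Rightarrow> real ^ 'm) \<Rightarrow> (real ^ 'n \<Rightarrow> real ^ 'n ^ 'm) \<Rightarrow> bool"
  where "has_weak_gradient S u G \<longleftrightarrow> (\<forall>i. has_weak_partial S i u (\<lambda>x. column i (G x)))"

definition W22_iso :: "(real ^ 2) set \<Rightarrow> (real ^ 2 \<Rightarrow> real ^ 3) set"
  where "W22_iso S = {u. W22 S u \<and> W1inf S u \<and>
    (\<exists>G. has_weak_gradient S u G \<and>
      (AE x in lebesgue_on S. transpose (G x) ** G x = mat 1))}"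

section \<open>Clamped isometric deformations of a rectangular strip\<close>

definition strip :: "real \<Rightarrow> (real ^ 2) set"
  where "strip l = {x. 0 < x $ 1 \<and> x $ 1 < l \<and> - 1/2 < x $ 2 \<and> x $ 2 < 1/2}"

text \<open>\<open>left_trace l f g\<close>: the trace of \<open>f\<close> on \<open>{0} \<times> (-1/2, 1/2)\<close> is \<open>g\<close>. The trace operator is
  the continuous extension of the restriction operator from functions smooth up to the boundary
  to \<open>W\<^sup>1\<^sup>,\<^sup>2\<close>, so its graph is the closure of the graph of the restriction operator.
  Only the values of \<open>g\<close> on the edge matter.\<close>

definition left_trace ::
  "real \<Rightarrow> (real ^ 2 \<Rightarrow> 'b::euclidean_space) \<Rightarrow> (real ^ 2 \<Rightarrow> 'b) \<Rightarrow> bool"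
  where "left_trace l f g \<longleftrightarrow>
    (\<exists>D v.
      (\<forall>i. has_weak_partial (strip l) i f (D i)) \<and>
      (\<forall>n::nat. smooth (v n)) \<and>
      (\<lambda>n. \<integral>\<^sup>+x. ennreal ((norm (v n x - f x))\<^sup>2) \<partial>lebesgue_on (strip l)) \<longlonglongrightarrow> 0 \<and>
      (\<forall>i. (\<lambda>n. \<integral>\<^sup>+x. ennreal ((norm (pderivative i (v n) x - D i x))\<^sup>2)
              \<partial>lebesgue_on (strip l)) \<longlonglongrightarrow> 0) \<and>
      (\<lambda>n. \<integral>\<^sup>+t. ennreal ((norm (v n (vector [0, t]) - g (vector [0, t])))\<^sup>2)
              \<partial>lebesgue_on {- 1/2<..<1/2}) \<longlonglongrightarrow> 0)"

definition clamped_iso :: "real \<Rightarrow> (real ^ 2 \<Rightarrow> real ^ 3) set"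
  where "clamped_iso l = {u \<in> W22_iso (strip l).
    left_trace l u (\<lambda>x. vector [x $ 1, x $ 2, 0]) \<and>
    (\<exists>G. has_weak_gradient (strip l) u G \<and>
      left_trace l G (\<lambda>x. vector [vector [1, 0], vector [0, 1], vector [0, 0]]))}"

definition symmetric_deformation :: "real \<Rightarrow> (real ^ 2 \<Rightarrow> real ^ 3) \<Rightarrow> bool"
  where "symmetric_deformation l u \<longleftrightarrow>
    (\<forall>x\<in>strip l. u x = vector [u (vector [x $ 1, - x $ 2]) $ 1,
                               - u (vector [x $ 1, - x $ 2]) $ 2,
                               u (vector [x $ 1, - x $ 2]) $ 3])"

definition cylindrical :: "real \<Rightarrow> (real ^ 2 \<Rightarrow> real ^ 3) \<Rightarrow> bool"
  where "cylindrical l u \<longleftrightarrow>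
    (\<forall>x\<in>strip l. u x = vector [u (vector [x $ 1, 0]) $ 1, x $ 2, u (vector [x $ 1, 0]) $ 3])"

text \<open>Membership in \<open>clamped_iso l\<close> depends only on the class of \<open>u\<close> modulo null sets of the strip,
  whereas the two pointwise notions above, and values at corners, refer to the representative
  that is continuous up to the boundary. A statement about point values therefore has to
  ask for \<open>continuous_on (closure (strip l)) u\<close>, which every class satisfies for one representative.\<close>

end

(*
  Let f be the second component of u, with gradient (p, q). Since u is isometric, the Gauss equation
  gives det D^2 f = 0, and p^2 + q^2 <= 1; by symmetry f and p vanish on the axis y = 0. Testing
  det D^2 f = 0 on the upper half strip with (1/2 - y)^2 times a trapezoidal cut-off in x (equal to 1
  except at distance less than e from the two short edges) and integrating by parts bounds the
  integral of cut-off * p^2 by (1/e) times the integral of |p| |D^2 f| over the two edge layers.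
  On each short edge f(x, 1/2) - f(x, -1/2) has modulus 1 (clamping, and the hypothesis at x = l),
  which by |p| <= 1 makes the integral of |q| nearly maximal and hence that of p^2 of order e^2 on the
  layers. Letting e tend to 0 yields p = 0, so f = y, so |q| = 1 and the other components do not
  depend on y.

  No mollification is needed: the definition of the trace supplies smooth functions converging to u
  and to its gradient in W^{1,2} of the whole strip.
*)

theory Submission
  imports Defs "HOL-Real_Asymp.Real_Asymp"
begin

text \<open>The Gauss equation concerns vectors, but all second derivatives of an isometric map are
  normal to the surface, so each component inherits a Hessian of determinant zero. With t the
  cut-off, w the weight and p_x q_y - p_y q_x = (p q_y)_x - (p q_x)_y, the determinant equation
  leaves edge terms and, up to sign, the integral of t w_y p q_x. As q_x = p_y, the latter contains
  (p^2/2)_y, and one more integration by parts in y yields t p^2 because w_yy = 2. Boundary terms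
  contain p at y = 0, and w or w_y at y = 1/2. The layer bound is just strong enough: Cauchy-Schwarz
  gives a norm of p of order e, which cancels 1/e, and the remaining L^2 norm of q_y over the layer
  tends to 0. The obstacle is that p and q are only in W^{1,2}, with neither values on the axis nor
  second derivatives of their own. Identities are therefore proved for smooth approximants and
  arranged so that the limit involves only products of two square integrable factors. The condition
  p = 0 on the axis is built into the approximants by taking odd parts.\<close>

section \<open>Rectangles in the plane and Fubini's theorem on them\<close>

definition pt :: "real \<Rightarrow> real \<Rightarrow> real ^ 2"
  where "pt x y = vector [x, y]"

lemma pt_nth [simp]: "pt x y $ 1 = x" "pt x y $ 2 = y"
  by (simp_all add: pt_def)

lemma pt_eta [simp]: "pt (z $ 1) (z $ 2) = z"
  by (simp add: vec_eq_iff forall_2)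

text \<open>The linear form to which the introduction rules for continuity and derivatives
  apply.\<close>

lemma pt_alt: "pt x y = x *\<^sub>R axis 1 1 + y *\<^sub>R axis 2 1"
  by (simp add: vec_eq_iff forall_2 axis_def)

lemma continuous_on_pt [continuous_intros]:
  "continuous_on A f \<Longrightarrow> continuous_on A g \<Longrightarrow> continuous_on A (\<lambda>t. pt (f t) (g t))"
  unfolding pt_alt by (intro continuous_intros)

text \<open>The open rectangle carries the measure and the weak derivatives, the closed one
  (\<open>crect\<close>) the continuity up to the boundary. As boxes, both inherit the facts on
  contents and closures of intervals.\<close>

definition rect :: "real \<Rightarrow> real \<Rightarrow> real \<Rightarrow> real \<Rightarrow> (real ^ 2) set"
  where "rect a b c d = box (pt a c) (pt b d)"

definition crect :: "real \<Rightarrow> real \<Rightarrow> real \<Rightarrow> real \<Rightarrow> (real ^ 2) set"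
  where "crect a b c d = cbox (pt a c) (pt b d)"

lemma mem_rect: "z \<in> rect a b c d \<longleftrightarrow> a < z $ 1 \<and> z $ 1 < b \<and> c < z $ 2 \<and> z $ 2 < d"
  by (auto simp: rect_def mem_box_cart forall_2)

lemma mem_crect: "z \<in> crect a b c d \<longleftrightarrow> a \<le> z $ 1 \<and> z $ 1 \<le> b \<and> c \<le> z $ 2 \<and> z $ 2 \<le> d"
  by (auto simp: crect_def mem_box_cart forall_2)

lemma strip_eq_rect: "strip l = rect 0 l (- 1/2) (1/2)"
  by (auto simp: strip_def mem_rect)

lemma rect_sets [measurable, simp]: "rect a b c d \<in> sets lebesgue" "crect a b c d \<in> sets lebesgue"
  by (auto simp: rect_def crect_def)

lemma rect_lmeasurable [simp]: "rect a b c d \<in> lmeasurable" "crect a b c d \<in> lmeasurable"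
  by (auto simp: rect_def crect_def)

lemma content_crect:
  assumes "a \<le> b" "c \<le> d"
  shows "Henstock_Kurzweil_Integration.content (cbox (pt a c) (pt b d)) = (b - a) * (d - c)"
proof -
  have "cbox (pt a c) (pt b d) \<noteq> {}"
    using assms by (auto simp: interval_ne_empty_cart forall_2)
  then show ?thesis
    by (simp add: content_cbox_cart prod_2 UNIV_2)
qed

text \<open>Fubini is used for pairs, so integrals over \<open>real ^ 2\<close> are carried over to
  \<open>real * real\<close>. The coordinate bijection sends boxes to boxes of the same content,
  whence the factor 1 in \<open>has_integral_twiddle\<close>.\<close>

lemma integral_crect_twiddle:
  fixes F :: "real ^ 2 \<Rightarrow> real"
  assumes "F integrable_on crect a b c d"
  shows "integral (cbox (a, c) (b, d)) (\<lambda>(x, y). F (pt x y)) = integral (crect a b c d) F"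
proof -
  let ?g = "\<lambda>z. pt (fst z) (snd z)" and ?h = "\<lambda>w::real^2. (w $ 1, w $ 2)"
  have h: "?h ` cbox u v = cbox (u $ 1, u $ 2) (v $ 1, v $ 2)" for u v
  proof (intro equalityI subsetI)
    fix z assume "z \<in> cbox (u $ 1, u $ 2) (v $ 1, v $ 2)"
    then have "pt (fst z) (snd z) \<in> cbox u v" "z = ?h (pt (fst z) (snd z))"
      by (auto simp: mem_box_cart forall_2 cbox_Pair_eq)
    then show "z \<in> ?h ` cbox u v" by blast
  qed (auto simp: mem_box_cart cbox_Pair_eq)
  have g: "?g ` cbox u v = cbox (pt (fst u) (snd u)) (pt (fst v) (snd v))" for u v
  proof (intro equalityI subsetI)
    fix z assume "z \<in> cbox (pt (fst u) (snd u)) (pt (fst v) (snd v))"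
    then have "?h z \<in> cbox u v" "z = ?g (?h z)"
      by (cases u; cases v; auto simp: mem_box_cart forall_2 cbox_Pair_eq)+
    then show "z \<in> ?g ` cbox u v" by blast
  qed (cases u; cases v; auto simp: mem_box_cart forall_2 cbox_Pair_eq)
  have "((\<lambda>z. F (?g z)) has_integral (1 / 1) *\<^sub>R integral (crect a b c d) F) (?h ` cbox (pt a c) (pt b d))"
  proof (rule has_integral_twiddle)
    show "continuous (at x) ?g" for x
      unfolding pt_alt by (intro continuous_intros)
    show "\<exists>w z. ?g ` cbox u v = cbox w z" for u v using g by blast
    show "\<exists>w z. ?h ` cbox u v = cbox w z" for u v using h by blast
    show "Henstock_Kurzweil_Integration.content (?g ` cbox u v) = 1 * Henstock_Kurzweil_Integration.content (cbox u v)" for u v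
    \<comment> \<open>The product formula for the content needs ordered endpoints; otherwise both
      boxes are empty.\<close>
    proof (cases "fst u \<le> fst v \<and> snd u \<le> snd v")
      case True
      then show ?thesis unfolding g
        by (cases u; cases v) (auto simp: content_crect content_Pair)
    next
      case False
      then have "cbox u v = {}" by (cases u; cases v) (auto simp: cbox_Pair_eq)
      then show ?thesis by simp
    qed
    show "(F has_integral integral (crect a b c d) F) (cbox (pt a c) (pt b d))"
      using assms by (simp add: crect_def has_integral_integral)
  qed auto
  then show ?thesis
    unfolding h by (auto simp: case_prod_beta' intro: integral_unique)
qed

lemma rect_integrable:
  fixes F :: "real ^ 2 \<Rightarrow> real"
  assumes "continuous_on (crect a b c d) F"
  shows "integrable (lebesgue_on (rect a b c d)) F"
proof -
  have "integrable (lebesgue_on (crect a b c d)) F"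
    using assms unfolding crect_def by (rule continuous_imp_integrable)
  moreover have "rect a b c d \<subseteq> crect a b c d"
    by (auto simp: mem_rect mem_crect)
  ultimately show ?thesis
    using set_integrable_subset[of lebesgue "crect a b c d" F "rect a b c d"]
    by (simp add: integrable_restrict_space set_integrable_def)
qed

text \<open>Bridge from Lebesgue integrals on open rectangles to iterated gauge integrals; the
  boundary does not affect the integral. Both orders are needed, since derivatives get integrated
  along either axis.\<close>

lemma LINT_rect:
  fixes F :: "real ^ 2 \<Rightarrow> real"
  assumes "continuous_on (crect a b c d) F"
  shows "(LINT z|lebesgue_on (rect a b c d). F z) = integral {a..b} (\<lambda>x. integral {c..d} (\<lambda>y. F (pt x y)))"
    and "(LINT z|lebesgue_on (rect a b c d). F z) = integral {c..d} (\<lambda>y. integral {a..b} (\<lambda>x. F (pt x y)))"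
proof -
  have "(LINT z|lebesgue_on (rect a b c d). F z) = integral (rect a b c d) F"
    by (intro lebesgue_integral_eq_integral rect_integrable assms) simp
  also have "\<dots> = integral (crect a b c d) F"
    unfolding rect_def crect_def by (rule integral_open_interval)
  also have "\<dots> = integral (cbox (a, c) (b, d)) (\<lambda>(x, y). F (pt x y))"
    by (rule integral_crect_twiddle[symmetric])
      (use assms in \<open>auto simp: crect_def intro: integrable_continuous\<close>)
  finally have eq: "(LINT z|lebesgue_on (rect a b c d). F z) = integral (cbox (a, c) (b, d)) (\<lambda>(x, y). F (pt x y))" .
  have cont: "continuous_on (cbox (a, c) (b, d)) (\<lambda>(x, y). F (pt x y))"
    unfolding case_prod_beta'
    by (rule continuous_on_compose2[OF assms]) (auto intro!: continuous_intros simp: mem_crect cbox_Pair_eq)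
  show 1: "(LINT z|lebesgue_on (rect a b c d). F z) = integral {a..b} (\<lambda>x. integral {c..d} (\<lambda>y. F (pt x y)))"
    unfolding eq by (subst integral_prod_continuous[OF cont]) auto
  show "(LINT z|lebesgue_on (rect a b c d). F z) = integral {c..d} (\<lambda>y. integral {a..b} (\<lambda>x. F (pt x y)))"
    unfolding 1 using integral_swap_continuous[OF cont] by simp
qed

lemma rect_borel_measurable:
  fixes F :: "real ^ 2 \<Rightarrow> real"
  assumes "continuous_on UNIV F"
  shows "F \<in> borel_measurable (lebesgue_on (rect a b c d))"
  by (intro borel_measurable_integrable rect_integrable continuous_on_subset[OF assms]) simp

section \<open>Partial derivatives along coordinate lines\<close>

text \<open>Differentiability along one family of lines, with continuity of both functions on the
  plane, is all that Fubini and the one-dimensional fundamental theorem require, and it is stable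
  under products and reflection.\<close>

definition pd1 :: "(real ^ 2 \<Rightarrow> real) \<Rightarrow> (real ^ 2 \<Rightarrow> real) \<Rightarrow> bool"
  where "pd1 F F1 \<longleftrightarrow> continuous_on UNIV F \<and> continuous_on UNIV F1 \<and>
    (\<forall>x y. ((\<lambda>t. F (pt t y)) has_real_derivative F1 (pt x y)) (at x))"

definition pd2 :: "(real ^ 2 \<Rightarrow> real) \<Rightarrow> (real ^ 2 \<Rightarrow> real) \<Rightarrow> bool"
  where "pd2 F F2 \<longleftrightarrow> continuous_on UNIV F \<and> continuous_on UNIV F2 \<and>
    (\<forall>x y. ((\<lambda>t. F (pt x t)) has_real_derivative F2 (pt x y)) (at y))"

lemma pd_continuous:
  "pd1 F F1 \<Longrightarrow> continuous_on A F" "pd1 F F1 \<Longrightarrow> continuous_on A F1"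
  "pd2 F F2 \<Longrightarrow> continuous_on A F" "pd2 F F2 \<Longrightarrow> continuous_on A F2"
  by (auto simp: pd1_def pd2_def intro: continuous_on_subset)

lemma pd1_mult:
  assumes "pd1 F F1" "pd1 G G1"
  shows "pd1 (\<lambda>z. F z * G z) (\<lambda>z. F1 z * G z + F z * G1 z)"
  using assms unfolding pd1_def
  by (auto intro!: continuous_intros derivative_eq_intros simp: algebra_simps)

lemma pd2_mult:
  assumes "pd2 F F2" "pd2 G G2"
  shows "pd2 (\<lambda>z. F z * G z) (\<lambda>z. F2 z * G z + F z * G2 z)"
  using assms unfolding pd2_def
  by (auto intro!: continuous_intros derivative_eq_intros simp: algebra_simps)

text \<open>The divergence theorem on a rectangle for a horizontal field: the inner integral is
  evaluated by the fundamental theorem of calculus.\<close>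

lemma LINT_pd1:
  assumes "pd1 F F1" "a \<le> b"
  shows "(LINT z|lebesgue_on (rect a b c d). F1 z) = integral {c..d} (\<lambda>y. F (pt b y) - F (pt a y))"
proof -
  have "((\<lambda>x. F1 (pt x y)) has_integral F (pt b y) - F (pt a y)) {a..b}" for y
    using assms unfolding pd1_def has_real_derivative_iff_has_vector_derivative
    by (intro fundamental_theorem_of_calculus) (auto intro: has_vector_derivative_at_within)
  then have "integral {a..b} (\<lambda>x. F1 (pt x y)) = F (pt b y) - F (pt a y)" for y
    by (rule integral_unique)
  then show ?thesis
    by (subst LINT_rect(2)[OF pd_continuous(2)[OF assms(1)]]) simp
qed

lemma LINT_pd2:
  assumes "pd2 F F2" "c \<le> d"
  shows "(LINT z|lebesgue_on (rect a b c d). F2 z) = integral {a..b} (\<lambda>x. F (pt x d) - F (pt x c))"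
proof -
  have "((\<lambda>y. F2 (pt x y)) has_integral F (pt x d) - F (pt x c)) {c..d}" for x
    using assms unfolding pd2_def has_real_derivative_iff_has_vector_derivative
    by (intro fundamental_theorem_of_calculus) (auto intro: has_vector_derivative_at_within)
  then have "integral {c..d} (\<lambda>y. F2 (pt x y)) = F (pt x d) - F (pt x c)" for x
    by (rule integral_unique)
  then show ?thesis
    by (subst LINT_rect(1)[OF pd_continuous(4)[OF assms(1)]]) simp
qed

section \<open>Limits in mean square\<close>

text \<open>Square integrability of the limit and of all terms is part of the notion, because the
  Bochner integral of a non-integrable function is 0 by default and the last clause alone would then
  mean nothing.\<close>

definition L2lim :: "'a measure \<Rightarrow> (nat \<Rightarrow> 'a \<Rightarrow> real) \<Rightarrow> ('a \<Rightarrow> real) \<Rightarrow> bool"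
  where "L2lim M V v \<longleftrightarrow>
    v \<in> borel_measurable M \<and> integrable M (\<lambda>x. (v x)\<^sup>2) \<and>
    (\<forall>n. V n \<in> borel_measurable M \<and> integrable M (\<lambda>x. (V n x)\<^sup>2)) \<and>
    (\<lambda>n. LINT x|M. (V n x - v x)\<^sup>2) \<longlonglongrightarrow> 0"

lemma integrable_mult_square:
  fixes f g :: "'a \<Rightarrow> real"
  assumes [measurable]: "f \<in> borel_measurable M" "g \<in> borel_measurable M"
    and "integrable M (\<lambda>x. (f x)\<^sup>2)" "integrable M (\<lambda>x. (g x)\<^sup>2)"
  shows "integrable M (\<lambda>x. f x * g x)"
proof (rule Bochner_Integration.integrable_bound)
  show "integrable M (\<lambda>x. (f x)\<^sup>2 + (g x)\<^sup>2)" using assms by simp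
  have "\<bar>s * t\<bar> \<le> s\<^sup>2 + t\<^sup>2" for s t :: real
    using sum_squares_bound[of "\<bar>s\<bar>" "\<bar>t\<bar>"] mult_nonneg_nonneg[of "\<bar>s\<bar>" "\<bar>t\<bar>"]
    unfolding abs_mult power2_abs by linarith
  then show "AE x in M. norm (f x * g x) \<le> norm ((f x)\<^sup>2 + (g x)\<^sup>2)" by simp
qed simp

lemma integrable_square_diff:
  fixes f g :: "'a \<Rightarrow> real"
  assumes "f \<in> borel_measurable M" "g \<in> borel_measurable M"
    and "integrable M (\<lambda>x. (f x)\<^sup>2)" "integrable M (\<lambda>x. (g x)\<^sup>2)"
  shows "integrable M (\<lambda>x. (f x - g x)\<^sup>2)"
  using assms integrable_mult_square[OF assms] by (simp add: power2_diff mult.assoc)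

lemma integrable_square_add:
  fixes f g :: "'a \<Rightarrow> real"
  assumes "f \<in> borel_measurable M" "g \<in> borel_measurable M"
    and "integrable M (\<lambda>x. (f x)\<^sup>2)" "integrable M (\<lambda>x. (g x)\<^sup>2)"
  shows "integrable M (\<lambda>x. (f x + g x)\<^sup>2)"
  using assms integrable_mult_square[OF assms] by (simp add: power2_sum mult.assoc)

text \<open>With \<open>r\<close>, \<open>s\<close> the two norms, expand the integral of (s|f| -
  r|g|)^2 and cancel \<open>r * s\<close>. If \<open>r * s = 0\<close>, one factor vanishes almost
  everywhere.\<close>

lemma Cauchy_Schwarz_LINT:
  fixes f g :: "'a \<Rightarrow> real"
  assumes [measurable]: "f \<in> borel_measurable M" "g \<in> borel_measurable M"
    and f: "integrable M (\<lambda>x. (f x)\<^sup>2)" and g: "integrable M (\<lambda>x. (g x)\<^sup>2)"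
  shows "(LINT x|M. \<bar>f x * g x\<bar>) \<le> sqrt (LINT x|M. (f x)\<^sup>2) * sqrt (LINT x|M. (g x)\<^sup>2)"
proof -
  define r s where "r = sqrt (LINT x|M. (f x)\<^sup>2)" and "s = sqrt (LINT x|M. (g x)\<^sup>2)"
  have rs: "r\<^sup>2 = (LINT x|M. (f x)\<^sup>2)" "s\<^sup>2 = (LINT x|M. (g x)\<^sup>2)" "r \<ge> 0" "s \<ge> 0"
    by (simp_all add: r_def s_def)
  have fg: "integrable M (\<lambda>x. \<bar>f x * g x\<bar>)"
    using integrable_mult_square[OF assms] by simp
  have "0 \<le> (LINT x|M. (s * \<bar>f x\<bar> - r * \<bar>g x\<bar>)\<^sup>2)" by simp
  also have "\<dots> = (LINT x|M. s\<^sup>2 * (f x)\<^sup>2 + r\<^sup>2 * (g x)\<^sup>2 - 2 * r * s * \<bar>f x * g x\<bar>)"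
    by (rule Bochner_Integration.integral_cong) (auto simp: power2_eq_square algebra_simps abs_mult)
  also have "\<dots> = s\<^sup>2 * r\<^sup>2 + r\<^sup>2 * s\<^sup>2 - 2 * r * s * (LINT x|M. \<bar>f x * g x\<bar>)"
    using f g fg by (simp add: rs)
  finally have *: "(r * s) * (LINT x|M. \<bar>f x * g x\<bar>) \<le> (r * s) * (r * s)"
    by (simp add: power2_eq_square algebra_simps)
  show ?thesis
  proof (cases "r * s = 0")
    case False
    then have "0 < r * s" using rs by (simp add: less_le)
    then have "(LINT x|M. \<bar>f x * g x\<bar>) \<le> r * s" using * by (metis mult_le_cancel_left_pos)
    then show ?thesis by (simp add: r_def s_def)
  next
    case True
    then have "AE x in M. f x * g x = 0"
      using rs(1,2) integral_nonneg_eq_0_iff_AE[OF f] integral_nonneg_eq_0_iff_AE[OF g] by auto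
    then have "(LINT x|M. \<bar>f x * g x\<bar>) = (LINT x|M. 0)"
      by (intro integral_cong_AE) auto
    then show ?thesis using rs(3,4) True by (simp add: r_def s_def)
  qed
qed

lemma L2limD:
  assumes "L2lim M V v"
  shows "v \<in> borel_measurable M" "integrable M (\<lambda>x. (v x)\<^sup>2)"
    "V n \<in> borel_measurable M" "integrable M (\<lambda>x. (V n x)\<^sup>2)"
    "(\<lambda>n. LINT x|M. (V n x - v x)\<^sup>2) \<longlonglongrightarrow> 0"
    "integrable M (\<lambda>x. (V n x - v x)\<^sup>2)"
  using assms by (auto simp: L2lim_def intro: integrable_square_diff)

text \<open>VW - vw = (V - v)(W - w) + (V - v)w + v(W - w), and Cauchy-Schwarz makes each summand
  small in mean; a bounded weight changes the estimate only by a factor.\<close>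

lemma L2lim_mult:
  assumes V: "L2lim M V v" and W: "L2lim M W w"
    and [measurable]: "\<theta> \<in> borel_measurable M" and C: "\<And>x. x \<in> space M \<Longrightarrow> \<bar>\<theta> x\<bar> \<le> C"
  shows "(\<lambda>n. LINT x|M. \<theta> x * (V n x * W n x)) \<longlonglongrightarrow> (LINT x|M. \<theta> x * (v x * w x))"
    and "integrable M (\<lambda>x. \<theta> x * (V n x * W n x))" "integrable M (\<lambda>x. \<theta> x * (v x * w x))"
proof -
  note [measurable] = L2limD(1,3)[OF V] L2limD(1,3)[OF W]
  have bd: "integrable M (\<lambda>x. \<theta> x * h x)" if h: "integrable M h" for h
  proof (rule Bochner_Integration.integrable_bound)
    show "integrable M (\<lambda>x. C * h x)" using h by simp
    show "(\<lambda>x. \<theta> x * h x) \<in> borel_measurable M" using h by measurable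
    show "AE x in M. norm (\<theta> x * h x) \<le> norm (C * h x)"
      by (rule AE_I2) (auto simp: abs_mult intro!: mult_right_mono order_trans[OF C])
  qed
  show 1: "integrable M (\<lambda>x. \<theta> x * (V n x * W n x))" for n
    by (intro bd integrable_mult_square L2limD[OF V] L2limD[OF W])
  show 2: "integrable M (\<lambda>x. \<theta> x * (v x * w x))"
    by (intro bd integrable_mult_square L2limD[OF V] L2limD[OF W])
  define A B where "A n = sqrt (LINT x|M. (V n x - v x)\<^sup>2)" and "B n = sqrt (LINT x|M. (W n x - w x)\<^sup>2)" for n
  define a b where "a = sqrt (LINT x|M. (v x)\<^sup>2)" and "b = sqrt (LINT x|M. (w x)\<^sup>2)"
  have AB: "A \<longlonglongrightarrow> 0" "B \<longlonglongrightarrow> 0"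
    using tendsto_real_sqrt[OF L2limD(5)[OF V]] tendsto_real_sqrt[OF L2limD(5)[OF W]]
    by (auto simp: A_def[abs_def] B_def[abs_def])
  have est: "\<bar>(LINT x|M. \<theta> x * (V n x * W n x)) - (LINT x|M. \<theta> x * (v x * w x))\<bar>
      \<le> \<bar>C\<bar> * (A n * B n + A n * b + a * B n)" for n
  proof -
    have i: "integrable M (\<lambda>x. (V n x - v x) * (W n x - w x))" "integrable M (\<lambda>x. (V n x - v x) * w x)"
      "integrable M (\<lambda>x. v x * (W n x - w x))"
      by (intro integrable_mult_square borel_measurable_diff L2limD[OF V] L2limD[OF W])+
    have "\<bar>(LINT x|M. \<theta> x * (V n x * W n x)) - (LINT x|M. \<theta> x * (v x * w x))\<bar>
      = \<bar>LINT x|M. \<theta> x * (V n x * W n x) - \<theta> x * (v x * w x)\<bar>"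
      using 1 2 by simp
    also have "\<dots> \<le> (LINT x|M. C * (\<bar>(V n x - v x) * (W n x - w x)\<bar> + \<bar>(V n x - v x) * w x\<bar> + \<bar>v x * (W n x - w x)\<bar>))"
    proof (rule integral_abs_bound[THEN order_trans], rule integral_mono)
      fix x assume x: "x \<in> space M"
      have "\<theta> x * (V n x * W n x) - \<theta> x * (v x * w x)
         = \<theta> x * ((V n x - v x) * (W n x - w x) + (V n x - v x) * w x + v x * (W n x - w x))"
        by (simp add: algebra_simps)
      also have "\<bar>\<dots>\<bar> \<le> C * (\<bar>(V n x - v x) * (W n x - w x)\<bar> + \<bar>(V n x - v x) * w x\<bar> + \<bar>v x * (W n x - w x)\<bar>)"
        unfolding abs_mult[of "\<theta> x"] using C[OF x] by (intro mult_mono) auto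
      finally show "\<bar>\<theta> x * (V n x * W n x) - \<theta> x * (v x * w x)\<bar> \<le> \<dots>" .
    qed (use 1 2 i in auto)
    also have "\<dots> = C * ((LINT x|M. \<bar>(V n x - v x) * (W n x - w x)\<bar>) + (LINT x|M. \<bar>(V n x - v x) * w x\<bar>)
       + (LINT x|M. \<bar>v x * (W n x - w x)\<bar>))"
      using i by simp
    also have "\<dots> \<le> \<bar>C\<bar> * (A n * B n + A n * b + a * B n)"
    \<comment> \<open>On an empty space the bound on \<theta> says nothing and \<open>C\<close> may
      be negative; all integrals are 0 then.\<close>
    proof (cases "space M = {}")
      case True
      then have "(LINT x|M. h x) = 0" for h :: "'a \<Rightarrow> real"
        by (simp add: Bochner_Integration.integral_empty)
      then show ?thesis by (simp add: A_def B_def a_def b_def)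
    next
      case False
      then have "0 \<le> C" using C by (meson abs_ge_zero equals0I order_trans)
      then show ?thesis
        unfolding A_def B_def a_def b_def
        by (intro mult_mono add_mono Cauchy_Schwarz_LINT borel_measurable_diff L2limD[OF V] L2limD[OF W]) auto
    qed
    finally show ?thesis .
  qed
  have lim: "(\<lambda>n. \<bar>C\<bar> * (A n * B n + A n * b + a * B n)) \<longlonglongrightarrow> 0"
    by (rule tendsto_eq_intros AB refl)+ simp
  have "(\<lambda>n. (LINT x|M. \<theta> x * (V n x * W n x)) - (LINT x|M. \<theta> x * (v x * w x))) \<longlonglongrightarrow> 0"
    by (rule Lim_null_comparison[OF _ lim]) (simp only: real_norm_def est eventually_True)
  then show "(\<lambda>n. LINT x|M. \<theta> x * (V n x * W n x)) \<longlonglongrightarrow> (LINT x|M. \<theta> x * (v x * w x))"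
    by (simp add: LIM_zero_iff)
qed

lemma L2lim_add:
  assumes V: "L2lim M V v" and W: "L2lim M W w"
  shows "L2lim M (\<lambda>n x. V n x + W n x) (\<lambda>x. v x + w x)"
proof -
  note [measurable] = L2limD(1,3)[OF V] L2limD(1,3)[OF W]
  have i: "integrable M (\<lambda>x. (V n x - v x)\<^sup>2)" "integrable M (\<lambda>x. (W n x - w x)\<^sup>2)" for n
    using L2limD(6) V W by blast+
  have "(\<lambda>n. LINT x|M. (V n x + W n x - (v x + w x))\<^sup>2) \<longlonglongrightarrow> 0"
  proof (rule tendsto_sandwich[of "\<lambda>_. 0", OF _ _ tendsto_const])
    show "\<forall>\<^sub>F n in sequentially. (LINT x|M. (V n x + W n x - (v x + w x))\<^sup>2)
        \<le> 2 * (LINT x|M. (V n x - v x)\<^sup>2) + 2 * (LINT x|M. (W n x - w x)\<^sup>2)"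
    proof (rule always_eventually, rule allI)
      fix n
      have "(LINT x|M. (V n x + W n x - (v x + w x))\<^sup>2) \<le> (LINT x|M. 2 * (V n x - v x)\<^sup>2 + 2 * (W n x - w x)\<^sup>2)"
      proof (rule integral_mono)
        show "integrable M (\<lambda>x. (V n x + W n x - (v x + w x))\<^sup>2)"
          by (intro integrable_square_diff integrable_square_add borel_measurable_add L2limD[OF V] L2limD[OF W])
        have "(s + t)\<^sup>2 \<le> 2 * s\<^sup>2 + 2 * t\<^sup>2" for s t :: real
          using zero_le_power2[of "s - t"] by (simp add: power2_eq_square algebra_simps)
        from this[of "V n x - v x" "W n x - w x" for x]
        show "(V n x + W n x - (v x + w x))\<^sup>2 \<le> 2 * (V n x - v x)\<^sup>2 + 2 * (W n x - w x)\<^sup>2" for x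
          by (simp add: algebra_simps)
      qed (use i in auto)
      then show "(LINT x|M. (V n x + W n x - (v x + w x))\<^sup>2)
        \<le> 2 * (LINT x|M. (V n x - v x)\<^sup>2) + 2 * (LINT x|M. (W n x - w x)\<^sup>2)"
        using i by simp
    qed
    show "(\<lambda>n. 2 * (LINT x|M. (V n x - v x)\<^sup>2) + 2 * (LINT x|M. (W n x - w x)\<^sup>2)) \<longlonglongrightarrow> 0"
      by (rule tendsto_eq_intros L2limD(5)[OF V] L2limD(5)[OF W] refl)+ simp
  qed (auto)
  then show ?thesis
    unfolding L2lim_def using L2limD[OF V] L2limD[OF W] by (auto intro!: integrable_square_add)
qed

lemma L2lim_cmult:
  assumes V: "L2lim M V v"
  shows "L2lim M (\<lambda>n x. r * V n x) (\<lambda>x. r * v x)"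
proof -
  have "(r * s - r * t)\<^sup>2 = r\<^sup>2 * (s - t)\<^sup>2" for s t :: real
    by (simp add: power2_eq_square algebra_simps)
  then show ?thesis
    using L2limD[OF V] tendsto_mult_right_zero[OF L2limD(5)[OF V], of "r\<^sup>2"]
    unfolding L2lim_def by (auto simp: power_mult_distrib)
qed

lemma L2lim_minus: "L2lim M V v \<Longrightarrow> L2lim M (\<lambda>n x. - V n x) (\<lambda>x. - v x)"
  using L2lim_cmult[of M V v "-1"] by simp

lemma L2lim_cong_AE:
  assumes V: "L2lim M V v" and [measurable]: "w \<in> borel_measurable M" and eq: "AE x in M. v x = w x"
  shows "L2lim M V w"
proof -
  note [measurable] = L2limD(1,3)[OF V]
  have "(LINT x|M. (V n x - v x)\<^sup>2) = (LINT x|M. (V n x - w x)\<^sup>2)" for n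
    by (rule integral_cong_AE) (use eq in auto)
  moreover have "integrable M (\<lambda>x. (v x)\<^sup>2) \<longleftrightarrow> integrable M (\<lambda>x. (w x)\<^sup>2)"
    by (rule integrable_cong_AE) (use eq in auto)
  ultimately show ?thesis
    using V by (simp add: L2lim_def)
qed

lemma L2lim_const:
  assumes "finite_measure M"
  shows "L2lim M (\<lambda>_ _. r) (\<lambda>_. r)"
  using assms by (simp add: L2lim_def finite_measure.integrable_const)

text \<open>The trace definition measures convergence by nonnegative integrals and does not assert
  that the limit is square integrable. One index \<open>N\<close> at finite distance settles this,
  since v = V_N - (V_N - v).\<close>

lemma L2limI_nn_integral:
  fixes v :: "'a \<Rightarrow> real"
  assumes [measurable]: "v \<in> borel_measurable M" "\<And>n. V n \<in> borel_measurable M"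
    and V: "\<And>n. integrable M (\<lambda>x. (V n x)\<^sup>2)"
    and lim: "(\<lambda>n. \<integral>\<^sup>+x. ennreal ((V n x - v x)\<^sup>2) \<partial>M) \<longlonglongrightarrow> 0"
  shows "L2lim M V v"
proof -
  have "\<forall>\<^sub>F n in sequentially. (\<integral>\<^sup>+x. ennreal ((V n x - v x)\<^sup>2) \<partial>M) < 1"
    by (rule order_tendstoD(2)[OF lim]) simp
  then obtain N where N: "(\<integral>\<^sup>+x. ennreal ((V N x - v x)\<^sup>2) \<partial>M) < 1"
    by (auto simp: eventually_sequentially)
  then have "integrable M (\<lambda>x. (V N x - v x)\<^sup>2)"
    by (intro integrableI_bounded) (auto intro: less_trans simp: ennreal_one_less_top)
  then have "integrable M (\<lambda>x. (V N x - (V N x - v x))\<^sup>2)"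
    by (rule integrable_square_diff[OF _ _ V, rotated 2]) simp_all
  then have v: "integrable M (\<lambda>x. (v x)\<^sup>2)" by simp
  then have "integrable M (\<lambda>x. (V n x - v x)\<^sup>2)" for n
    by (intro integrable_square_diff) (auto simp: V)
  then have "(\<integral>\<^sup>+x. ennreal ((V n x - v x)\<^sup>2) \<partial>M) = ennreal (LINT x|M. (V n x - v x)\<^sup>2)" for n
    by (intro nn_integral_eq_integral) auto
  then have "(\<lambda>n. LINT x|M. (V n x - v x)\<^sup>2) \<longlonglongrightarrow> 0"
    using lim by (simp add: tendsto_ennreal_iff flip: ennreal_0)
  then show ?thesis
    using V v by (simp add: L2lim_def)
qed

lemma rect_finite_measure: "finite_measure (lebesgue_on (rect a b c d))"
  by (simp add: finite_measure_lebesgue_on)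

lemma bounded_on_rect:
  fixes \<theta> :: "real ^ 2 \<Rightarrow> real"
  assumes "continuous_on UNIV \<theta>"
  obtains C where "\<And>z. z \<in> rect a b c d \<Longrightarrow> \<bar>\<theta> z\<bar> \<le> C"
proof -
  have "compact (\<theta> ` crect a b c d)"
    unfolding crect_def by (intro compact_continuous_image continuous_on_subset[OF assms]) auto
  then obtain C where "\<And>z. z \<in> crect a b c d \<Longrightarrow> \<bar>\<theta> z\<bar> \<le> C"
    by (force dest!: compact_imp_bounded simp: bounded_iff)
  then show ?thesis
    by (intro that[of C]) (auto simp: mem_rect mem_crect)
qed

section \<open>Smooth bump functions\<close>

lemma pderivative_eq: "(f has_derivative f') (at x) \<Longrightarrow> pderivative i f x = f' (axis i 1)"
  by (simp add: pderivative_def frechet_derivative_at[symmetric])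

text \<open>\<open>Ck\<close> is phrased with \<open>frechet_derivative\<close>; this rule admits
  any explicitly exhibited derivative instead.\<close>

lemma Ck_Suc_I:
  assumes "\<And>x. (f has_derivative f' x) (at x)" "\<And>i. Ck k (\<lambda>x. f' x (axis i 1))"
  shows "Ck (Suc k) f"
proof -
  have "pderivative i f = (\<lambda>x. f' x (axis i 1))" for i
    using pderivative_eq[OF assms(1)] by blast
  then show ?thesis
    using assms by (auto simp: differentiable_on_def differentiable_def intro: has_derivative_at_withinI)
qed

lemma Ck_Suc_D:
  assumes "Ck (Suc k) f"
  shows "(f has_derivative (\<lambda>h. frechet_derivative f (at x) h)) (at x)" "Ck k (pderivative i f)"
  using assms by (auto simp: differentiable_on_def frechet_derivative_works[symmetric])

lemma Ck_continuous: "Ck k f \<Longrightarrow> continuous_on UNIV f"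
  by (cases k) (auto intro: differentiable_imp_continuous_on)

lemma Ck_add: "Ck k f \<Longrightarrow> Ck k g \<Longrightarrow> Ck k (\<lambda>x. f x + g x)"
proof (induction k arbitrary: f g)
  case (Suc k)
  show ?case
    by (rule Ck_Suc_I[OF has_derivative_add[OF Ck_Suc_D(1)[OF Suc.prems(1)] Ck_Suc_D(1)[OF Suc.prems(2)]]])
      (use Suc.IH[OF Ck_Suc_D(2)[OF Suc.prems(1)] Ck_Suc_D(2)[OF Suc.prems(2)]] in \<open>simp add: pderivative_def\<close>)
qed (auto intro: continuous_intros)

lemma Ck_bounded_linear:
  assumes L: "bounded_linear L"
  shows "Ck k f \<Longrightarrow> Ck k (\<lambda>x. L (f x))"
proof (induction k arbitrary: f)
  case (Suc k)
  show ?case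
    by (rule Ck_Suc_I[OF bounded_linear.has_derivative[OF L Ck_Suc_D(1)[OF Suc.prems]]])
      (use Suc.IH[OF Ck_Suc_D(2)[OF Suc.prems]] in \<open>simp add: pderivative_def\<close>)
qed (auto intro: bounded_linear.continuous_on[OF L])

lemma Ck_Suc_imp: "Ck (Suc k) f \<Longrightarrow> Ck k f"
proof (induction k arbitrary: f)
  case 0 then show ?case using Ck_continuous[of "Suc 0" f] by simp
next
  case (Suc k)
  show ?case
    by (rule Ck_Suc_I[OF Ck_Suc_D(1)[OF Suc.prems]])
      (use Suc.IH[OF Ck_Suc_D(2)[OF Suc.prems]] in \<open>simp add: pderivative_def\<close>)
qed

lemma Ck_mult:
  fixes f g :: "real ^ 'n \<Rightarrow> real"
  shows "Ck k f \<Longrightarrow> Ck k g \<Longrightarrow> Ck k (\<lambda>x. f x * g x)"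
proof (induction k arbitrary: f g)
  case (Suc k)
  show ?case
  proof (rule Ck_Suc_I[OF has_derivative_mult[OF Ck_Suc_D(1)[OF Suc.prems(1)] Ck_Suc_D(1)[OF Suc.prems(2)]]])
    show "Ck k (\<lambda>x. f x * frechet_derivative g (at x) (axis i 1) + frechet_derivative f (at x) (axis i 1) * g x)" for i
      using Ck_add[OF Suc.IH[OF Ck_Suc_imp[OF Suc.prems(1)] Ck_Suc_D(2)[OF Suc.prems(2)]]
          Suc.IH[OF Ck_Suc_D(2)[OF Suc.prems(1)] Ck_Suc_imp[OF Suc.prems(2)]]]
      by (simp add: pderivative_def)
  qed
qed (auto intro: continuous_intros)

section \<open>Functions that are flat at the origin\<close>

text \<open>The powers of \<open>1 / t\<close> are included so that the family is closed, up to
  linear combinations, under differentiation. Smoothness of exp(-c/t), extended by 0, then follows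
  by induction.\<close>

definition flat :: "nat \<Rightarrow> real \<Rightarrow> real \<Rightarrow> real"
  where "flat k c t = (if t > 0 then (1 / t) ^ k * exp (- c / t) else 0)"

text \<open>Substituting s = c/t turns this into s^k / exp s \<longlonglongrightarrow> 0 at
  infinity.\<close>

lemma flat_tendsto_0:
  assumes "c > 0"
  shows "(flat k c \<longlongrightarrow> 0) (at_right 0)"
proof -
  have "filterlim (\<lambda>t. c / t) at_top (at_right (0::real))"
    using assms by real_asymp
  from filterlim_compose[OF tendsto_power_div_exp_0[of k] this]
  have "((\<lambda>t. (1 / c) ^ k * ((c / t) ^ k / exp (c / t))) \<longlongrightarrow> 0) (at_right 0)"
    by (rule tendsto_mult_right_zero)
  then show ?thesis
    by (rule Lim_transform_eventually)
      (use assms in \<open>auto simp: flat_def eventually_at_right_field exp_minus field_simps power_divide intro!: exI[of _ 1]\<close>)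
qed

lemma flat_tendsto_0': "c > 0 \<Longrightarrow> (flat k c \<longlongrightarrow> 0) (at 0)"
proof (rule filterlim_split_at)
  show "(flat k c \<longlongrightarrow> 0) (at_left 0)"
    by (rule Lim_transform_eventually[OF tendsto_const])
      (auto simp: flat_def eventually_at_left_field intro!: exI[of _ "-1"])
qed (rule flat_tendsto_0)

lemma flat_deriv:
  assumes c: "c > 0"
  shows "(flat k c has_real_derivative c * flat (k + 2) c t - k * flat (k + 1) c t) (at t)"
proof -
  consider "t > 0" | "t < 0" | "t = 0" by linarith
  then show ?thesis
  proof cases
    case 1
    define s where "s = 1 / t"
    have s: "((\<lambda>t. 1 / t) has_real_derivative - (s\<^sup>2)) (at t)"
      using 1 by (auto intro!: derivative_eq_intros simp: s_def power2_eq_square)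
    have "((\<lambda>t. (1 / t) ^ k * exp (- c * (1 / t))) has_real_derivative
        (real k * (- (s\<^sup>2) * s ^ (k - 1))) * exp (- c * s) + exp (- c * s) * (- c * - (s\<^sup>2)) * s ^ k) (at t)"
      unfolding s_def
      by (intro DERIV_mult DERIV_fun_exp DERIV_cmult s[unfolded s_def])
        (use DERIV_power[OF s, of k] in \<open>simp add: s_def\<close>)
    \<comment> \<open>The split on \<open>k\<close> is needed for the truncated exponent
      \<open>k - 1\<close>: at \<open>k = 0\<close> the factor \<open>real k\<close> removes that
      term.\<close>
    also have "(real k * (- (s\<^sup>2) * s ^ (k - 1))) * exp (- c * s) + exp (- c * s) * (- c * - (s\<^sup>2)) * s ^ k
        = c * flat (k + 2) c t - k * flat (k + 1) c t"
      using 1 by (cases k) (simp_all add: flat_def flip: s_def, simp_all add: s_def power2_eq_square algebra_simps)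
    finally have "((\<lambda>t. (1 / t) ^ k * exp (- c / t)) has_real_derivative c * flat (k + 2) c t - k * flat (k + 1) c t) (at t)"
      by simp
    then show ?thesis
      by (rule has_field_derivative_transform_within_open[of _ _ _ "{0<..}"]) (use 1 in \<open>auto simp: flat_def\<close>)
  next
    case 2
    have "((\<lambda>t. 0) has_real_derivative 0) (at t)" by simp
    then have "(flat k c has_real_derivative 0) (at t)"
      by (rule has_field_derivative_transform_within_open[of _ _ _ "{..<0}"]) (use 2 in \<open>auto simp: flat_def\<close>)
    then show ?thesis using 2 by (simp add: flat_def)
  next
    case 3
    \<comment> \<open>Dividing by \<open>h\<close> raises the exponent of \<open>1 / h\<close> by
      one, so the difference quotient at 0 is \<open>flat (Suc k) c h\<close>.\<close>
    have "((\<lambda>h. (flat k c (0 + h) - flat k c 0) / h) \<longlongrightarrow> 0) (at 0)"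
      by (rule Lim_transform_eventually[OF flat_tendsto_0'[OF c, of "Suc k"]]) (auto simp: flat_def)
    then show ?thesis using 3 by (simp add: DERIV_def flat_def)
  qed
qed

text \<open>The values 1 and -1 of \<sigma> give the two flanks of a bump. \<open>k\<close> stays
  arbitrary in the induction because a derivative raises it by 1 and by 2.\<close>

lemma Ck_flat:
  assumes c: "c > 0"
  shows "Ck m (\<lambda>x. flat k c (\<sigma> * x $ j + \<tau>))"
proof (induction m arbitrary: k)
  case 0
  have "continuous_on UNIV (flat k c)"
    by (intro continuous_at_imp_continuous_on ballI DERIV_isCont[OF flat_deriv[OF c]])
  then show ?case
    unfolding Ck.simps
    by (rule continuous_on_compose2[of UNIV "flat k c" UNIV "\<lambda>x. \<sigma> * x $ j + \<tau>"])
      (auto intro!: continuous_intros)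
next
  case (Suc m)
  define D where "D x = c * flat (k + 2) c (\<sigma> * x $ j + \<tau>) - k * flat (k + 1) c (\<sigma> * x $ j + \<tau>)" for x
  show ?case
  proof (rule Ck_Suc_I)
    show "((\<lambda>x. flat k c (\<sigma> * x $ j + \<tau>)) has_derivative (\<lambda>h. D x * (\<sigma> * h $ j))) (at x)" for x
    proof -
      have "((\<lambda>x. \<sigma> * x $ j + \<tau>) has_derivative (\<lambda>h. \<sigma> * h $ j)) (at x)"
        by (auto intro!: derivative_eq_intros bounded_linear_imp_has_derivative bounded_linear_vec_nth)
      from has_derivative_compose[OF this flat_deriv[OF c, of k, unfolded has_field_derivative_def]]
      show ?thesis by (simp add: D_def mult_ac)
    qed
    have "Ck m D"
      using Ck_add[OF Ck_bounded_linear[OF bounded_linear_mult_right Suc.IH[of "k + 2"], of c]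
           Ck_bounded_linear[OF bounded_linear_mult_right Suc.IH[of "k + 1"], of "- real k"]]
      unfolding D_def by simp
    then show "Ck m (\<lambda>x. D x * (\<sigma> * axis i 1 $ j))" for i
      by (rule Ck_bounded_linear[OF bounded_linear_mult_left])
  qed
qed

text \<open>The exponent \<open>1 / Suc n\<close> makes the bumps converge to the indicator function as \<open>n \<rightarrow> \<infinity>\<close>.\<close>

definition bmp :: "nat \<Rightarrow> real \<Rightarrow> real \<Rightarrow> real \<Rightarrow> real"
  where "bmp n a b t = flat 0 (1 / Suc n) (t - a) * flat 0 (1 / Suc n) (b - t)"

definition bmp' :: "nat \<Rightarrow> real \<Rightarrow> real \<Rightarrow> real \<Rightarrow> real"
  where "bmp' n a b t = (flat 2 (1 / Suc n) (t - a) * flat 0 (1 / Suc n) (b - t)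
    - flat 0 (1 / Suc n) (t - a) * flat 2 (1 / Suc n) (b - t)) / Suc n"

lemma bmp_deriv: "(bmp n a b has_real_derivative bmp' n a b t) (at t)"
proof -
  have d: "(flat 0 (1 / Suc n) has_real_derivative flat 2 (1 / Suc n) s / Suc n) (at s)" for s
    using flat_deriv[of "1 / Suc n" 0 s] by (simp add: numeral_2_eq_2)
  have "((\<lambda>t. flat 0 (1 / Suc n) (t - a)) has_real_derivative flat 2 (1 / Suc n) (t - a) / Suc n * 1) (at t)"
    by (rule DERIV_chain2[OF d]) (auto intro!: derivative_eq_intros)
  moreover have "((\<lambda>t. flat 0 (1 / Suc n) (b - t)) has_real_derivative flat 2 (1 / Suc n) (b - t) / Suc n * (-1)) (at t)"
    by (rule DERIV_chain2[OF d]) (auto intro!: derivative_eq_intros)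
  ultimately show ?thesis
    unfolding bmp_def[abs_def] bmp'_def
    by (rule DERIV_mult[THEN DERIV_cong]) (simp add: diff_divide_distrib mult.commute)
qed

lemma flat_continuous: "c > 0 \<Longrightarrow> continuous_on A (flat k c)"
  by (intro continuous_at_imp_continuous_on ballI DERIV_isCont[OF flat_deriv])

lemma bmp_continuous:
  assumes "continuous_on A f"
  shows "continuous_on A (\<lambda>x. bmp n a b (f x))" "continuous_on A (\<lambda>x. bmp' n a b (f x))"
  unfolding bmp_def bmp'_def
  by (intro continuous_intros continuous_on_compose2[OF flat_continuous[of _ UNIV]] assms; simp)+

lemma bmp_nonneg: "0 \<le> bmp n a b t"
  by (simp add: bmp_def flat_def)

lemma bmp_le_1: "bmp n a b t \<le> 1"
  unfolding bmp_def by (intro mult_le_one) (auto simp: flat_def)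

lemma bmp_eq_0: "t \<le> a \<or> b \<le> t \<Longrightarrow> bmp n a b t = 0" "t \<le> a \<or> b \<le> t \<Longrightarrow> bmp' n a b t = 0"
  by (auto simp: bmp_def bmp'_def flat_def)

lemma bmp_tendsto: "(\<lambda>n. bmp n a b t) \<longlonglongrightarrow> (if a < t \<and> t < b then 1 else 0)"
proof (cases "a < t \<and> t < b")
  case True
  have e: "(\<lambda>n. exp (- (1 / Suc n) / s)) \<longlonglongrightarrow> 1" if "s > 0" for s :: real
    using that by real_asymp
  have "(\<lambda>n. bmp n a b t) \<longlonglongrightarrow> 1 * 1"
    unfolding bmp_def using True by (simp only: flat_def) (intro tendsto_mult, auto intro: e[simplified])
  then show ?thesis using True by simp
next
  case False
  then show ?thesis by (auto simp: bmp_eq_0)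
qed

definition bump :: "nat \<Rightarrow> real \<Rightarrow> real \<Rightarrow> real \<Rightarrow> real \<Rightarrow> real ^ 2 \<Rightarrow> real"
  where "bump n a b c d z = bmp n a b (z $ 1) * bmp n c d (z $ 2)"

definition bump1 :: "nat \<Rightarrow> real \<Rightarrow> real \<Rightarrow> real \<Rightarrow> real \<Rightarrow> real ^ 2 \<Rightarrow> real"
  where "bump1 n a b c d z = bmp' n a b (z $ 1) * bmp n c d (z $ 2)"

definition bump2 :: "nat \<Rightarrow> real \<Rightarrow> real \<Rightarrow> real \<Rightarrow> real \<Rightarrow> real ^ 2 \<Rightarrow> real"
  where "bump2 n a b c d z = bmp n a b (z $ 1) * bmp' n c d (z $ 2)"

text \<open>The mixed derivative, on which two integrations by parts in opposite orders
  meet.\<close>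

definition bump12 :: "nat \<Rightarrow> real \<Rightarrow> real \<Rightarrow> real \<Rightarrow> real \<Rightarrow> real ^ 2 \<Rightarrow> real"
  where "bump12 n a b c d z = bmp' n a b (z $ 1) * bmp' n c d (z $ 2)"

lemma bump_continuous:
  "continuous_on A (bump n a b c d)" "continuous_on A (bump1 n a b c d)"
  "continuous_on A (bump2 n a b c d)" "continuous_on A (bump12 n a b c d)"
  unfolding bump_def[abs_def] bump1_def[abs_def] bump2_def[abs_def] bump12_def[abs_def]
  by (intro continuous_intros bmp_continuous)+

lemma bump_pd:
  "pd1 (bump n a b c d) (bump1 n a b c d)" "pd2 (bump n a b c d) (bump2 n a b c d)"
  "pd2 (bump1 n a b c d) (bump12 n a b c d)" "pd1 (bump2 n a b c d) (bump12 n a b c d)"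
  unfolding pd1_def pd2_def
  by (simp_all add: bump_continuous)
    (auto intro!: derivative_eq_intros bmp_deriv simp: bump_def bump1_def bump2_def bump12_def)

lemma bump_eq_0:
  assumes "z \<notin> rect a b c d"
  shows "bump n a b c d z = 0" "bump1 n a b c d z = 0" "bump2 n a b c d z = 0" "bump12 n a b c d z = 0"
  using assms by (auto simp: bump_def bump1_def bump2_def bump12_def mem_rect bmp_eq_0 not_less)

lemma bump_bounds: "0 \<le> bump n a b c d z" "bump n a b c d z \<le> 1"
  unfolding bump_def by (auto intro!: mult_nonneg_nonneg mult_le_one bmp_nonneg bmp_le_1)

lemma bump_test_function:
  assumes "crect a b c d \<subseteq> S"
  shows "test_function S (bump n a b c d)"
proof -
  have "Ck k (bump n a b c d)" for k
  proof -
    have "Ck k (\<lambda>z::real^2. bmp n a b (z $ i))" for i a b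
      using Ck_mult[OF Ck_flat[of "1 / Suc n" k 0 1 i "-a"] Ck_flat[of "1 / Suc n" k 0 "-1" i b]]
      by (simp add: bmp_def)
    then show ?thesis
      unfolding bump_def[abs_def] by (intro Ck_mult)
  qed
  moreover have sub: "closure {z. bump n a b c d z \<noteq> 0} \<subseteq> crect a b c d"
    by (rule closure_minimal) (use bump_eq_0(1)[of _ a b c d n] in \<open>force simp: mem_rect mem_crect\<close>, simp add: crect_def closed_cbox)
  moreover have "compact (crect a b c d \<inter> closure {z. bump n a b c d z \<noteq> 0})"
    by (intro compact_Int_closed) (auto simp: crect_def)
  ultimately show ?thesis
    using assms by (simp add: test_function_def smooth_def inf.absorb2)
qed

lemma Ck_pd:
  fixes F :: "real ^ 2 \<Rightarrow> real"
  assumes "Ck (Suc k) F"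
  shows "pd1 F (pderivative 1 F)" "pd2 F (pderivative 2 F)"
proof -
  have d: "(F has_derivative frechet_derivative F (at z)) (at z)" for z
    by (rule Ck_Suc_D(1)[OF assms])
  have lin: "linear (frechet_derivative F (at z))" for z
    by (rule has_derivative_linear[OF d])
  have "((\<lambda>t. F (pt t y)) has_derivative (\<lambda>h. frechet_derivative F (at (pt x y)) (h *\<^sub>R axis 1 1))) (at x)" for x y
    by (rule has_derivative_compose[OF _ d]) (unfold pt_alt, auto intro!: derivative_eq_intros)
  then have 1: "((\<lambda>t. F (pt t y)) has_real_derivative pderivative 1 F (pt x y)) (at x)" for x y
    unfolding has_field_derivative_def pderivative_def linear_scale[OF lin] by (simp add: mult_commute_abs)
  have "((\<lambda>t. F (pt x t)) has_derivative (\<lambda>h. frechet_derivative F (at (pt x y)) (h *\<^sub>R axis 2 1))) (at y)" for x y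
    by (rule has_derivative_compose[OF _ d]) (unfold pt_alt, auto intro!: derivative_eq_intros)
  then have 2: "((\<lambda>t. F (pt x t)) has_real_derivative pderivative 2 F (pt x y)) (at y)" for x y
    unfolding has_field_derivative_def pderivative_def linear_scale[OF lin] by (simp add: mult_commute_abs)
  show "pd1 F (pderivative 1 F)" "pd2 F (pderivative 2 F)"
    unfolding pd1_def pd2_def using 1 2 Ck_continuous[OF assms] Ck_continuous[OF Ck_Suc_D(2)[OF assms]] by auto
qed

section \<open>The fundamental lemma of the calculus of variations\<close>

text \<open>Bumps increase to indicators of rectangles, rectangles generate the Borel sets, and
  Lebesgue sets differ from Borel sets by null sets. So the integral of \<open>h\<close> over every
  measurable set vanishes.\<close>

lemma AE_zero_if_bump:
  assumes h: "integrable (lebesgue_on (rect A B C D)) h"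
    and bump: "\<And>n a b c d. crect a b c d \<subseteq> rect A B C D \<Longrightarrow>
      (LINT z|lebesgue_on (rect A B C D). bump n a b c d z * h z) = 0"
  shows "AE z in lebesgue_on (rect A B C D). h z = 0"
proof -
  define S where "S = rect A B C D"
  define M where "M = lebesgue_on S"
  have h: "integrable M h" and [measurable]: "h \<in> borel_measurable M"
    using h by (simp_all add: M_def S_def borel_measurable_integrable)
  have sp: "space M = S" by (simp add: M_def)
  have cm: "f \<in> borel_measurable M" if "continuous_on UNIV f" for f :: "real ^ 2 \<Rightarrow> real"
    using rect_borel_measurable[OF that] by (simp add: M_def S_def)
  have sets_rect: "rect a b c d \<inter> S \<in> sets M" for a b c d
    unfolding M_def by (subst sets_restrict_space_iff) (auto simp: S_def)
  have im: "(\<lambda>z. indicator (rect a b c d) z :: real) \<in> borel_measurable M" for a b c d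
    using borel_measurable_indicator[OF sets_rect[of a b c d]]
    by (rule measurable_cong[THEN iffD1, rotated]) (auto simp: sp indicator_def)
  have step1: "(LINT z|M. indicator (rect a b c d) z * h z) = 0" if sub: "crect a b c d \<subseteq> S" for a b c d
  proof -
    have "(\<lambda>n. LINT z|M. bump n a b c d z * h z) \<longlonglongrightarrow> (LINT z|M. indicator (rect a b c d) z * h z)"
    proof (rule integral_dominated_convergence)
      show "integrable M (\<lambda>z. \<bar>h z\<bar>)" using h by simp
      show "(\<lambda>z. bump n a b c d z * h z) \<in> borel_measurable M" for n
        using cm[OF bump_continuous(1)] by measurable
      show "(\<lambda>z. indicator (rect a b c d) z * h z) \<in> borel_measurable M"
        using im by measurable
      show "AE z in M. norm (bump n a b c d z * h z) \<le> \<bar>h z\<bar>" for n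
        using bump_bounds[of n a b c d] by (auto simp: abs_mult mult_left_le_one_le)
      have "(\<lambda>n. bump n a b c d z * h z) \<longlonglongrightarrow> indicator (rect a b c d) z * h z" for z
        unfolding bump_def
        by (rule tendsto_eq_intros bmp_tendsto refl)+ (auto simp: mem_rect indicator_def)
      then show "AE z in M. (\<lambda>n. bump n a b c d z * h z) \<longlonglongrightarrow> indicator (rect a b c d) z * h z" by simp
    qed
    moreover have "(LINT z|M. bump n a b c d z * h z) = 0" for n
      using bump[of a b c d n] sub by (simp add: M_def S_def)
    ultimately show ?thesis by (simp add: LIMSEQ_const_iff)
  qed
  have step2: "(LINT z|M. indicator (rect a b c d) z * h z) = 0" for a b c d
  proof -
    \<comment> \<open>Clip to \<open>S\<close>, then shrink by \<open>1 / Suc n\<close>: the closed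
      rectangles lie in \<open>S\<close>, as \<open>step1\<close> demands, and exhaust the part of
      \<open>rect a b c d\<close> inside \<open>S\<close>.\<close>
    define a' b' c' d' where "a' n = max a A + 1 / Suc n" and "b' n = min b B - 1 / Suc n"
      and "c' n = max c C + 1 / Suc n" and "d' n = min d D - 1 / Suc n" for n
    have pos: "0 < 1 / real (Suc n)" for n by simp
    have lim: "(\<lambda>n. LINT z|M. indicator (rect (a' n) (b' n) (c' n) (d' n)) z * h z) \<longlonglongrightarrow>
        (LINT z|M. indicator (rect a b c d) z * h z)"
    proof (rule integral_dominated_convergence)
      show "integrable M (\<lambda>z. \<bar>h z\<bar>)" using h by simp
      show "(\<lambda>z. indicator (rect (a' n) (b' n) (c' n) (d' n)) z * h z) \<in> borel_measurable M" for n
        using im by measurable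
      show "(\<lambda>z. indicator (rect a b c d) z * h z) \<in> borel_measurable M"
        using im by measurable
      show "AE z in M. norm (indicator (rect (a' n) (b' n) (c' n) (d' n)) z * h z) \<le> \<bar>h z\<bar>" for n
        by (auto simp: indicator_def)
      have "(\<lambda>n. indicator (rect (a' n) (b' n) (c' n) (d' n)) z * h z) \<longlonglongrightarrow> indicator (rect a b c d) z * h z"
        if z: "z \<in> S" for z
      proof (cases "z \<in> rect a b c d")
        case True
        have "(\<lambda>n. a' n) \<longlonglongrightarrow> max a A" "(\<lambda>n. b' n) \<longlonglongrightarrow> min b B" "(\<lambda>n. c' n) \<longlonglongrightarrow> max c C" "(\<lambda>n. d' n) \<longlonglongrightarrow> min d D"
          unfolding a'_def b'_def c'_def d'_def by real_asymp+
        then have "\<forall>\<^sub>F n in sequentially. a' n < z $ 1" "\<forall>\<^sub>F n in sequentially. z $ 1 < b' n"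
          "\<forall>\<^sub>F n in sequentially. c' n < z $ 2" "\<forall>\<^sub>F n in sequentially. z $ 2 < d' n"
          using True z by (auto simp: S_def mem_rect intro: order_tendstoD)
        then have "\<forall>\<^sub>F n in sequentially. indicator (rect a b c d) z * h z = indicator (rect (a' n) (b' n) (c' n) (d' n)) z * h z"
          by eventually_elim (use True in \<open>simp add: mem_rect indicator_def\<close>)
        then show ?thesis by (rule Lim_transform_eventually[OF tendsto_const])
      next
        case False
        have "rect (a' n) (b' n) (c' n) (d' n) \<subseteq> rect a b c d" for n
        proof -
          have "a \<le> a' n" "b' n \<le> b" "c \<le> c' n" "d' n \<le> d"
            unfolding a'_def b'_def c'_def d'_def using pos[of n] by linarith+
          then show ?thesis by (auto simp: mem_rect)
        qed
        then have "z \<notin> rect (a' n) (b' n) (c' n) (d' n)" for n using False by blast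
        then show ?thesis using False by simp
      qed
      then show "AE z in M. (\<lambda>n. indicator (rect (a' n) (b' n) (c' n) (d' n)) z * h z) \<longlonglongrightarrow> indicator (rect a b c d) z * h z"
        by (intro AE_I2) (simp add: sp)
    qed
    have sub: "crect (a' n) (b' n) (c' n) (d' n) \<subseteq> S" for n
    proof -
      have "A < a' n" "b' n < B" "C < c' n" "d' n < D"
        unfolding a'_def b'_def c'_def d'_def using pos[of n] by linarith+
      then show ?thesis by (auto simp: S_def mem_rect mem_crect)
    qed
    show ?thesis using lim by (simp add: step1[OF sub] LIMSEQ_const_iff)
  qed
  have int: "integrable M (\<lambda>z. indicator (A' \<inter> S) z * h z)" if "A' \<in> sets borel" for A'
  proof -
    have "A' \<inter> S \<in> sets M"
      unfolding M_def using that by (subst sets_restrict_space_iff) (auto simp: S_def)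
    then show ?thesis
      using integrable_mult_indicator[OF _ h] by simp
  qed
  have step3: "(LINT z|M. indicator (A' \<inter> S) z * h z) = 0" if "A' \<in> sets borel" for A'
  proof -
    define G where "G = range (\<lambda>(a, b). box a b :: (real ^ 2) set)"
    have sb: "sets borel = sigma_sets UNIV G"
      unfolding G_def by (subst borel_eq_box) simp
    have box: "(LINT z|M. indicator (box u v \<inter> S) z * h z) = 0" for u v
    proof -
      have "box u v = rect (u $ 1) (v $ 1) (u $ 2) (v $ 2)" by (simp add: rect_def)
      then have "(LINT z|M. indicator (box u v \<inter> S) z * h z)
          = (LINT z|M. indicator (rect (u $ 1) (v $ 1) (u $ 2) (v $ 2)) z * h z)"
        by (intro Bochner_Integration.integral_cong) (auto simp: sp indicator_def)
      then show ?thesis by (simp add: step2)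
    qed
    have "box u v \<in> G" for u v
      unfolding G_def by (rule range_eqI[of _ _ "(u, v)"]) simp
    then have "Int_stable G"
      unfolding Int_stable_def by (auto simp: G_def box_Int_box)
    moreover have "G \<subseteq> Pow UNIV" "A' \<in> sigma_sets UNIV G"
      using that by (auto simp: sb)
    ultimately
    show ?thesis
    proof (induction rule: sigma_sets_induct_disjoint)
      case (basic A') then show ?case using box by (auto simp: G_def)
    next
      case empty then show ?case by simp
    next
      case (compl A')
      then have A': "A' \<in> sets borel" by (simp add: sb)
      have "(LINT z|M. indicator ((UNIV - A') \<inter> S) z * h z) = (LINT z|M. h z - indicator (A' \<inter> S) z * h z)"
        by (rule Bochner_Integration.integral_cong) (auto simp: sp indicator_def)
      also have "\<dots> = (LINT z|M. h z)"
        using compl int[OF A'] h by simp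
      \<comment> \<open>The complement step needs the total integral. \<open>S\<close> is itself a
        rectangle, and \<open>step2\<close> covers rectangles that reach the boundary of
        \<open>S\<close>.\<close>
      also have "\<dots> = (LINT z|M. indicator (rect A B C D) z * h z)"
        by (rule Bochner_Integration.integral_cong) (auto simp: sp S_def)
      finally show ?case by (simp add: step2)
    next
      case (union F)
      then have F: "F i \<in> sets borel" for i by (auto simp: sb)
      have FS: "F i \<inter> S \<in> sets M" for i
        unfolding M_def using F by (subst sets_restrict_space_iff) (auto simp: S_def)
      have "(LINT z:(\<Union>i. F i \<inter> S)|M. h z) = (\<Sum>i. (LINT z:(F i \<inter> S)|M. h z))"
      proof (rule lebesgue_integral_countable_add)
        show "set_integrable M (\<Union>i. F i \<inter> S) h"
          unfolding set_integrable_def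
          by (rule integrable_mult_indicator[OF _ h]) (use FS in \<open>auto simp del: UN_simps\<close>)
        show "(F i \<inter> S) \<inter> (F j \<inter> S) = {}" if "i \<noteq> j" for i j
          using union.hyps(1) that by (auto simp: disjoint_family_on_def)
      qed (rule FS)
      then show ?case
        using union by (simp add: set_lebesgue_integral_def)
    qed
  qed
  have "AE z in M. h z = 0"
  proof (rule sigma_finite_measure.density_zero[OF _ h])
    show "sigma_finite_measure M"
      using rect_finite_measure[of A B C D] unfolding M_def S_def finite_measure_def by blast
    fix A' assume A': "A' \<in> sets M"
    then have sub: "A' \<subseteq> S" "A' \<in> sets lebesgue"
      unfolding M_def by (auto simp: sets_restrict_space_iff S_def)
    \<comment> \<open>\<open>sets M\<close> consists of Lebesgue sets, while \<open>step3\<close> is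
      about Borel sets; replace the given set by its Borel part \<open>B0\<close>.\<close>
    then obtain B0 N N' where A'_eq: "A' = B0 \<union> N" "N \<subseteq> N'" "N' \<in> null_sets lborel" "B0 \<in> sets lborel"
      by (meson sets_completionE)
    have N': "AE z in M. z \<notin> N'"
    proof -
      have "AE z in lborel. z \<notin> N'" using A'_eq(3) by (rule AE_not_in)
      then have "AE z in lebesgue. z \<notin> N'" by (rule AE_completion)
      then show ?thesis unfolding M_def S_def by (subst AE_restrict_space_iff) auto
    qed
    have "set_lebesgue_integral M A' h = (LINT z|M. indicator (B0 \<inter> S) z * h z)"
      unfolding set_lebesgue_integral_def
    proof (rule integral_cong_AE)
      show "(\<lambda>z. indicator A' z *\<^sub>R h z) \<in> borel_measurable M" using A' by measurable
      show "(\<lambda>z. indicator (B0 \<inter> S) z * h z) \<in> borel_measurable M"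
        using int[of B0] A'_eq(4) by (simp add: borel_measurable_integrable)
      show "AE z in M. indicator A' z *\<^sub>R h z = indicator (B0 \<inter> S) z * h z"
        using N' by eventually_elim (use A'_eq sub in \<open>auto simp: indicator_def\<close>)
    qed
    also have "\<dots> = 0" using A'_eq(4) by (intro step3) simp
    finally show "set_lebesgue_integral M A' h = 0" .
  qed
  then show ?thesis unfolding M_def S_def .
qed

section \<open>Mean square limits of smooth functions together with their derivatives\<close>

text \<open>The open rectangle does not contain its sides, so \<theta> vanishes on them and the
  boundary integrals drop out.\<close>

lemma ibp1:
  assumes \<theta>: "pd1 \<theta> \<theta>1" and F: "pd1 F F1" and "A \<le> B"
    and 0: "\<And>z. z \<notin> rect A B C D \<Longrightarrow> \<theta> z = 0"
  shows "(LINT z|lebesgue_on (rect A B C D). \<theta> z * F1 z) = - (LINT z|lebesgue_on (rect A B C D). \<theta>1 z * F z)"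
proof -
  have i: "integrable (lebesgue_on (rect A B C D)) (\<lambda>z. \<theta> z * F1 z)" "integrable (lebesgue_on (rect A B C D)) (\<lambda>z. \<theta>1 z * F z)"
    by (intro rect_integrable continuous_intros pd_continuous(1,2)[OF \<theta>] pd_continuous(1,2)[OF F])+
  have "(LINT z|lebesgue_on (rect A B C D). \<theta>1 z * F z + \<theta> z * F1 z)
      = integral {C..D} (\<lambda>y. \<theta> (pt B y) * F (pt B y) - \<theta> (pt A y) * F (pt A y))"
    by (rule LINT_pd1[OF pd1_mult[OF \<theta> F] \<open>A \<le> B\<close>])
  also have "\<dots> = 0" by (simp add: 0 mem_rect)
  finally show ?thesis using i by simp
qed

lemma ibp2:
  assumes \<theta>: "pd2 \<theta> \<theta>2" and F: "pd2 F F2" and "C \<le> D"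
    and 0: "\<And>z. z \<notin> rect A B C D \<Longrightarrow> \<theta> z = 0"
  shows "(LINT z|lebesgue_on (rect A B C D). \<theta> z * F2 z) = - (LINT z|lebesgue_on (rect A B C D). \<theta>2 z * F z)"
proof -
  have i: "integrable (lebesgue_on (rect A B C D)) (\<lambda>z. \<theta> z * F2 z)" "integrable (lebesgue_on (rect A B C D)) (\<lambda>z. \<theta>2 z * F z)"
    by (intro rect_integrable continuous_intros pd_continuous(3,4)[OF \<theta>] pd_continuous(3,4)[OF F])+
  have "(LINT z|lebesgue_on (rect A B C D). \<theta>2 z * F z + \<theta> z * F2 z)
      = integral {A..B} (\<lambda>x. \<theta> (pt x D) * F (pt x D) - \<theta> (pt x C) * F (pt x C))"
    by (rule LINT_pd2[OF pd2_mult[OF \<theta> F] \<open>C \<le> D\<close>])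
  also have "\<dots> = 0" by (simp add: 0 mem_rect)
  finally show ?thesis using i by simp
qed

text \<open>\<open>C2\<close> is shaped so that only derivatives along coordinate lines are needed; the two mixed
  derivatives agree almost everywhere by \<open>C2_mixed\<close>.\<close>

definition C2 :: "(real ^ 2 \<Rightarrow> real) \<Rightarrow> (real ^ 2 \<Rightarrow> real) \<Rightarrow> (real ^ 2 \<Rightarrow> real) \<Rightarrow>
    (real ^ 2 \<Rightarrow> real) \<Rightarrow> (real ^ 2 \<Rightarrow> real) \<Rightarrow> bool"
  where "C2 F F1 F2 F12 F21 \<longleftrightarrow> pd1 F F1 \<and> pd2 F F2 \<and> pd2 F1 F12 \<and> pd1 F2 F21"

section \<open>Functions on a rectangle with strong derivatives in mean square\<close>

locale rectangle =
  fixes A B C D :: real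
  assumes AB: "A \<le> B" and CD: "C \<le> D"
begin

definition "S = rect A B C D"

definition "M = lebesgue_on S"

lemma space_M [simp]: "space M = S" by (simp add: M_def)

sublocale finite_measure M
  unfolding M_def S_def by (rule rect_finite_measure)

lemma cont_measurable: "continuous_on UNIV f \<Longrightarrow> f \<in> borel_measurable M" for f :: "real ^ 2 \<Rightarrow> real"
  unfolding M_def S_def by (rule rect_borel_measurable)

lemma cont_integrable: "continuous_on UNIV f \<Longrightarrow> integrable M f" for f :: "real ^ 2 \<Rightarrow> real"
  unfolding M_def S_def by (rule rect_integrable) (rule continuous_on_subset, auto)

lemma L2lim_mult_cont:
  assumes "L2lim M V v" "L2lim M W w" "continuous_on UNIV \<theta>"
  shows "(\<lambda>n. LINT z|M. \<theta> z * (V n z * W n z)) \<longlonglongrightarrow> (LINT z|M. \<theta> z * (v z * w z))"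
    and "integrable M (\<lambda>z. \<theta> z * (V n z * W n z))" "integrable M (\<lambda>z. \<theta> z * (v z * w z))"
proof -
  obtain K where "\<And>z. z \<in> S \<Longrightarrow> \<bar>\<theta> z\<bar> \<le> K"
    unfolding S_def using bounded_on_rect[OF assms(3)] by blast
  then show "(\<lambda>n. LINT z|M. \<theta> z * (V n z * W n z)) \<longlonglongrightarrow> (LINT z|M. \<theta> z * (v z * w z))"
    and "integrable M (\<lambda>z. \<theta> z * (V n z * W n z))" "integrable M (\<lambda>z. \<theta> z * (v z * w z))"
    using L2lim_mult[OF assms(1,2) cont_measurable[OF assms(3)], of K] by simp_all
qed

lemma L2lim_weighted_cont:
  assumes "L2lim M V v" "continuous_on UNIV \<theta>"
  shows "(\<lambda>n. LINT z|M. \<theta> z * V n z) \<longlonglongrightarrow> (LINT z|M. \<theta> z * v z)"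
    and "integrable M (\<lambda>z. \<theta> z * v z)"
  using L2lim_mult_cont[OF assms(1) L2lim_const[OF finite_measure_axioms, of 1] assms(2)] by simp_all

text \<open>W^{1,2} as a closure: identities proved for the approximants pass to the limit. The
  mixed derivatives of the approximants need not converge; they are there so that integration by
  parts can be applied to \<open>V1\<close> and \<open>V2\<close>, and they cancel before the limit
  is taken.\<close>

definition strong :: "(real ^ 2 \<Rightarrow> real) \<Rightarrow> (real ^ 2 \<Rightarrow> real) \<Rightarrow> (real ^ 2 \<Rightarrow> real) \<Rightarrow> bool"
  where "strong v v1 v2 \<longleftrightarrow> (\<exists>V V1 V2 V12 V21. (\<forall>n. C2 (V n) (V1 n) (V2 n) (V12 n) (V21 n)) \<and>
    L2lim M V v \<and> L2lim M V1 v1 \<and> L2lim M V2 v2)"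

lemma strongE:
  assumes "strong v v1 v2"
  obtains V V1 V2 V12 V21 where "\<And>n. pd1 (V n) (V1 n)" "\<And>n. pd2 (V n) (V2 n)"
    "\<And>n. pd2 (V1 n) (V12 n)" "\<And>n. pd1 (V2 n) (V21 n)"
    "L2lim M V v" "L2lim M V1 v1" "L2lim M V2 v2"
  using assms unfolding strong_def C2_def by blast

lemma strongD:
  assumes "strong v v1 v2"
  shows "v \<in> borel_measurable M" "v1 \<in> borel_measurable M" "v2 \<in> borel_measurable M"
    "integrable M (\<lambda>z. (v z)\<^sup>2)" "integrable M (\<lambda>z. (v1 z)\<^sup>2)" "integrable M (\<lambda>z. (v2 z)\<^sup>2)"
    "integrable M v" "integrable M v1" "integrable M v2"
proof -
  have i: "integrable M f" if "L2lim M V f" for V f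
    using integrable_mult_square[OF L2limD(1)[OF that] L2limD(1)[OF L2lim_const[OF finite_measure_axioms, of 1]]]
      L2limD(2)[OF that] L2limD(2)[OF L2lim_const[OF finite_measure_axioms, of 1]] by simp
  show "v \<in> borel_measurable M" "v1 \<in> borel_measurable M" "v2 \<in> borel_measurable M"
    "integrable M (\<lambda>z. (v z)\<^sup>2)" "integrable M (\<lambda>z. (v1 z)\<^sup>2)" "integrable M (\<lambda>z. (v2 z)\<^sup>2)"
    "integrable M v" "integrable M v1" "integrable M v2"
    using assms unfolding strong_def by (blast intro: L2limD(1,2) i)+
qed

lemma AE_zero:
  assumes "integrable M h"
    and "\<And>n a b c d. crect a b c d \<subseteq> S \<Longrightarrow> (LINT z|M. bump n a b c d z * h z) = 0"
  shows "AE z in M. h z = 0"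
  using assms unfolding M_def S_def by (rule AE_zero_if_bump)

lemma bump_0:
  assumes "crect a b c d \<subseteq> S" "z \<notin> S"
  shows "bump n a b c d z = 0" "bump1 n a b c d z = 0" "bump2 n a b c d z = 0"
proof -
  have "z \<notin> rect a b c d" using assms by (auto simp: mem_rect mem_crect subset_iff)
  then show "bump n a b c d z = 0" "bump1 n a b c d z = 0" "bump2 n a b c d z = 0"
    by (simp_all add: bump_eq_0)
qed

lemmas ibp1_M = ibp1[OF _ _ AB, of _ _ _ _ C D, folded S_def, folded M_def]
lemmas ibp2_M = ibp2[OF _ _ CD, of _ _ _ _ A B, folded S_def, folded M_def]

text \<open>Both sides of the integration by parts are continuous under mean square convergence.
  Strong derivatives are thus weak ones, which makes them unique.\<close>

lemma strong_weak1:
  assumes v: "strong v v1 v2" and \<theta>: "pd1 \<theta> \<theta>1" "\<And>z. z \<notin> S \<Longrightarrow> \<theta> z = 0"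
  shows "(LINT z|M. \<theta> z * v1 z) = - (LINT z|M. \<theta>1 z * v z)"
proof -
  obtain V V1 where V: "\<And>n. pd1 (V n) (V1 n)" and lim: "L2lim M V v" "L2lim M V1 v1"
    using v by (elim strongE) blast
  have "(LINT z|M. \<theta> z * V1 n z) = - (LINT z|M. \<theta>1 z * V n z)" for n
    by (rule ibp1_M[OF \<theta>(1) V \<theta>(2)])
  moreover have "(\<lambda>n. LINT z|M. \<theta> z * V1 n z) \<longlonglongrightarrow> (LINT z|M. \<theta> z * v1 z)"
    by (rule L2lim_weighted_cont[OF lim(2) pd_continuous(1)[OF \<theta>(1)]])
  moreover have "(\<lambda>n. - (LINT z|M. \<theta>1 z * V n z)) \<longlonglongrightarrow> - (LINT z|M. \<theta>1 z * v z)"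
    by (intro tendsto_minus L2lim_weighted_cont[OF lim(1) pd_continuous(2)[OF \<theta>(1)]])
  ultimately show ?thesis
    by (simp add: LIMSEQ_unique)
qed

lemma strong_weak2:
  assumes v: "strong v v1 v2" and \<theta>: "pd2 \<theta> \<theta>2" "\<And>z. z \<notin> S \<Longrightarrow> \<theta> z = 0"
  shows "(LINT z|M. \<theta> z * v2 z) = - (LINT z|M. \<theta>2 z * v z)"
proof -
  obtain V V2 where V: "\<And>n. pd2 (V n) (V2 n)" and lim: "L2lim M V v" "L2lim M V2 v2"
    using v by (elim strongE) blast
  have "(LINT z|M. \<theta> z * V2 n z) = - (LINT z|M. \<theta>2 z * V n z)" for n
    by (rule ibp2_M[OF \<theta>(1) V \<theta>(2)])
  moreover have "(\<lambda>n. LINT z|M. \<theta> z * V2 n z) \<longlonglongrightarrow> (LINT z|M. \<theta> z * v2 z)"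
    by (rule L2lim_weighted_cont[OF lim(2) pd_continuous(3)[OF \<theta>(1)]])
  moreover have "(\<lambda>n. - (LINT z|M. \<theta>2 z * V n z)) \<longlonglongrightarrow> - (LINT z|M. \<theta>2 z * v z)"
    by (intro tendsto_minus L2lim_weighted_cont[OF lim(1) pd_continuous(4)[OF \<theta>(1)]])
  ultimately show ?thesis
    by (simp add: LIMSEQ_unique)
qed

lemma AE_eqI:
  assumes "integrable M f" "integrable M g"
    and "\<And>n a b c d. crect a b c d \<subseteq> S \<Longrightarrow> (LINT z|M. bump n a b c d z * f z) = (LINT z|M. bump n a b c d z * g z)"
  shows "AE z in M. f z = g z"
proof -
  have *: "integrable M (\<lambda>z. bump n a b c d z * h z)" if h: "integrable M h" for h n a b c d
  proof (rule Bochner_Integration.integrable_bound[OF h])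
    show "(\<lambda>z. bump n a b c d z * h z) \<in> borel_measurable M"
      using h cont_measurable[OF bump_continuous(1)] by measurable
    show "AE z in M. norm (bump n a b c d z * h z) \<le> norm (h z)"
      using bump_bounds[of n a b c d] by (auto simp: abs_mult mult_left_le_one_le)
  qed
  have "AE z in M. f z - g z = 0"
    by (rule AE_zero) (use assms * in \<open>auto simp: right_diff_distrib\<close>)
  then show ?thesis by simp
qed

lemma strong_unique:
  assumes v: "strong v v1 v2" and w: "strong w w1 w2" and eq: "AE z in M. v z = w z"
  shows "AE z in M. v1 z = w1 z" "AE z in M. v2 z = w2 z"
proof -
  have *: "(LINT z|M. \<theta> z * v z) = (LINT z|M. \<theta> z * w z)" if "continuous_on UNIV \<theta>" for \<theta>
  proof (rule integral_cong_AE)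
    show "(\<lambda>z. \<theta> z * v z) \<in> borel_measurable M" "(\<lambda>z. \<theta> z * w z) \<in> borel_measurable M"
      using strongD(1)[OF v] strongD(1)[OF w] cont_measurable[OF that] by measurable
  qed (use eq in auto)
  show "AE z in M. v1 z = w1 z"
    by (rule AE_eqI[OF strongD(8)[OF v] strongD(8)[OF w]])
      (simp add: strong_weak1[OF v bump_pd(1) bump_0(1)] strong_weak1[OF w bump_pd(1) bump_0(1)] *[OF bump_continuous(2)])
  show "AE z in M. v2 z = w2 z"
    by (rule AE_eqI[OF strongD(9)[OF v] strongD(9)[OF w]])
      (simp add: strong_weak2[OF v bump_pd(2) bump_0(1)] strong_weak2[OF w bump_pd(2) bump_0(1)] *[OF bump_continuous(3)])
qed

text \<open>Tested against a bump, both sides become the integral of \<open>u\<close> against the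
  mixed derivative of the bump.\<close>

lemma strong_curl:
  assumes u: "strong u p q" and p: "strong p p1 p2" and q: "strong q q1 q2"
  shows "AE z in M. p2 z = q1 z"
  by (rule AE_eqI[OF strongD(9)[OF p] strongD(8)[OF q]])
    (simp add: strong_weak2[OF p bump_pd(2) bump_0(1)] strong_weak1[OF q bump_pd(1) bump_0(1)]
      strong_weak1[OF u bump_pd(4) bump_0(3)] strong_weak2[OF u bump_pd(3) bump_0(2)])

text \<open>Symmetry of mixed derivatives by the same exchange of integrations by parts. Equality
  almost everywhere is enough under an integral.\<close>

lemma C2_mixed:
  assumes "pd1 F F1" "pd2 F F2" "pd2 F1 F12" "pd1 F2 F21"
  shows "AE z in M. F12 z = F21 z"
proof (rule AE_eqI)
  show "integrable M F12" "integrable M F21"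
    using assms by (auto intro: cont_integrable pd_continuous)
  show "(LINT z|M. bump n a b c d z * F12 z) = (LINT z|M. bump n a b c d z * F21 z)"
    if "crect a b c d \<subseteq> S" for n a b c d
    by (simp add: ibp2_M[OF bump_pd(2) assms(3) bump_0(1)[OF that]] ibp1_M[OF bump_pd(1) assms(4) bump_0(1)[OF that]]
        ibp1_M[OF bump_pd(4) assms(1) bump_0(3)[OF that]] ibp2_M[OF bump_pd(3) assms(2) bump_0(2)[OF that]])
qed

text \<open>The limit passage in the Leibniz rule, shared by the two coordinate directions.\<close>

lemma product_limit:
  assumes vlim: "L2lim M V v" "L2lim M V' v'" and wlim: "L2lim M W w" "L2lim M W' w'"
    and c: "continuous_on UNIV \<theta>" "continuous_on UNIV \<theta>'"
    and eq: "\<And>n. (LINT z|M. \<theta> z * (V' n z * W n z + V n z * W' n z)) = - (LINT z|M. \<theta>' z * (V n z * W n z))"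
  shows "(LINT z|M. \<theta> z * (v' z * w z)) + (LINT z|M. \<theta> z * (v z * w' z)) = - (LINT z|M. \<theta>' z * (v z * w z))"
proof -
  have "(LINT z|M. \<theta> z * (V' n z * W n z)) + (LINT z|M. \<theta> z * (V n z * W' n z)) = - (LINT z|M. \<theta>' z * (V n z * W n z))" for n
    using L2lim_mult_cont(2)[OF vlim(2) wlim(1) c(1)] L2lim_mult_cont(2)[OF vlim(1) wlim(2) c(1)]
    unfolding eq[symmetric] by (simp add: distrib_left)
  moreover have "(\<lambda>n. (LINT z|M. \<theta> z * (V' n z * W n z)) + (LINT z|M. \<theta> z * (V n z * W' n z)))
      \<longlonglongrightarrow> (LINT z|M. \<theta> z * (v' z * w z)) + (LINT z|M. \<theta> z * (v z * w' z))"
    by (intro tendsto_add L2lim_mult_cont vlim wlim c)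
  moreover have "(\<lambda>n. - (LINT z|M. \<theta>' z * (V n z * W n z))) \<longlonglongrightarrow> - (LINT z|M. \<theta>' z * (v z * w z))"
    by (intro tendsto_minus L2lim_mult_cont vlim wlim c)
  ultimately show ?thesis
    by (simp add: LIMSEQ_unique)
qed

lemma strong_product:
  assumes v: "strong v v1 v2" and w: "strong w w1 w2" and \<theta>: "\<And>z. z \<notin> S \<Longrightarrow> \<theta> z = 0"
  shows "pd1 \<theta> \<theta>1 \<Longrightarrow>
      (LINT z|M. \<theta> z * (v1 z * w z)) + (LINT z|M. \<theta> z * (v z * w1 z)) = - (LINT z|M. \<theta>1 z * (v z * w z))"
    and "pd2 \<theta> \<theta>2 \<Longrightarrow>
      (LINT z|M. \<theta> z * (v2 z * w z)) + (LINT z|M. \<theta> z * (v z * w2 z)) = - (LINT z|M. \<theta>2 z * (v z * w z))"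
proof -
  obtain V V1 V2 where V: "\<And>n. pd1 (V n) (V1 n)" "\<And>n. pd2 (V n) (V2 n)"
    and vlim: "L2lim M V v" "L2lim M V1 v1" "L2lim M V2 v2"
    using v by (elim strongE) blast
  obtain W W1 W2 where W: "\<And>n. pd1 (W n) (W1 n)" "\<And>n. pd2 (W n) (W2 n)"
    and wlim: "L2lim M W w" "L2lim M W1 w1" "L2lim M W2 w2"
    using w by (elim strongE) blast
  show "(LINT z|M. \<theta> z * (v1 z * w z)) + (LINT z|M. \<theta> z * (v z * w1 z)) = - (LINT z|M. \<theta>1 z * (v z * w z))"
    if t: "pd1 \<theta> \<theta>1"
    by (rule product_limit[OF vlim(1,2) wlim(1,2) pd_continuous(1,2)[OF t] ibp1_M[OF t pd1_mult[OF V(1) W(1)] \<theta>]])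
  show "(LINT z|M. \<theta> z * (v2 z * w z)) + (LINT z|M. \<theta> z * (v z * w2 z)) = - (LINT z|M. \<theta>2 z * (v z * w z))"
    if t: "pd2 \<theta> \<theta>2"
    by (rule product_limit[OF vlim(1,3) wlim(1,3) pd_continuous(3,4)[OF t] ibp2_M[OF t pd2_mult[OF V(2) W(2)] \<theta>]])
qed

lemma integrable_cont_mult:
  fixes f g :: "real ^ 2 \<Rightarrow> real"
  assumes "f \<in> borel_measurable M" "g \<in> borel_measurable M" "integrable M (\<lambda>z. (f z)\<^sup>2)" "integrable M (\<lambda>z. (g z)\<^sup>2)"
    and "continuous_on UNIV \<theta>"
  shows "integrable M (\<lambda>z. \<theta> z * (f z * g z))"
proof -
  have "L2lim M (\<lambda>_. f) f" "L2lim M (\<lambda>_. g) g" using assms by (simp_all add: L2lim_def)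
  then show ?thesis using L2lim_mult_cont(3) assms(5) by blast
qed

text \<open>Sum the tested Leibniz rule over \<open>k\<close>: the right side becomes
  \<open>r\<close> times the integral of a derivative of the bump, which is 0. It serves to
  differentiate the relations that say that the columns of the gradient are orthonormal.\<close>

lemma strong_inner_const:
  fixes v w :: "'k::finite \<Rightarrow> real ^ 2 \<Rightarrow> real"
  assumes v: "\<And>k. strong (v k) (v1 k) (v2 k)" and w: "\<And>k. strong (w k) (w1 k) (w2 k)"
    and const: "AE z in M. (\<Sum>k\<in>UNIV. v k z * w k z) = r"
  shows "AE z in M. (\<Sum>k\<in>UNIV. v1 k z * w k z + v k z * w1 k z) = 0"
    and "AE z in M. (\<Sum>k\<in>UNIV. v2 k z * w k z + v k z * w2 k z) = 0"
proof -
  note mi = integrable_cont_mult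
  note m = strongD[OF v] strongD[OF w]
  have "(LINT z|M. \<theta> z * (\<Sum>k\<in>UNIV. v k z * w k z)) = r * (LINT z|M. \<theta> z)" if "continuous_on UNIV \<theta>" for \<theta>
  proof -
    have "(LINT z|M. \<theta> z * (\<Sum>k\<in>UNIV. v k z * w k z)) = (LINT z|M. r * \<theta> z)"
    proof (rule integral_cong_AE)
      show "(\<lambda>z. \<theta> z * (\<Sum>k\<in>UNIV. v k z * w k z)) \<in> borel_measurable M"
        using strongD(1)[OF v] strongD(1)[OF w] cont_measurable[OF that] by measurable
      show "(\<lambda>z. r * \<theta> z) \<in> borel_measurable M"
        using cont_measurable[OF that] by measurable
    qed (use const in auto)
    then show ?thesis by simp
  qed
  moreover have "(LINT z|M. \<theta> z * (\<Sum>k\<in>UNIV. v k z * w k z)) = (\<Sum>k\<in>UNIV. LINT z|M. \<theta> z * (v k z * w k z))"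
    if "continuous_on UNIV \<theta>" for \<theta>
    unfolding sum_distrib_left by (intro Bochner_Integration.integral_sum mi m that)
  ultimately have zero: "(\<Sum>k\<in>UNIV. LINT z|M. \<theta> z * (v k z * w k z)) = r * (LINT z|M. \<theta> z)" if "continuous_on UNIV \<theta>" for \<theta>
    using that by simp
  \<comment> \<open>\<open>b'\<close> stands for \<open>bump1\<close> or \<open>bump2\<close>, and
    the primed families for the matching partial derivatives, so both directions are handled at
    once.\<close>
  have main: "AE z in M. (\<Sum>k\<in>UNIV. v' k z * w k z + v k z * w' k z) = 0"
    if m': "\<And>k. v' k \<in> borel_measurable M" "\<And>k. w' k \<in> borel_measurable M"
        "\<And>k. integrable M (\<lambda>z. (v' k z)\<^sup>2)" "\<And>k. integrable M (\<lambda>z. (w' k z)\<^sup>2)"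
      and b': "\<And>n a b c d. continuous_on UNIV (b' n a b c d)"
        "\<And>n a b c d. crect a b c d \<subseteq> S \<Longrightarrow> (LINT z|M. b' n a b c d z) = 0"
      and prod: "\<And>n a b c d k. crect a b c d \<subseteq> S \<Longrightarrow>
        (LINT z|M. bump n a b c d z * (v' k z * w k z)) + (LINT z|M. bump n a b c d z * (v k z * w' k z))
        = - (LINT z|M. b' n a b c d z * (v k z * w k z))" for v' w' b'
  proof (rule AE_zero)
    show "integrable M (\<lambda>z. \<Sum>k\<in>UNIV. v' k z * w k z + v k z * w' k z)"
      by (intro Bochner_Integration.integrable_sum Bochner_Integration.integrable_add integrable_mult_square m m')
    fix n a b c d assume sub: "crect a b c d \<subseteq> S"
    have "(LINT z|M. bump n a b c d z * (\<Sum>k\<in>UNIV. v' k z * w k z + v k z * w' k z))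
      = (\<Sum>k\<in>UNIV. (LINT z|M. bump n a b c d z * (v' k z * w k z)) + (LINT z|M. bump n a b c d z * (v k z * w' k z)))"
      unfolding sum_distrib_left distrib_left
      by (simp add: Bochner_Integration.integral_sum Bochner_Integration.integral_add mi m m' bump_continuous)
    also have "\<dots> = 0"
      by (simp add: prod[OF sub] sum_negf zero[OF b'(1)] b'(2)[OF sub])
    finally show "(LINT z|M. bump n a b c d z * (\<Sum>k\<in>UNIV. v' k z * w k z + v k z * w' k z)) = 0" .
  qed
  show "AE z in M. (\<Sum>k\<in>UNIV. v1 k z * w k z + v k z * w1 k z) = 0"
  proof (rule main[where b' = bump1])
    \<comment> \<open>Integration by parts against the constant function 1.\<close>
    show "(LINT z|M. bump1 n a b c d z) = 0" if "crect a b c d \<subseteq> S" for n a b c d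
      using ibp1_M[OF bump_pd(1) _ bump_0(1)[OF that], of "\<lambda>_. 1" "\<lambda>_. 0"] by (simp add: pd1_def)
  qed (rule m bump_continuous strong_product(1)[OF v w bump_0(1) bump_pd(1)], assumption?)+
  show "AE z in M. (\<Sum>k\<in>UNIV. v2 k z * w k z + v k z * w2 k z) = 0"
  proof (rule main[where b' = bump2])
    show "(LINT z|M. bump2 n a b c d z) = 0" if "crect a b c d \<subseteq> S" for n a b c d
      using ibp2_M[OF bump_pd(2) _ bump_0(1)[OF that], of "\<lambda>_. 1" "\<lambda>_. 0"] by (simp add: pd2_def)
  qed (rule m bump_continuous strong_product(2)[OF v w bump_0(1) bump_pd(2)], assumption?)+
qed

text \<open>For smooth functions the Jacobian is (p q_y)_x - (p q_x)_y, the mixed derivatives of q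
  cancelling. After integration by parts only first derivatives remain, so the identity survives the
  limit.\<close>

lemma strong_jacobian:
  assumes p: "strong p p1 p2" and q: "strong q q1 q2"
    and \<theta>1: "pd1 \<theta> \<theta>1" and \<theta>2: "pd2 \<theta> \<theta>2" and \<theta>: "\<And>z. z \<notin> S \<Longrightarrow> \<theta> z = 0"
  shows "(LINT z|M. \<theta> z * (p1 z * q2 z)) - (LINT z|M. \<theta> z * (p2 z * q1 z))
    = (LINT z|M. \<theta>2 z * (p z * q1 z)) - (LINT z|M. \<theta>1 z * (p z * q2 z))"
proof -
  obtain P P1 P2 where P: "\<And>n. pd1 (P n) (P1 n)" "\<And>n. pd2 (P n) (P2 n)"
    and plim: "L2lim M P p" "L2lim M P1 p1" "L2lim M P2 p2"
    using p by (elim strongE) blast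
  obtain Q Q1 Q2 Q12 Q21 where Q: "\<And>n. pd1 (Q n) (Q1 n)" "\<And>n. pd2 (Q n) (Q2 n)"
    "\<And>n. pd2 (Q1 n) (Q12 n)" "\<And>n. pd1 (Q2 n) (Q21 n)"
    and qlim: "L2lim M Q q" "L2lim M Q1 q1" "L2lim M Q2 q2"
    using q by (elim strongE) (rule that, assumption+)
  note c = pd_continuous(1,2)[OF \<theta>1, of UNIV] pd_continuous(4)[OF \<theta>2, of UNIV]
  have "(LINT z|M. \<theta> z * (P1 n z * Q2 n z)) - (LINT z|M. \<theta> z * (P2 n z * Q1 n z))
    = (LINT z|M. \<theta>2 z * (P n z * Q1 n z)) - (LINT z|M. \<theta>1 z * (P n z * Q2 n z))" for n
  proof -
    note pc = pd_continuous(1,2)[OF P(1)[of n], of UNIV] pd_continuous(4)[OF P(2)[of n], of UNIV]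
      pd_continuous(3,4)[OF Q(3)[of n], of UNIV] pd_continuous(1,2)[OF Q(4)[of n], of UNIV]
    have e1: "(LINT z|M. \<theta> z * (P1 n z * Q2 n z)) + (LINT z|M. \<theta> z * (P n z * Q21 n z)) = - (LINT z|M. \<theta>1 z * (P n z * Q2 n z))"
      by (subst Bochner_Integration.integral_add[symmetric])
        (auto intro!: cont_integrable continuous_intros c pc simp flip: distrib_left
           intro: ibp1_M[OF \<theta>1 pd1_mult[OF P(1) Q(4)] \<theta>])
    have e2: "(LINT z|M. \<theta> z * (P2 n z * Q1 n z)) + (LINT z|M. \<theta> z * (P n z * Q12 n z)) = - (LINT z|M. \<theta>2 z * (P n z * Q1 n z))"
      by (subst Bochner_Integration.integral_add[symmetric])
        (auto intro!: cont_integrable continuous_intros c pc simp flip: distrib_left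
           intro: ibp2_M[OF \<theta>2 pd2_mult[OF P(2) Q(3)] \<theta>])
    have "(LINT z|M. \<theta> z * (P n z * Q12 n z)) = (LINT z|M. \<theta> z * (P n z * Q21 n z))"
    proof (rule integral_cong_AE)
      show "(\<lambda>z. \<theta> z * (P n z * Q12 n z)) \<in> borel_measurable M" "(\<lambda>z. \<theta> z * (P n z * Q21 n z)) \<in> borel_measurable M"
        by (intro cont_measurable continuous_intros c pc)+
      show "AE z in M. \<theta> z * (P n z * Q12 n z) = \<theta> z * (P n z * Q21 n z)"
        using C2_mixed[OF Q(1,2,3,4), of n] by auto
    qed
    then show ?thesis using e1 e2 by simp
  qed
  moreover have "(\<lambda>n. (LINT z|M. \<theta> z * (P1 n z * Q2 n z)) - (LINT z|M. \<theta> z * (P2 n z * Q1 n z)))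
    \<longlonglongrightarrow> (LINT z|M. \<theta> z * (p1 z * q2 z)) - (LINT z|M. \<theta> z * (p2 z * q1 z))"
    by (intro tendsto_diff L2lim_mult_cont plim qlim c)
  moreover have "(\<lambda>n. (LINT z|M. \<theta>2 z * (P n z * Q1 n z)) - (LINT z|M. \<theta>1 z * (P n z * Q2 n z)))
    \<longlonglongrightarrow> (LINT z|M. \<theta>2 z * (p z * q1 z)) - (LINT z|M. \<theta>1 z * (p z * q2 z))"
    by (intro tendsto_diff L2lim_mult_cont plim qlim c)
  ultimately show ?thesis
    by (simp add: LIMSEQ_unique)
qed

text \<open>For the two columns \<open>p\<close>, \<open>q\<close> of an isometric gradient this is the Gauss equation.\<close>

lemma strong_gauss:
  fixes p q :: "'k::finite \<Rightarrow> real ^ 2 \<Rightarrow> real"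
  assumes p: "\<And>k. strong (p k) (p1 k) (p2 k)" and q: "\<And>k. strong (q k) (q1 k) (q2 k)"
    and o1: "AE z in M. (\<Sum>k\<in>UNIV. p k z * q1 k z) = 0"
    and o2: "AE z in M. (\<Sum>k\<in>UNIV. p k z * q2 k z) = 0"
  shows "AE z in M. (\<Sum>k\<in>UNIV. p1 k z * q2 k z - p2 k z * q1 k z) = 0"
proof (rule AE_zero)
  note mi = integrable_cont_mult
  note m = strongD[OF p] strongD[OF q]
  show "integrable M (\<lambda>z. \<Sum>k\<in>UNIV. p1 k z * q2 k z - p2 k z * q1 k z)"
    by (intro Bochner_Integration.integrable_sum Bochner_Integration.integrable_diff integrable_mult_square m)
  have zero: "(\<Sum>k\<in>UNIV. LINT z|M. \<theta> z * (p k z * r k z)) = 0"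
    if r: "\<And>k. r k \<in> borel_measurable M" "\<And>k. integrable M (\<lambda>z. (r k z)\<^sup>2)"
      "AE z in M. (\<Sum>k\<in>UNIV. p k z * r k z) = 0" and c: "continuous_on UNIV \<theta>" for r \<theta>
  proof -
    have "(\<Sum>k\<in>UNIV. LINT z|M. \<theta> z * (p k z * r k z)) = (LINT z|M. \<theta> z * (\<Sum>k\<in>UNIV. p k z * r k z))"
      unfolding sum_distrib_left by (intro Bochner_Integration.integral_sum[symmetric] mi m r c)
    also have "\<dots> = (LINT z|M. 0)"
    proof (rule integral_cong_AE)
      show "(\<lambda>z. \<theta> z * (\<Sum>k\<in>UNIV. p k z * r k z)) \<in> borel_measurable M"
        using strongD(1)[OF p] r(1) cont_measurable[OF c] by measurable
    qed (use r(3) in auto)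
    finally show ?thesis by simp
  qed
  fix n a b c d assume sub: "crect a b c d \<subseteq> S"
  let ?\<theta> = "bump n a b c d"
  have "(LINT z|M. ?\<theta> z * (\<Sum>k\<in>UNIV. p1 k z * q2 k z - p2 k z * q1 k z))
    = (\<Sum>k\<in>UNIV. (LINT z|M. ?\<theta> z * (p1 k z * q2 k z)) - (LINT z|M. ?\<theta> z * (p2 k z * q1 k z)))"
    unfolding sum_distrib_left right_diff_distrib
    by (simp add: Bochner_Integration.integral_sum Bochner_Integration.integral_diff mi m bump_continuous)
  \<comment> \<open>Moving derivatives off the Jacobian leaves the inner products of
    \<open>p\<close> with the two derivatives of \<open>q\<close>, which are 0 by \<open>o1\<close>
    and \<open>o2\<close>.\<close>
  also have "\<dots> = (\<Sum>k\<in>UNIV. (LINT z|M. bump2 n a b c d z * (p k z * q1 k z)) - (LINT z|M. bump1 n a b c d z * (p k z * q2 k z)))"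
    by (intro sum.cong refl strong_jacobian[OF p q bump_pd(1,2) bump_0(1)[OF sub]])
  also have "\<dots> = 0"
    using zero[OF strongD(2)[OF q] strongD(5)[OF q] o1 bump_continuous(3)]
      zero[OF strongD(3)[OF q] strongD(6)[OF q] o2 bump_continuous(2)]
    by (simp add: sum_subtractf)
  finally show "(LINT z|M. ?\<theta> z * (\<Sum>k\<in>UNIV. p1 k z * q2 k z - p2 k z * q1 k z)) = 0" .
qed

end

section \<open>Traces on coordinate lines\<close>

text \<open>Constants that converge in mean to \<open>E\<close> converge to the average
  \<open>m\<close> of \<open>E\<close>; hence \<open>E = m\<close> in mean, and by continuity
  everywhere on the interval.\<close>

lemma const_limit:
  fixes E :: "real \<Rightarrow> real"
  assumes "A < B" and E: "continuous_on {A..B} E"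
    and lim: "(\<lambda>n. integral {A..B} (\<lambda>x. \<bar>c n - E x\<bar>)) \<longlonglongrightarrow> 0"
    and x: "x \<in> {A..B}"
  shows "c \<longlonglongrightarrow> E x"
proof -
  define m where "m = integral {A..B} E / (B - A)"
  have i: "(\<lambda>x. c n - E x) integrable_on {A..B}" "(\<lambda>x. \<bar>c n - E x\<bar>) integrable_on {A..B}" for n
    by (intro integrable_continuous_real continuous_intros E)+
  have c: "c \<longlonglongrightarrow> m"
  proof -
    have est: "\<bar>c n - m\<bar> \<le> integral {A..B} (\<lambda>x. \<bar>c n - E x\<bar>) / (B - A)" for n
    proof -
      have "(B - A) * (c n - m) = integral {A..B} (\<lambda>x. c n - E x)"
        using \<open>A < B\<close> by (simp add: m_def integral_diff integrable_continuous_real E field_simps)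
      also have "\<bar>\<dots>\<bar> \<le> integral {A..B} (\<lambda>x. \<bar>c n - E x\<bar>)"
        using integral_norm_bound_integral[OF i] by simp
      finally have "\<bar>c n - m\<bar> * (B - A) \<le> integral {A..B} (\<lambda>x. \<bar>c n - E x\<bar>)"
        using \<open>A < B\<close> by (simp add: abs_mult mult.commute)
      then show ?thesis using \<open>A < B\<close> by (subst pos_le_divide_eq) auto
    qed
    have "(\<lambda>n. integral {A..B} (\<lambda>x. \<bar>c n - E x\<bar>) / (B - A)) \<longlonglongrightarrow> 0"
      using tendsto_divide_zero[OF lim] .
    then have "(\<lambda>n. c n - m) \<longlonglongrightarrow> 0"
      by (rule Lim_null_comparison[rotated]) (simp only: real_norm_def est eventually_True)
    then show ?thesis by (rule LIM_zero_cancel)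
  qed
  have "integral {A..B} (\<lambda>x. \<bar>m - E x\<bar>) \<le> (B - A) * \<bar>m - c n\<bar> + integral {A..B} (\<lambda>x. \<bar>c n - E x\<bar>)" for n
  proof -
    have "integral {A..B} (\<lambda>x. \<bar>m - E x\<bar>) \<le> integral {A..B} (\<lambda>x. \<bar>m - c n\<bar> + \<bar>c n - E x\<bar>)"
      by (rule integral_le) (auto intro!: integrable_continuous_real continuous_intros E)
    also have "\<dots> = (B - A) * \<bar>m - c n\<bar> + integral {A..B} (\<lambda>x. \<bar>c n - E x\<bar>)"
      using \<open>A < B\<close> by (subst integral_add) (auto intro!: i)
    finally show ?thesis .
  qed
  moreover have "(\<lambda>n. (B - A) * \<bar>m - c n\<bar> + integral {A..B} (\<lambda>x. \<bar>c n - E x\<bar>)) \<longlonglongrightarrow> (B - A) * \<bar>m - m\<bar> + 0"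
    by (intro tendsto_intros c lim)
  ultimately have "integral {A..B} (\<lambda>x. \<bar>m - E x\<bar>) \<le> 0"
    by (metis (no_types, lifting) LIMSEQ_le_const abs_zero add.right_neutral diff_self mult_zero_right)
  moreover have "0 \<le> integral {A..B} (\<lambda>x. \<bar>m - E x\<bar>)"
    by (intro integral_nonneg integrable_continuous_real continuous_intros E) auto
  ultimately have "integral {A..B} (\<lambda>x. \<bar>m - E x\<bar>) = 0" by simp
  moreover have cE: "continuous_on {A..B} (\<lambda>x. \<bar>m - E x\<bar>)"
    by (intro continuous_intros E)
  ultimately have "\<bar>m - E x\<bar> = 0"
    using integral_eq_0_iff[of A B "\<lambda>x. \<bar>m - E x\<bar>", OF cE \<open>A < B\<close>] x abs_ge_zero by blast
  then show ?thesis using c by simp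
qed

text \<open>\<open>Hn\<close> are functions whose increments from \<open>A\<close> are uniformly
  close to \<open>R\<close>, but whose values are controlled only in mean. Subtracting, the
  constants \<open>Hn n A\<close> converge in mean to H - R, and \<open>const_limit\<close> applies.
  This recovers a boundary value from convergence in the interior.\<close>

lemma section_limit:
  fixes H R :: "real \<Rightarrow> real" and Hn :: "nat \<Rightarrow> real \<Rightarrow> real"
  assumes "A < B" and H: "continuous_on {A..B} H" and Hn: "\<And>n. continuous_on {A..B} (Hn n)"
    and R: "\<And>n x. x \<in> {A..B} \<Longrightarrow> \<bar>Hn n x - Hn n A - R x\<bar> \<le> r n" and r: "r \<longlonglongrightarrow> 0"
    and lim: "(\<lambda>n. integral {A..B} (\<lambda>x. \<bar>Hn n x - H x\<bar>)) \<longlonglongrightarrow> 0"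
  shows "\<And>x. x \<in> {A..B} \<Longrightarrow> H x - H A = R x" and "(\<lambda>n. Hn n A) \<longlonglongrightarrow> H A"
proof -
  have ul: "uniform_limit {A..B} (\<lambda>n x. Hn n x - Hn n A) R sequentially"
  proof (rule uniform_limitI)
    fix e :: real assume "e > 0"
    have "\<forall>\<^sub>F n in sequentially. r n < e"
      using order_tendstoD(2)[OF r \<open>e > 0\<close>] .
    then show "\<forall>\<^sub>F n in sequentially. \<forall>x\<in>{A..B}. dist (Hn n x - Hn n A) (R x) < e"
      by eventually_elim (auto simp: dist_real_def intro: le_less_trans[OF R])
  qed
  have Rc: "continuous_on {A..B} R"
    by (rule uniform_limit_theorem[OF _ ul]) (intro always_eventually allI continuous_intros Hn, simp)
  have RA: "R A = 0"
  proof -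
    have "\<bar>R A\<bar> \<le> r n" for n using R[of A n] \<open>A < B\<close> by simp
    then show ?thesis using LIMSEQ_le_const[OF r, of "\<bar>R A\<bar>"] by simp
  qed
  define E where "E x = H x - R x" for x
  have E: "continuous_on {A..B} E"
    unfolding E_def by (intro continuous_intros H Rc)
  have est: "integral {A..B} (\<lambda>x. \<bar>Hn n A - E x\<bar>) \<le> (B - A) * r n + integral {A..B} (\<lambda>x. \<bar>Hn n x - H x\<bar>)" for n
  proof -
    have "integral {A..B} (\<lambda>x. \<bar>Hn n A - E x\<bar>) \<le> integral {A..B} (\<lambda>x. r n + \<bar>Hn n x - H x\<bar>)"
    proof (rule integral_le)
      show "\<bar>Hn n A - E x\<bar> \<le> r n + \<bar>Hn n x - H x\<bar>" if "x \<in> {A..B}" for x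
        using R[OF that, of n] by (simp add: E_def)
    qed (auto intro!: integrable_continuous_real continuous_intros E H Hn)
    also have "\<dots> = (B - A) * r n + integral {A..B} (\<lambda>x. \<bar>Hn n x - H x\<bar>)"
      using \<open>A < B\<close> by (subst integral_add) (auto intro!: integrable_continuous_real continuous_intros H Hn)
    finally show ?thesis .
  qed
  have up: "(\<lambda>n. (B - A) * r n + integral {A..B} (\<lambda>x. \<bar>Hn n x - H x\<bar>)) \<longlonglongrightarrow> 0"
    by (rule tendsto_eq_intros r lim refl)+ simp
  have "(\<lambda>n. integral {A..B} (\<lambda>x. \<bar>Hn n A - E x\<bar>)) \<longlonglongrightarrow> 0"
  proof (rule tendsto_sandwich[OF _ _ tendsto_const up])
    show "\<forall>\<^sub>F n in sequentially. 0 \<le> integral {A..B} (\<lambda>x. \<bar>Hn n A - E x\<bar>)"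
      by (intro always_eventually allI integral_nonneg integrable_continuous_real continuous_intros E) auto
  qed (use est in auto)
  from const_limit[OF \<open>A < B\<close> E this]
  have *: "(\<lambda>n. Hn n A) \<longlonglongrightarrow> E x" if "x \<in> {A..B}" for x using that .
  have "E A = H A" using RA by (simp add: E_def)
  then show lim: "(\<lambda>n. Hn n A) \<longlonglongrightarrow> H A" using *[of A] \<open>A < B\<close> by simp
  show "H x - H A = R x" if "x \<in> {A..B}" for x
    using LIMSEQ_unique[OF lim *[OF that]] unfolding E_def by linarith
qed

text \<open>\<open>g\<close> is the derivative of its integral function, whose difference quotients
  are bounded by \<open>K\<close>. With \<open>K = 0\<close> this shows that a continuous function
  vanishes.\<close>

lemma bound_from_integrals:
  fixes g :: "real \<Rightarrow> real"
  assumes "C < D" and g: "continuous_on {C..D} g"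
    and b: "\<And>c d. C \<le> c \<Longrightarrow> c \<le> d \<Longrightarrow> d \<le> D \<Longrightarrow> \<bar>integral {c..d} g\<bar> \<le> K * (d - c)"
    and y: "y \<in> {C..D}"
  shows "\<bar>g y\<bar> \<le> K"
proof -
  define G where "G t = integral {C..t} g" for t
  have i: "g integrable_on {c..d}" if "C \<le> c" "d \<le> D" for c d
    by (intro integrable_continuous_real continuous_on_subset[OF g]) (use that in auto)
  have comb: "G d - G c = integral {c..d} g" if "C \<le> c" "c \<le> d" "d \<le> D" for c d
    using Henstock_Kurzweil_Integration.integral_combine[of C c d g] i[of C d] that by (simp add: G_def)
  have "(G has_real_derivative g y) (at y within {C..D})"
    unfolding G_def by (rule integral_has_real_derivative[OF g y])
  then have lim: "((\<lambda>t. \<bar>(G t - G y) / (t - y)\<bar>) \<longlongrightarrow> \<bar>g y\<bar>) (at y within {C..D})"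
    by (intro tendsto_rabs) (simp add: has_field_derivative_iff)
  have "\<bar>(G t - G y) / (t - y)\<bar> \<le> K" if t: "t \<in> {C..D}" "t \<noteq> y" for t
  proof (cases "t < y")
    case True
    then have "\<bar>G t - G y\<bar> \<le> K * \<bar>t - y\<bar>"
      using comb[of t y] b[of t y] t y by (simp add: abs_minus_commute)
    then show ?thesis using t by (simp add: field_simps)
  next
    case False
    then have "\<bar>G t - G y\<bar> \<le> K * \<bar>t - y\<bar>"
      using comb[of y t] b[of y t] t y by simp
    then show ?thesis using t by (simp add: field_simps)
  qed
  then have "\<forall>\<^sub>F t in at y within {C..D}. \<bar>(G t - G y) / (t - y)\<bar> \<le> K"
    by (auto simp: eventually_at_filter)
  moreover have "at y within {C..D} \<noteq> bot"
    using \<open>C < D\<close> y by (simp add: trivial_limit_within)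
  ultimately show ?thesis using tendsto_upperbound[OF lim] by blast
qed

lemma (in finite_measure) L2lim_L1:
  assumes V: "L2lim M V v"
  shows "(\<lambda>n. LINT z|M. \<bar>V n z - v z\<bar>) \<longlonglongrightarrow> 0" "integrable M (\<lambda>z. V n z - v z)" "integrable M v"
proof -
  have one: "(\<lambda>_. 1) \<in> borel_measurable M" "integrable M (\<lambda>z. (1::real)\<^sup>2)" by simp_all
  note m = borel_measurable_diff[OF L2limD(3)[OF V] L2limD(1)[OF V]]
  show "integrable M (\<lambda>z. V n z - v z)" for n
    using integrable_mult_square[OF m one(1) L2limD(6)[OF V] one(2)] by simp
  show "integrable M v"
    using integrable_mult_square[OF L2limD(1)[OF V] one(1) L2limD(2)[OF V] one(2)] by simp
  have est: "(LINT z|M. \<bar>V n z - v z\<bar>) \<le> sqrt (LINT z|M. (V n z - v z)\<^sup>2) * sqrt (LINT z|M. 1\<^sup>2)" for n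
    using Cauchy_Schwarz_LINT[OF m one(1) L2limD(6)[OF V] one(2)] by simp
  have up: "(\<lambda>n. sqrt (LINT z|M. (V n z - v z)\<^sup>2) * sqrt (LINT z|M. 1\<^sup>2)) \<longlonglongrightarrow> 0"
    using tendsto_mult_left_zero[OF tendsto_real_sqrt[OF L2limD(5)[OF V], simplified]] .
  show "(\<lambda>n. LINT z|M. \<bar>V n z - v z\<bar>) \<longlonglongrightarrow> 0"
    by (rule tendsto_sandwich[OF _ _ tendsto_const up]) (use est in auto)
qed

section \<open>Restriction to subrectangles and integrals along sections\<close>

context rectangle
begin

lemma sub_space: "rect a b c d \<subseteq> S \<Longrightarrow> lebesgue_on (rect a b c d) = restrict_space M (rect a b c d)"
  unfolding M_def by (simp add: restrict_restrict_space S_def inf.absorb2)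

lemma sub_sets: "rect a b c d \<subseteq> S \<Longrightarrow> rect a b c d \<in> sets M"
  unfolding M_def by (subst sets_restrict_space_iff) (auto simp: S_def)

lemma sub_LINT:
  fixes g :: "real ^ 2 \<Rightarrow> real"
  assumes "rect a b c d \<subseteq> S"
  shows "(LINT z|lebesgue_on (rect a b c d). g z) = (LINT z|M. indicator (rect a b c d) z * g z)"
  unfolding sub_space[OF assms] using sub_sets[OF assms]
  by (subst integral_restrict_space) (auto simp: Int_absorb2 assms)

lemma sub_integrable:
  fixes g :: "real ^ 2 \<Rightarrow> real"
  assumes "rect a b c d \<subseteq> S" "integrable M g"
  shows "integrable (lebesgue_on (rect a b c d)) g"
  unfolding sub_space[OF assms(1)] using sub_sets[OF assms(1)] assms(2)
    integrable_mult_indicator[OF sub_sets[OF assms(1)] assms(2)]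
  by (subst integrable_restrict_space) (auto simp: Int_absorb2 assms(1))

lemma sub_LINT_le:
  fixes g :: "real ^ 2 \<Rightarrow> real"
  assumes "rect a b c d \<subseteq> S" "integrable M g" "\<And>z. 0 \<le> g z"
  shows "(LINT z|lebesgue_on (rect a b c d). g z) \<le> (LINT z|M. g z)"
  unfolding sub_LINT[OF assms(1)]
proof (rule integral_mono)
  show "integrable M (\<lambda>z. indicator (rect a b c d) z * g z)"
    using integrable_mult_indicator[OF sub_sets[OF assms(1)] assms(2)] by simp
qed (use assms in \<open>auto simp: indicator_def\<close>)

lemma sub_AE: "rect a b c d \<subseteq> S \<Longrightarrow> AE z in M. P z \<Longrightarrow> AE z in lebesgue_on (rect a b c d). P z"
  unfolding sub_space using sub_sets[of a b c d] by (subst AE_restrict_space_iff) (auto simp: Int_absorb2)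

lemma sub_L2lim:
  assumes sub: "rect a b c d \<subseteq> S" and V: "L2lim M V v"
  shows "L2lim (lebesgue_on (rect a b c d)) V v"
proof -
  have "(\<lambda>n. LINT z|lebesgue_on (rect a b c d). (V n z - v z)\<^sup>2) \<longlonglongrightarrow> 0"
  proof (rule tendsto_sandwich[OF _ _ tendsto_const L2limD(5)[OF V]])
    show "\<forall>\<^sub>F n in sequentially. (LINT z|lebesgue_on (rect a b c d). (V n z - v z)\<^sup>2) \<le> (LINT z|M. (V n z - v z)\<^sup>2)"
      by (intro always_eventually allI sub_LINT_le[OF sub] L2limD(6)[OF V]) simp
  qed simp
  then show ?thesis
    unfolding L2lim_def using L2limD[OF V] sub_integrable[OF sub]
    by (auto simp: sub_space[OF sub] intro: measurable_restrict_space1)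
qed

text \<open>The bound does not depend on the subrectangle; this is the uniformity that
  \<open>section_limit\<close> asks for.\<close>

lemma sub_LINT_diff_le:
  assumes V: "L2lim M V v" and sub: "rect a b c d \<subseteq> S"
  shows "\<bar>(LINT z|lebesgue_on (rect a b c d). V n z) - (LINT z|lebesgue_on (rect a b c d). v z)\<bar>
    \<le> (LINT z|M. \<bar>V n z - v z\<bar>)"
proof -
  have i: "integrable M (\<lambda>z. V n z - v z)" "integrable M v" using L2lim_L1[OF V] by auto
  then have "integrable M (\<lambda>z. (V n z - v z) + v z)" by (rule Bochner_Integration.integrable_add)
  then have "integrable M (V n)" by simp
  then have "(LINT z|lebesgue_on (rect a b c d). V n z) - (LINT z|lebesgue_on (rect a b c d). v z)
    = (LINT z|lebesgue_on (rect a b c d). V n z - v z)"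
    using sub_integrable[OF sub] i by (simp add: Bochner_Integration.integral_diff)
  also have "\<bar>\<dots>\<bar> \<le> (LINT z|lebesgue_on (rect a b c d). \<bar>V n z - v z\<bar>)"
    by (rule integral_abs_bound)
  also have "\<dots> \<le> (LINT z|M. \<bar>V n z - v z\<bar>)"
    by (rule sub_LINT_le[OF sub]) (use i in auto)
  finally show ?thesis .
qed

lemma cont_section1:
  fixes f :: "real ^ 2 \<Rightarrow> real"
  assumes f: "continuous_on (crect A B C D) f" and cd: "C \<le> c" "d \<le> D"
  shows "continuous_on {A..B} (\<lambda>x. integral {c..d} (\<lambda>y. f (pt x y)))"
proof -
  have "continuous_on ({A..B} \<times> cbox c d) (\<lambda>(x, y). f (pt x y))"
    unfolding case_prod_beta'
    by (rule continuous_on_compose2[OF f]) (use cd in \<open>auto intro!: continuous_intros simp: mem_crect\<close>)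
  from integral_continuous_on_param[OF this] show ?thesis by simp
qed

lemma cont_section2:
  fixes f :: "real ^ 2 \<Rightarrow> real"
  assumes f: "continuous_on (crect A B C D) f" and ab: "A \<le> a" "b \<le> B"
  shows "continuous_on {C..D} (\<lambda>y. integral {a..b} (\<lambda>x. f (pt x y)))"
proof -
  have "continuous_on ({C..D} \<times> cbox a b) (\<lambda>(y, x). f (pt x y))"
    unfolding case_prod_beta'
    by (rule continuous_on_compose2[OF f]) (use ab in \<open>auto intro!: continuous_intros simp: mem_crect\<close>)
  from integral_continuous_on_param[OF this] show ?thesis by simp
qed

lemma cont_line1:
  fixes f :: "real ^ 2 \<Rightarrow> real"
  assumes f: "continuous_on (crect A B C D) f" and "x \<in> {A..B}" "C \<le> c" "d \<le> D"
  shows "continuous_on {c..d} (\<lambda>y. f (pt x y))"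
  by (rule continuous_on_compose2[OF f]) (use assms in \<open>auto intro!: continuous_intros simp: mem_crect\<close>)

lemma cont_line2:
  fixes f :: "real ^ 2 \<Rightarrow> real"
  assumes f: "continuous_on (crect A B C D) f" and "y \<in> {C..D}" "A \<le> a" "b \<le> B"
  shows "continuous_on {a..b} (\<lambda>x. f (pt x y))"
  by (rule continuous_on_compose2[OF f]) (use assms in \<open>auto intro!: continuous_intros simp: mem_crect\<close>)

text \<open>Averaging over a vertical segment gives a function of x alone, with increments equal to
  integrals of the weak derivative. This ties pointwise values of the continuous representative to
  the derivative, right up to the sides, and the second claim is what identifies the trace.\<close>

lemma section1:
  fixes f :: "real ^ 2 \<Rightarrow> real"
  assumes f: "continuous_on (crect A B C D) f" and W: "\<And>n. pd1 (W n) (W1 n)"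
    and Wf: "L2lim M W f" and Wp: "L2lim M W1 p"
    and "A < B" and cd: "C \<le> c" "c \<le> d" "d \<le> D"
  shows "\<And>x. x \<in> {A..B} \<Longrightarrow> integral {c..d} (\<lambda>y. f (pt x y)) - integral {c..d} (\<lambda>y. f (pt A y))
      = (LINT z|lebesgue_on (rect A x c d). p z)"
    and "(\<lambda>n. integral {c..d} (\<lambda>y. W n (pt A y))) \<longlonglongrightarrow> integral {c..d} (\<lambda>y. f (pt A y))"
proof -
  define H where "H x = integral {c..d} (\<lambda>y. f (pt x y))" for x
  define Hn where "Hn n x = integral {c..d} (\<lambda>y. W n (pt x y))" for n x
  define R where "R x = (LINT z|lebesgue_on (rect A x c d). p z)" for x
  have Wc: "continuous_on (crect A B C D) (W n)" for n by (rule pd_continuous(1)[OF W])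
  have iW: "(\<lambda>y. W n (pt x y)) integrable_on {c..d}" and jf: "(\<lambda>y. f (pt x y)) integrable_on {c..d}"
    if "x \<in> {A..B}" for n x
    using that cd by (auto intro!: integrable_continuous_real cont_line1[OF Wc] cont_line1[OF f])
  have 1: "\<bar>Hn n x - Hn n A - R x\<bar> \<le> (LINT z|M. \<bar>W1 n z - p z\<bar>)" if x: "x \<in> {A..B}" for n x
  proof -
    have "Hn n x - Hn n A = integral {c..d} (\<lambda>y. W n (pt x y) - W n (pt A y))"
      unfolding Hn_def using \<open>A < B\<close> by (intro integral_diff[symmetric] iW x) simp
    also have "\<dots> = (LINT z|lebesgue_on (rect A x c d). W1 n z)"
      by (rule LINT_pd1[OF W, symmetric]) (use x in simp)
    finally have eq: "Hn n x - Hn n A = (LINT z|lebesgue_on (rect A x c d). W1 n z)" .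
    have "rect A x c d \<subseteq> S" using x cd by (auto simp: S_def mem_rect)
    then show ?thesis
      unfolding R_def eq by (rule sub_LINT_diff_le[OF Wp])
  qed
  have sub: "rect A B c d \<subseteq> S" using cd by (auto simp: S_def mem_rect)
  have 2: "integral {A..B} (\<lambda>x. \<bar>Hn n x - H x\<bar>) \<le> (LINT z|M. \<bar>W n z - f z\<bar>)" for n
  proof -
    have gc: "continuous_on (crect A B C D) (\<lambda>z. \<bar>W n z - f z\<bar>)"
      by (intro continuous_intros Wc f)
    have "integral {A..B} (\<lambda>x. \<bar>Hn n x - H x\<bar>) \<le> integral {A..B} (\<lambda>x. integral {c..d} (\<lambda>y. \<bar>W n (pt x y) - f (pt x y)\<bar>))"
    proof (rule integral_le)
      show "(\<lambda>x. \<bar>Hn n x - H x\<bar>) integrable_on {A..B}"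
        unfolding Hn_def H_def using cd
        by (intro integrable_continuous_real continuous_intros cont_section1 Wc f)
      show "(\<lambda>x. integral {c..d} (\<lambda>y. \<bar>W n (pt x y) - f (pt x y)\<bar>)) integrable_on {A..B}"
        using cd by (intro integrable_continuous_real cont_section1[OF gc])
      show "\<bar>Hn n x - H x\<bar> \<le> integral {c..d} (\<lambda>y. \<bar>W n (pt x y) - f (pt x y)\<bar>)" if x: "x \<in> {A..B}" for x
      proof -
        have "Hn n x - H x = integral {c..d} (\<lambda>y. W n (pt x y) - f (pt x y))"
          unfolding Hn_def H_def by (intro integral_diff[symmetric] iW jf x)
        also have "\<bar>\<dots>\<bar> \<le> integral {c..d} (\<lambda>y. \<bar>W n (pt x y) - f (pt x y)\<bar>)"
        proof (rule integral_norm_bound_integral[where f = "\<lambda>y. W n (pt x y) - f (pt x y)", unfolded real_norm_def])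
          show "(\<lambda>y. W n (pt x y) - f (pt x y)) integrable_on {c..d}"
            by (intro integrable_diff iW jf x)
          show "(\<lambda>y. \<bar>W n (pt x y) - f (pt x y)\<bar>) integrable_on {c..d}"
            using cd by (intro integrable_continuous_real cont_line1[OF gc] x)
        qed simp
        finally show ?thesis .
      qed
    qed
    also have "\<dots> = (LINT z|lebesgue_on (rect A B c d). \<bar>W n z - f z\<bar>)"
    proof (rule LINT_rect(1)[of A B c d "\<lambda>z. \<bar>W n z - f z\<bar>", symmetric])
      show "continuous_on (crect A B c d) (\<lambda>z. \<bar>W n z - f z\<bar>)"
        by (rule continuous_on_subset[OF gc]) (use cd in \<open>auto simp: mem_crect\<close>)
    qed
    also have "\<dots> \<le> (LINT z|M. \<bar>W n z - f z\<bar>)"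
      by (rule sub_LINT_le[OF sub]) (use L2lim_L1[OF Wf] in auto)
    finally show ?thesis .
  qed
  have "(\<lambda>n. integral {A..B} (\<lambda>x. \<bar>Hn n x - H x\<bar>)) \<longlonglongrightarrow> 0"
  proof (rule tendsto_sandwich[OF _ _ tendsto_const L2lim_L1(1)[OF Wf]])
    show "\<forall>\<^sub>F n in sequentially. 0 \<le> integral {A..B} (\<lambda>x. \<bar>Hn n x - H x\<bar>)"
      unfolding Hn_def H_def using cd
      by (intro always_eventually allI integral_nonneg integrable_continuous_real continuous_intros cont_section1 Wc f) auto
  qed (use 2 in auto)
  note lim0 = this
  have c: "continuous_on {A..B} H" "continuous_on {A..B} (Hn n)" for n
    unfolding H_def Hn_def using cd by (intro cont_section1 Wc f; simp)+
  note lim = section_limit[of A B H Hn R, OF \<open>A < B\<close> c _ L2lim_L1(1)[OF Wp] lim0]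
  show "integral {c..d} (\<lambda>y. f (pt x y)) - integral {c..d} (\<lambda>y. f (pt A y)) = (LINT z|lebesgue_on (rect A x c d). p z)"
    if "x \<in> {A..B}" for x
    using lim(1)[OF 1 that] unfolding H_def R_def .
  show "(\<lambda>n. integral {c..d} (\<lambda>y. W n (pt A y))) \<longlonglongrightarrow> integral {c..d} (\<lambda>y. f (pt A y))"
    using lim(2)[OF 1] unfolding H_def Hn_def .
qed

lemma section2:
  fixes f :: "real ^ 2 \<Rightarrow> real"
  assumes f: "continuous_on (crect A B C D) f" and W: "\<And>n. pd2 (W n) (W2 n)"
    and Wf: "L2lim M W f" and Wp: "L2lim M W2 p"
    and "C < D" and ab: "A \<le> a" "a \<le> b" "b \<le> B"
  shows "\<And>y. y \<in> {C..D} \<Longrightarrow> integral {a..b} (\<lambda>x. f (pt x y)) - integral {a..b} (\<lambda>x. f (pt x C))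
      = (LINT z|lebesgue_on (rect a b C y). p z)"
    and "(\<lambda>n. integral {a..b} (\<lambda>x. W n (pt x C))) \<longlonglongrightarrow> integral {a..b} (\<lambda>x. f (pt x C))"
proof -
  define H where "H y = integral {a..b} (\<lambda>x. f (pt x y))" for y
  define Hn where "Hn n y = integral {a..b} (\<lambda>x. W n (pt x y))" for n y
  define R where "R y = (LINT z|lebesgue_on (rect a b C y). p z)" for y
  have Wc: "continuous_on (crect A B C D) (W n)" for n by (rule pd_continuous(3)[OF W])
  have iW: "(\<lambda>x. W n (pt x y)) integrable_on {a..b}" and jf: "(\<lambda>x. f (pt x y)) integrable_on {a..b}"
    if "y \<in> {C..D}" for n y
    using that ab by (auto intro!: integrable_continuous_real cont_line2[OF Wc] cont_line2[OF f])
  have 1: "\<bar>Hn n y - Hn n C - R y\<bar> \<le> (LINT z|M. \<bar>W2 n z - p z\<bar>)" if y: "y \<in> {C..D}" for n y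
  proof -
    have "Hn n y - Hn n C = integral {a..b} (\<lambda>x. W n (pt x y) - W n (pt x C))"
      unfolding Hn_def using \<open>C < D\<close> by (intro integral_diff[symmetric] iW y) simp
    also have "\<dots> = (LINT z|lebesgue_on (rect a b C y). W2 n z)"
      by (rule LINT_pd2[OF W, symmetric]) (use y in simp)
    finally have eq: "Hn n y - Hn n C = (LINT z|lebesgue_on (rect a b C y). W2 n z)" .
    have "rect a b C y \<subseteq> S" using y ab by (auto simp: S_def mem_rect)
    then show ?thesis
      unfolding R_def eq by (rule sub_LINT_diff_le[OF Wp])
  qed
  have sub: "rect a b C D \<subseteq> S" using ab by (auto simp: S_def mem_rect)
  have 2: "integral {C..D} (\<lambda>y. \<bar>Hn n y - H y\<bar>) \<le> (LINT z|M. \<bar>W n z - f z\<bar>)" for n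
  proof -
    have gc: "continuous_on (crect A B C D) (\<lambda>z. \<bar>W n z - f z\<bar>)"
      by (intro continuous_intros Wc f)
    have "integral {C..D} (\<lambda>y. \<bar>Hn n y - H y\<bar>) \<le> integral {C..D} (\<lambda>y. integral {a..b} (\<lambda>x. \<bar>W n (pt x y) - f (pt x y)\<bar>))"
    proof (rule integral_le)
      show "(\<lambda>y. \<bar>Hn n y - H y\<bar>) integrable_on {C..D}"
        unfolding Hn_def H_def using ab
        by (intro integrable_continuous_real continuous_intros cont_section2 Wc f)
      show "(\<lambda>y. integral {a..b} (\<lambda>x. \<bar>W n (pt x y) - f (pt x y)\<bar>)) integrable_on {C..D}"
        using ab by (intro integrable_continuous_real cont_section2[OF gc])
      show "\<bar>Hn n y - H y\<bar> \<le> integral {a..b} (\<lambda>x. \<bar>W n (pt x y) - f (pt x y)\<bar>)" if y: "y \<in> {C..D}" for y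
      proof -
        have "Hn n y - H y = integral {a..b} (\<lambda>x. W n (pt x y) - f (pt x y))"
          unfolding Hn_def H_def by (intro integral_diff[symmetric] iW jf y)
        also have "\<bar>\<dots>\<bar> \<le> integral {a..b} (\<lambda>x. \<bar>W n (pt x y) - f (pt x y)\<bar>)"
        proof (rule integral_norm_bound_integral[where f = "\<lambda>x. W n (pt x y) - f (pt x y)", unfolded real_norm_def])
          show "(\<lambda>x. W n (pt x y) - f (pt x y)) integrable_on {a..b}"
            by (intro integrable_diff iW jf y)
          show "(\<lambda>x. \<bar>W n (pt x y) - f (pt x y)\<bar>) integrable_on {a..b}"
            using ab by (intro integrable_continuous_real cont_line2[OF gc] y)
        qed simp
        finally show ?thesis .
      qed
    qed
    also have "\<dots> = (LINT z|lebesgue_on (rect a b C D). \<bar>W n z - f z\<bar>)"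
    proof (rule LINT_rect(2)[of a b C D "\<lambda>z. \<bar>W n z - f z\<bar>", symmetric])
      show "continuous_on (crect a b C D) (\<lambda>z. \<bar>W n z - f z\<bar>)"
        by (rule continuous_on_subset[OF gc]) (use ab in \<open>auto simp: mem_crect\<close>)
    qed
    also have "\<dots> \<le> (LINT z|M. \<bar>W n z - f z\<bar>)"
      by (rule sub_LINT_le[OF sub]) (use L2lim_L1[OF Wf] in auto)
    finally show ?thesis .
  qed
  have "(\<lambda>n. integral {C..D} (\<lambda>y. \<bar>Hn n y - H y\<bar>)) \<longlonglongrightarrow> 0"
  proof (rule tendsto_sandwich[OF _ _ tendsto_const L2lim_L1(1)[OF Wf]])
    show "\<forall>\<^sub>F n in sequentially. 0 \<le> integral {C..D} (\<lambda>y. \<bar>Hn n y - H y\<bar>)"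
      unfolding Hn_def H_def using ab
      by (intro always_eventually allI integral_nonneg integrable_continuous_real continuous_intros cont_section2 Wc f) auto
  qed (use 2 in auto)
  note lim0 = this
  have c: "continuous_on {C..D} H" "continuous_on {C..D} (Hn n)" for n
    unfolding H_def Hn_def using ab by (intro cont_section2 Wc f; simp)+
  note lim = section_limit[of C D H Hn R, OF \<open>C < D\<close> c _ L2lim_L1(1)[OF Wp] lim0]
  show "integral {a..b} (\<lambda>x. f (pt x y)) - integral {a..b} (\<lambda>x. f (pt x C)) = (LINT z|lebesgue_on (rect a b C y). p z)"
    if "y \<in> {C..D}" for y
    using lim(1)[OF 1 that] unfolding H_def R_def .
  show "(\<lambda>n. integral {a..b} (\<lambda>x. W n (pt x C))) \<longlonglongrightarrow> integral {a..b} (\<lambda>x. f (pt x C))"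
    using lim(2)[OF 1] unfolding H_def Hn_def .
qed

lemma rect_measure: "a \<le> b \<Longrightarrow> c \<le> d \<Longrightarrow> measure lebesgue (rect a b c d) = (b - a) * (d - c)"
  using content_crect[of a b c d] by (simp add: rect_def measure_completion measure_lborel_box_eq measure_lborel_cbox_eq)

end

section \<open>Pointwise consequences for the continuous representative\<close>

context rectangle
begin

lemma strongI:
  "(\<And>n. C2 (V n) (V1 n) (V2 n) (V12 n) (V21 n)) \<Longrightarrow> L2lim M V v \<Longrightarrow> L2lim M V1 v1 \<Longrightarrow> L2lim M V2 v2 \<Longrightarrow>
    strong v v1 v2"
  unfolding strong_def by blast

lemma strong_sub:
  assumes v: "strong v v1 v2" and sub: "rect a b c d \<subseteq> S" and "a \<le> b" "c \<le> d"
  shows "rectangle.strong a b c d v v1 v2"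
proof -
  interpret sub: rectangle a b c d by unfold_locales fact+
  have "sub.M = lebesgue_on (rect a b c d)" by (simp add: sub.M_def sub.S_def)
  then show ?thesis
    using v sub_L2lim[OF sub] unfolding strong_def sub.strong_def by metis
qed

lemma strong_cont_section1:
  assumes v: "strong f p q" and f: "continuous_on (crect A B C D) f"
    and ab: "A \<le> a" "a \<le> b" "b \<le> B" and cd: "C \<le> c" "c \<le> d" "d \<le> D"
  shows "integral {c..d} (\<lambda>y. f (pt b y) - f (pt a y)) = (LINT z|lebesgue_on (rect a b c d). p z)"
proof (cases "a = b")
  case True
  then have "rect a b c d = {}" by (auto simp: mem_rect)
  then show ?thesis using True by (simp add: Bochner_Integration.integral_empty)
next
  case False
  \<comment> \<open>\<open>section1\<close> compares only with the left side, so the rectangle is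
    cut to make \<open>a\<close> its left side.\<close>
  interpret sub: rectangle a B C D using ab CD by unfold_locales auto
  have "rect a B C D \<subseteq> S" using ab by (auto simp: S_def mem_rect)
  from strong_sub[OF v this] have "sub.strong f p q" using ab CD by simp
  then obtain W W1 where W: "\<And>n. pd1 (W n) (W1 n)" "L2lim sub.M W f" "L2lim sub.M W1 p"
    by (elim sub.strongE) blast
  have fs: "continuous_on (crect a B C D) f"
    by (rule continuous_on_subset[OF f]) (use ab in \<open>auto simp: mem_crect\<close>)
  have i: "(\<lambda>y. f (pt x y)) integrable_on {c..d}" if "x \<in> {A..B}" for x
    by (intro integrable_continuous_real cont_line1[OF f that] cd)
  have "integral {c..d} (\<lambda>y. f (pt b y)) - integral {c..d} (\<lambda>y. f (pt a y)) = (LINT z|lebesgue_on (rect a b c d). p z)"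
    by (rule sub.section1(1)[OF fs W]) (use ab cd False in auto)
  then show ?thesis
    using i[of a] i[of b] ab by (simp add: integral_diff)
qed

lemma strong_cont_section2:
  assumes v: "strong f p q" and f: "continuous_on (crect A B C D) f"
    and ab: "A \<le> a" "a \<le> b" "b \<le> B" and cd: "C \<le> c" "c \<le> d" "d \<le> D"
  shows "integral {a..b} (\<lambda>x. f (pt x d) - f (pt x c)) = (LINT z|lebesgue_on (rect a b c d). q z)"
proof (cases "c = d")
  case True
  then have "rect a b c d = {}" by (auto simp: mem_rect)
  then show ?thesis using True by (simp add: Bochner_Integration.integral_empty)
next
  case False
  interpret sub: rectangle A B c D using cd AB by unfold_locales auto
  have "rect A B c D \<subseteq> S" using cd by (auto simp: S_def mem_rect)
  from strong_sub[OF v this] have "sub.strong f p q" using cd AB by simp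
  then obtain W W2 where W: "\<And>n. pd2 (W n) (W2 n)" "L2lim sub.M W f" "L2lim sub.M W2 q"
    by (elim sub.strongE) blast
  have fs: "continuous_on (crect A B c D) f"
    by (rule continuous_on_subset[OF f]) (use cd in \<open>auto simp: mem_crect\<close>)
  have i: "(\<lambda>x. f (pt x y)) integrable_on {a..b}" if "y \<in> {C..D}" for y
    by (intro integrable_continuous_real cont_line2[OF f that] ab)
  have "integral {a..b} (\<lambda>x. f (pt x d)) - integral {a..b} (\<lambda>x. f (pt x c)) = (LINT z|lebesgue_on (rect a b c d). q z)"
    by (rule sub.section2(1)[OF fs W]) (use ab cd False in auto)
  then show ?thesis
    using i[of c] i[of d] cd by (simp add: integral_diff)
qed

lemma sub_LINT_bound:
  fixes g :: "real ^ 2 \<Rightarrow> real"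
  assumes g: "integrable M g" "AE z in M. \<bar>g z\<bar> \<le> K" and sub: "rect a b c d \<subseteq> S" and "a \<le> b" "c \<le> d"
  shows "\<bar>LINT z|lebesgue_on (rect a b c d). g z\<bar> \<le> K * ((b - a) * (d - c))"
proof -
  interpret R: finite_measure "lebesgue_on (rect a b c d)" by (rule rect_finite_measure)
  have "\<bar>LINT z|lebesgue_on (rect a b c d). g z\<bar> \<le> (LINT z|lebesgue_on (rect a b c d). \<bar>g z\<bar>)"
    by (rule integral_abs_bound)
  also have "\<dots> \<le> (LINT z|lebesgue_on (rect a b c d). K)"
    by (rule integral_mono_AE) (use sub_integrable[OF sub g(1)] sub_AE[OF sub g(2)] in auto)
  also have "\<dots> = K * ((b - a) * (d - c))"
    using assms(4,5) by (simp add: measure_restrict_space rect_measure)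
  finally show ?thesis .
qed

text \<open>The section identity bounds every vertical average of the increment, and
  \<open>bound_from_integrals\<close> turns this into a Lipschitz bound on each horizontal line,
  including the lines in the boundary.\<close>

lemma strong_line1:
  assumes v: "strong f p q" and f: "continuous_on (crect A B C D) f" and K: "AE z in M. \<bar>p z\<bar> \<le> K"
    and "C < D" and ab: "A \<le> a" "a \<le> b" "b \<le> B" and y: "y \<in> {C..D}"
  shows "\<bar>f (pt b y) - f (pt a y)\<bar> \<le> K * (b - a)"
proof (rule bound_from_integrals[OF \<open>C < D\<close> _ _ y])
  show "continuous_on {C..D} (\<lambda>y. f (pt b y) - f (pt a y))"
    using ab by (intro continuous_intros cont_line1[OF f]) auto
  show "\<bar>integral {c..d} (\<lambda>y. f (pt b y) - f (pt a y))\<bar> \<le> K * (b - a) * (d - c)" if "C \<le> c" "c \<le> d" "d \<le> D" for c d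
  proof -
    have sub: "rect a b c d \<subseteq> S" using ab that by (auto simp: S_def mem_rect)
    show ?thesis
      using sub_LINT_bound[OF strongD(8)[OF v] K sub ab(2) that(2)]
      unfolding strong_cont_section1[OF v f ab that] by (simp add: mult.assoc)
  qed
qed

lemma strong_line2:
  assumes v: "strong f p q" and f: "continuous_on (crect A B C D) f" and K: "AE z in M. \<bar>q z\<bar> \<le> K"
    and "A < B" and cd: "C \<le> c" "c \<le> d" "d \<le> D" and x: "x \<in> {A..B}"
  shows "\<bar>f (pt x d) - f (pt x c)\<bar> \<le> K * (d - c)"
proof (rule bound_from_integrals[OF \<open>A < B\<close> _ _ x])
  show "continuous_on {A..B} (\<lambda>x. f (pt x d) - f (pt x c))"
    using cd by (intro continuous_intros cont_line2[OF f]) auto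
  show "\<bar>integral {a..b} (\<lambda>x. f (pt x d) - f (pt x c))\<bar> \<le> K * (d - c) * (b - a)" if "A \<le> a" "a \<le> b" "b \<le> B" for a b
  proof -
    have sub: "rect a b c d \<subseteq> S" using cd that by (auto simp: S_def mem_rect)
    show ?thesis
      using sub_LINT_bound[OF strongD(9)[OF v] K sub that(2) cd(2)]
      unfolding strong_cont_section2[OF v f that cd] by (simp add: ac_simps)
  qed
qed

text \<open>On the side x = A the integrals of \<open>W n\<close> over any segment converge to those
  of \<open>f\<close> by \<open>section1\<close>, and to those of \<open>g\<close> by assumption. So
  f - g has zero integral over each segment.\<close>

lemma section1_trace:
  assumes f: "continuous_on (crect A B C D) f" and W: "\<And>n. pd1 (W n) (W1 n)"
    and Wf: "L2lim M W f" and Wp: "L2lim M W1 p"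
    and "A < B" "C < D" and g: "continuous_on {C..D} g"
    and trace: "(\<lambda>n. integral {C..D} (\<lambda>y. \<bar>W n (pt A y) - g y\<bar>)) \<longlonglongrightarrow> 0" and y: "y \<in> {C..D}"
  shows "f (pt A y) = g y"
proof -
  have Wc: "continuous_on (crect A B C D) (W n)" for n by (rule pd_continuous(1)[OF W])
  have "\<bar>f (pt A y) - g y\<bar> \<le> 0"
  proof (rule bound_from_integrals[OF \<open>C < D\<close> _ _ y])
    show "continuous_on {C..D} (\<lambda>y. f (pt A y) - g y)"
      using AB by (intro continuous_intros cont_line1[OF f] g) auto
    show "\<bar>integral {c..d} (\<lambda>y. f (pt A y) - g y)\<bar> \<le> 0 * (d - c)" if cd: "C \<le> c" "c \<le> d" "d \<le> D" for c d
    proof -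
      have gi: "g integrable_on {c..d}"
        using cd by (intro integrable_continuous_real continuous_on_subset[OF g]) auto
      have Wi: "(\<lambda>y. W n (pt A y)) integrable_on {c..d}" and fi: "(\<lambda>y. f (pt A y)) integrable_on {c..d}" for n
        using cd AB by (intro integrable_continuous_real cont_line1[OF Wc] cont_line1[OF f]; simp)+
      have ai: "(\<lambda>y. \<bar>W n (pt A y) - g y\<bar>) integrable_on {c'..d'}" if "C \<le> c'" "d' \<le> D" for n c' d'
        using that AB
        by (intro integrable_continuous_real continuous_intros cont_line1[OF Wc] continuous_on_subset[OF g]) auto
      have "\<bar>integral {c..d} (\<lambda>y. W n (pt A y)) - integral {c..d} g\<bar> \<le> integral {C..D} (\<lambda>y. \<bar>W n (pt A y) - g y\<bar>)" for n
      proof -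
        have "\<bar>integral {c..d} (\<lambda>y. W n (pt A y) - g y)\<bar> \<le> integral {c..d} (\<lambda>y. \<bar>W n (pt A y) - g y\<bar>)"
          using integral_norm_bound_integral[OF integrable_diff[OF Wi gi] ai[of c d n]] cd by simp
        also have "\<dots> \<le> integral {C..D} (\<lambda>y. \<bar>W n (pt A y) - g y\<bar>)"
          by (rule integral_subset_le) (use cd ai in auto)
        finally show ?thesis using Wi gi by (simp add: integral_diff)
      qed
      then have "(\<lambda>n. integral {c..d} (\<lambda>y. W n (pt A y)) - integral {c..d} g) \<longlonglongrightarrow> 0"
        by (intro Lim_null_comparison[OF _ trace] always_eventually allI) (simp only: real_norm_def)
      then have "(\<lambda>n. integral {c..d} (\<lambda>y. W n (pt A y))) \<longlonglongrightarrow> integral {c..d} g"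
        by (rule LIM_zero_cancel)
      with section1(2)[OF f W Wf Wp \<open>A < B\<close> cd] have "integral {c..d} (\<lambda>y. f (pt A y)) = integral {c..d} g"
        by (rule LIMSEQ_unique)
      then show ?thesis using fi gi by (simp add: integral_diff)
    qed
  qed
  then show ?thesis by simp
qed

end

section \<open>Reflection\<close>

definition mirror :: "real ^ 2 \<Rightarrow> real ^ 2"
  where "mirror z = pt (z $ 1) (- (z $ 2))"

lemma mirror_pt [simp]: "mirror (pt x y) = pt x (- y)"
  by (simp add: mirror_def)

lemma continuous_on_mirror: "continuous_on A mirror"
  unfolding mirror_def[abs_def] by (intro continuous_intros)

lemma pd1_mirror:
  assumes "pd1 F F1"
  shows "pd1 (\<lambda>z. F (mirror z)) (\<lambda>z. F1 (mirror z))"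
  unfolding pd1_def
proof (intro conjI allI)
  show "continuous_on UNIV (\<lambda>z. F (mirror z))" "continuous_on UNIV (\<lambda>z. F1 (mirror z))"
    by (rule continuous_on_compose2[OF pd_continuous(1)[OF assms, of UNIV]]
        continuous_on_compose2[OF pd_continuous(2)[OF assms, of UNIV]], rule continuous_on_mirror, simp)+
  show "((\<lambda>t. F (mirror (pt t y))) has_real_derivative F1 (mirror (pt x y))) (at x)" for x y
    using assms by (simp add: pd1_def)
qed

lemma pd2_mirror:
  assumes "pd2 F F2"
  shows "pd2 (\<lambda>z. F (mirror z)) (\<lambda>z. - F2 (mirror z))"
  unfolding pd2_def
proof (intro conjI allI)
  have c: "continuous_on UNIV (\<lambda>z. F (mirror z))" "continuous_on UNIV (\<lambda>z. F2 (mirror z))"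
    by (rule continuous_on_compose2[OF pd_continuous(3)[OF assms, of UNIV]]
        continuous_on_compose2[OF pd_continuous(4)[OF assms, of UNIV]], rule continuous_on_mirror, simp)+
  then show "continuous_on UNIV (\<lambda>z. F (mirror z))" "continuous_on UNIV (\<lambda>z. - F2 (mirror z))"
    by (auto intro: continuous_intros)
  have F: "((\<lambda>t. F (pt x t)) has_real_derivative F2 (pt x (- y))) (at (- y))" for x y
    using assms by (simp add: pd2_def)
  have "((\<lambda>t. F (pt x (- t))) has_real_derivative F2 (pt x (- y)) * (- 1)) (at y)" for x y
    by (rule DERIV_chain2[of "\<lambda>t. F (pt x t)" _ uminus, OF F]) (auto intro!: derivative_eq_intros)
  then show "((\<lambda>t. F (mirror (pt x t))) has_real_derivative - F2 (mirror (pt x y))) (at y)" for x y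
    by simp
qed

lemma pd_lin:
  "pd1 F F1 \<Longrightarrow> pd1 G G1 \<Longrightarrow> pd1 (\<lambda>z. r * F z + s * G z) (\<lambda>z. r * F1 z + s * G1 z)"
  "pd2 F F1 \<Longrightarrow> pd2 G G1 \<Longrightarrow> pd2 (\<lambda>z. r * F z + s * G z) (\<lambda>z. r * F1 z + s * G1 z)"
  unfolding pd1_def pd2_def by (auto intro!: continuous_intros derivative_eq_intros)

lemma C2_mirror:
  assumes "C2 F F1 F2 F12 F21"
  shows "C2 (\<lambda>z. F (mirror z)) (\<lambda>z. F1 (mirror z)) (\<lambda>z. - F2 (mirror z)) (\<lambda>z. - F12 (mirror z)) (\<lambda>z. - F21 (mirror z))"
proof -
  have "pd1 (\<lambda>z. - 1 * F2 (mirror z) + 0 * F2 (mirror z)) (\<lambda>z. - 1 * F21 (mirror z) + 0 * F21 (mirror z))"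
    using assms unfolding C2_def by (intro pd_lin pd1_mirror) auto
  then show ?thesis
    using assms pd1_mirror[of F F1] pd2_mirror[of F F2] pd2_mirror[of F1 F12] unfolding C2_def by simp
qed

lemma C2_lin:
  assumes "C2 F F1 F2 F12 F21" "C2 G G1 G2 G12 G21"
  shows "C2 (\<lambda>z. r * F z + s * G z) (\<lambda>z. r * F1 z + s * G1 z) (\<lambda>z. r * F2 z + s * G2 z)
    (\<lambda>z. r * F12 z + s * G12 z) (\<lambda>z. r * F21 z + s * G21 z)"
  using assms unfolding C2_def by (auto intro: pd_lin)

text \<open>The reflection is diagonal with factors 1 and -1, so the density in the affine change of
  variables is 1.\<close>

lemma distr_mirror: "distr lebesgue lebesgue mirror = lebesgue" and mirror_measurable: "mirror \<in> lebesgue \<rightarrow>\<^sub>M lebesgue"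
proof -
  define c :: "real ^ 2 \<Rightarrow> real" where "c j = (if j = axis 1 1 then 1 else - 1)" for j
  have nz: "c j \<noteq> 0" for j by (simp add: c_def)
  have ne: "(axis 1 1 :: real ^ 2) \<noteq> axis 2 1" by (simp add: axis_eq_axis)
  have B: "(Basis :: (real ^ 2) set) = {axis 1 1, axis 2 1}"
    by (auto simp: Basis_vec_def UNIV_2)
  have T: "(\<lambda>x. 0 + (\<Sum>j\<in>Basis. (c j * (x \<bullet> j)) *\<^sub>R j)) = mirror"
    using ne by (auto simp: B c_def mirror_def pt_alt inner_axis fun_eq_iff)
  have "lebesgue = density (distr lebesgue lebesgue mirror) (\<lambda>_. (\<Prod>j\<in>Basis. \<bar>c j\<bar>))"
    using lebesgue_affine_euclidean[of c 0, OF nz] unfolding T .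
  moreover have "(\<Prod>j\<in>Basis. \<bar>c j\<bar>) = 1" by (intro prod.neutral) (simp add: c_def)
  ultimately show "distr lebesgue lebesgue mirror = lebesgue"
    by (simp add: density_1)
  show "mirror \<in> lebesgue \<rightarrow>\<^sub>M lebesgue"
    using lebesgue_affine_measurable[of c 0, OF nz] unfolding T .
qed

locale symmetric_rectangle = rectangle A B "- D" D for A B D
begin

lemma mirror_S: "mirror z \<in> S \<longleftrightarrow> z \<in> S"
  by (auto simp: mirror_def S_def mem_rect)

lemma mirror_measurable_M: "mirror \<in> M \<rightarrow>\<^sub>M M"
  unfolding M_def by (rule measurable_restrict_space3[OF mirror_measurable]) (auto simp: mirror_S)

lemma distr_mirror_M: "distr M M mirror = M"
proof (rule measure_eqI)
  fix X assume "X \<in> sets (distr M M mirror)"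
  then have X: "X \<in> sets M" by simp
  then have X': "X \<in> sets lebesgue" "X \<subseteq> S"
    unfolding M_def by (auto simp: sets_restrict_space_iff S_def)
  have "emeasure (distr M M mirror) X = emeasure M (mirror -` X \<inter> S)"
    using X by (simp add: emeasure_distr[OF mirror_measurable_M])
  also have "mirror -` X \<inter> S = mirror -` X" using X'(2) mirror_S by auto
  also have "emeasure M (mirror -` X) = emeasure lebesgue (mirror -` X)"
    unfolding M_def by (rule emeasure_restrict_space) (use X'(2) mirror_S in \<open>auto simp: S_def\<close>)
  also have "\<dots> = emeasure (distr lebesgue lebesgue mirror) X"
    using X' by (simp add: emeasure_distr[OF mirror_measurable])
  also have "\<dots> = emeasure M X"
    unfolding distr_mirror M_def by (rule emeasure_restrict_space[symmetric]) (use X'(2) in \<open>auto simp: S_def\<close>)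
  finally show "emeasure (distr M M mirror) X = emeasure M X" .
qed simp

lemma L2lim_mirror:
  assumes "L2lim M V v"
  shows "L2lim M (\<lambda>n z. V n (mirror z)) (\<lambda>z. v (mirror z))"
proof -
  note V = L2limD[OF assms]
  have i: "integrable M (\<lambda>z. g (mirror z))" "(LINT z|M. g (mirror z)) = (LINT z|M. g z)" if "integrable M g" for g :: "real ^ 2 \<Rightarrow> real"
    using integrable_distr[OF mirror_measurable_M, of g] integral_distr[OF mirror_measurable_M, of g] that
    unfolding distr_mirror_M by (auto simp: borel_measurable_integrable)
  show ?thesis
    unfolding L2lim_def
    using V i(1)[OF V(2)] i(1)[OF V(4)] i(2)[OF V(6)]
      measurable_compose[OF mirror_measurable_M V(1)] measurable_compose[OF mirror_measurable_M V(3)] by simp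
qed

lemma strong_mirror:
  assumes "strong v v1 v2"
  shows "strong (\<lambda>z. v (mirror z)) (\<lambda>z. v1 (mirror z)) (\<lambda>z. - v2 (mirror z))"
proof -
  obtain V V1 V2 V12 V21 where V: "\<And>n. C2 (V n) (V1 n) (V2 n) (V12 n) (V21 n)"
    and lim: "L2lim M V v" "L2lim M V1 v1" "L2lim M V2 v2"
    using assms unfolding strong_def by blast
  show ?thesis
    by (rule strongI[OF C2_mirror[OF V] L2lim_mirror[OF lim(1)] L2lim_mirror[OF lim(2)] L2lim_minus[OF L2lim_mirror[OF lim(3)]]])
qed

end

context rectangle
begin

lemma strong_lin:
  assumes "strong v v1 v2" "strong w w1 w2"
  shows "strong (\<lambda>z. r * v z + s * w z) (\<lambda>z. r * v1 z + s * w1 z) (\<lambda>z. r * v2 z + s * w2 z)"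
proof -
  obtain V V1 V2 V12 V21 where V: "\<And>n. C2 (V n) (V1 n) (V2 n) (V12 n) (V21 n)"
    and vlim: "L2lim M V v" "L2lim M V1 v1" "L2lim M V2 v2"
    using assms unfolding strong_def by blast
  obtain W W1 W2 W12 W21 where W: "\<And>n. C2 (W n) (W1 n) (W2 n) (W12 n) (W21 n)"
    and wlim: "L2lim M W w" "L2lim M W1 w1" "L2lim M W2 w2"
    using assms unfolding strong_def by blast
  show ?thesis
    by (rule strongI[OF C2_lin[OF V W] L2lim_add[OF L2lim_cmult[OF vlim(1)] L2lim_cmult[OF wlim(1)]]
      L2lim_add[OF L2lim_cmult[OF vlim(2)] L2lim_cmult[OF wlim(2)]]
      L2lim_add[OF L2lim_cmult[OF vlim(3)] L2lim_cmult[OF wlim(3)]]])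
qed

lemma strong_C2:
  assumes "C2 F F1 F2 F12 F21"
  shows "strong F F1 F2"
proof -
  have "L2lim M (\<lambda>_. f) f" if "continuous_on UNIV f" for f
    unfolding L2lim_def using that by (auto intro!: cont_measurable cont_integrable continuous_intros)
  then show ?thesis
    by (intro strongI[OF assms]) (use assms in \<open>auto simp: C2_def intro: pd_continuous\<close>)
qed

end

text \<open>Take the odd parts of the approximants; they converge to the odd part of
  \<open>p\<close>, which is \<open>p\<close>, and by uniqueness their derivatives have the limits
  \<open>p1\<close> and \<open>p2\<close>. Odd continuous functions vanish exactly on the axis,
  which replaces a trace of \<open>p\<close> there.\<close>

lemma (in symmetric_rectangle) strong_odd:
  assumes p: "strong p p1 p2" and odd: "AE z in M. p (mirror z) = - p z"
  obtains P P1 P2 P12 P21 where "\<And>n. C2 (P n) (P1 n) (P2 n) (P12 n) (P21 n)"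
    "L2lim M P p" "L2lim M P1 p1" "L2lim M P2 p2" "\<And>n x. P n (pt x 0) = 0"
proof -
  obtain V V1 V2 V12 V21 where V: "\<And>n. C2 (V n) (V1 n) (V2 n) (V12 n) (V21 n)"
    and lim: "L2lim M V p" "L2lim M V1 p1" "L2lim M V2 p2"
    using p unfolding strong_def by blast
  define P where "P n z = 1/2 * V n z + (- 1/2) * V n (mirror z)" for n z
  define P1 where "P1 n z = 1/2 * V1 n z + (- 1/2) * V1 n (mirror z)" for n z
  define P2 where "P2 n z = 1/2 * V2 n z + (- 1/2) * (- V2 n (mirror z))" for n z
  define P12 where "P12 n z = 1/2 * V12 n z + (- 1/2) * (- V12 n (mirror z))" for n z
  define P21 where "P21 n z = 1/2 * V21 n z + (- 1/2) * (- V21 n (mirror z))" for n z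
  have P: "C2 (P n) (P1 n) (P2 n) (P12 n) (P21 n)" for n
    unfolding P_def[abs_def] P1_def[abs_def] P2_def[abs_def] P12_def[abs_def] P21_def[abs_def]
    by (rule C2_lin[OF V C2_mirror[OF V]])
  have L: "L2lim M P (\<lambda>z. 1/2 * p z + (- 1/2) * p (mirror z))"
    "L2lim M P1 (\<lambda>z. 1/2 * p1 z + (- 1/2) * p1 (mirror z))"
    "L2lim M P2 (\<lambda>z. 1/2 * p2 z + (- 1/2) * (- p2 (mirror z)))"
    unfolding P_def[abs_def] P1_def[abs_def] P2_def[abs_def]
    by (intro L2lim_add L2lim_cmult L2lim_mirror L2lim_minus lim)+
  have s: "strong (\<lambda>z. 1/2 * p z + (- 1/2) * p (mirror z)) (\<lambda>z. 1/2 * p1 z + (- 1/2) * p1 (mirror z))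
      (\<lambda>z. 1/2 * p2 z + (- 1/2) * (- p2 (mirror z)))"
    by (rule strongI[OF P L])
  have eq: "AE z in M. 1/2 * p z + (- 1/2) * p (mirror z) = p z"
    using odd by eventually_elim simp
  show ?thesis
  proof (rule that[OF P])
    show "L2lim M P p" by (rule L2lim_cong_AE[OF L(1) strongD(1)[OF p] eq])
    show "L2lim M P1 p1" by (rule L2lim_cong_AE[OF L(2) strongD(2)[OF p] strong_unique(1)[OF s p eq]])
    show "L2lim M P2 p2" by (rule L2lim_cong_AE[OF L(3) strongD(3)[OF p] strong_unique(2)[OF s p eq]])
    show "P n (pt x 0) = 0" for n x by (simp add: P_def)
  qed
qed

section \<open>The cut-off identity on the half strip\<close>

text \<open>Slopes \<plusminus>1/\<epsilon> on the two edge layers and 0 between them, with value 0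
  at both ends: differentiating it localises the integral to the layers without boundary
  terms.\<close>

definition trap :: "real \<Rightarrow> real \<Rightarrow> real \<Rightarrow> real"
  where "trap \<epsilon> l x = min 1 (min (x / \<epsilon>) ((l - x) / \<epsilon>))"

lemma trap_continuous: "\<epsilon> > 0 \<Longrightarrow> continuous_on A f \<Longrightarrow> continuous_on A (\<lambda>z. trap \<epsilon> l (f z))"
  unfolding trap_def by (intro continuous_intros) auto

lemma trap_bounds: "\<epsilon> > 0 \<Longrightarrow> 0 \<le> x \<Longrightarrow> x \<le> l \<Longrightarrow> 0 \<le> trap \<epsilon> l x \<and> trap \<epsilon> l x \<le> 1"
  by (auto simp: trap_def)

text \<open>The cut-off is only Lipschitz, so integration by parts is done on the three intervals
  where it is linear; the values of \<open>F\<close> at \<epsilon> and l - \<epsilon>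
  cancel.\<close>

lemma trap_ibp:
  fixes F :: "real \<Rightarrow> real"
  assumes e: "0 < \<epsilon>" "2 * \<epsilon> \<le> l" and F: "\<And>x. (F has_real_derivative F' x) (at x)"
  shows "integral {0..l} (\<lambda>x. trap \<epsilon> l x * F' x) = (integral {l - \<epsilon>..l} F - integral {0..\<epsilon>} F) / \<epsilon>"
proof -
  have Fc: "continuous_on A F" for A
    by (intro continuous_at_imp_continuous_on ballI DERIV_isCont[OF F])
  have Fi: "(F has_integral integral {a..b} F) {a..b}" for a b
    by (intro integrable_integral integrable_continuous_real Fc)
  have ftc: "(G' has_integral G b - G a) {a..b}" if "a \<le> b" "\<And>x. (G has_real_derivative G' x) (at x)" for G G' :: "real \<Rightarrow> real" and a b
    using that by (intro fundamental_theorem_of_calculus)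
      (auto simp: has_real_derivative_iff_has_vector_derivative intro: has_vector_derivative_at_within)
  have "((\<lambda>x. F x / \<epsilon> + x / \<epsilon> * F' x) has_integral \<epsilon> / \<epsilon> * F \<epsilon> - 0 / \<epsilon> * F 0) {0..\<epsilon>}"
    by (rule ftc) (use e in \<open>auto intro!: derivative_eq_intros F simp: add_divide_distrib diff_divide_distrib mult.commute\<close>)
  from has_integral_diff[OF this has_integral_divide[OF Fi, where c = \<epsilon>]]
  have h1: "((\<lambda>x. x / \<epsilon> * F' x) has_integral F \<epsilon> - integral {0..\<epsilon>} F / \<epsilon>) {0..\<epsilon>}"
    using e by simp
  have h2: "(F' has_integral F (l - \<epsilon>) - F \<epsilon>) {\<epsilon>..l - \<epsilon>}"
    by (rule ftc) (use e F in auto)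
  have "((\<lambda>x. - F x / \<epsilon> + (l - x) / \<epsilon> * F' x) has_integral (l - l) / \<epsilon> * F l - (l - (l - \<epsilon>)) / \<epsilon> * F (l - \<epsilon>)) {l - \<epsilon>..l}"
    by (rule ftc) (use e in \<open>auto intro!: derivative_eq_intros F simp: add_divide_distrib diff_divide_distrib mult.commute\<close>)
  from has_integral_add[OF this has_integral_divide[OF Fi, where c = \<epsilon>]]
  have h3: "((\<lambda>x. (l - x) / \<epsilon> * F' x) has_integral - F (l - \<epsilon>) + integral {l - \<epsilon>..l} F / \<epsilon>) {l - \<epsilon>..l}"
    using e by simp
  have "((\<lambda>x. trap \<epsilon> l x * F' x) has_integral F \<epsilon> - integral {0..\<epsilon>} F / \<epsilon>) {0..\<epsilon>}"
    by (rule has_integral_eq[OF _ h1]) (use e in \<open>auto simp: trap_def min_def field_simps\<close>)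
  moreover have "((\<lambda>x. trap \<epsilon> l x * F' x) has_integral F (l - \<epsilon>) - F \<epsilon>) {\<epsilon>..l - \<epsilon>}"
    by (rule has_integral_eq[OF _ h2]) (use e in \<open>auto simp: trap_def min_def field_simps\<close>)
  moreover have "((\<lambda>x. trap \<epsilon> l x * F' x) has_integral - F (l - \<epsilon>) + integral {l - \<epsilon>..l} F / \<epsilon>) {l - \<epsilon>..l}"
  proof (rule has_integral_eq[OF _ h3])
    show "(l - x) / \<epsilon> * F' x = trap \<epsilon> l x * F' x" if "x \<in> {l - \<epsilon>..l}" for x
    proof -
      \<comment> \<open>The descending branch is the smallest of the three on this layer: 2
        \<epsilon> \<le> l gives l - x \<le> \<epsilon> \<le> l - \<epsilon> \<le> x.\<close>
      have "(l - x) / \<epsilon> \<le> x / \<epsilon>" "(l - x) / \<epsilon> \<le> 1"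
        using that e by (auto intro!: divide_right_mono)
      then show ?thesis by (simp add: trap_def)
    qed
  qed
  ultimately have "((\<lambda>x. trap \<epsilon> l x * F' x) has_integral (F \<epsilon> - integral {0..\<epsilon>} F / \<epsilon> + (F (l - \<epsilon>) - F \<epsilon>))
      + (- F (l - \<epsilon>) + integral {l - \<epsilon>..l} F / \<epsilon>)) {0..l}"
    using e by (intro has_integral_combine[of 0 "l - \<epsilon>" l] has_integral_combine[of 0 \<epsilon> "l - \<epsilon>"]) auto
  then show ?thesis
    by (simp add: integral_unique diff_divide_distrib)
qed

lemma trap_LINT:
  assumes e: "0 < \<epsilon>" "2 * \<epsilon> \<le> l" and F: "pd1 F F1"
  shows "(LINT z|lebesgue_on (rect 0 l c d). trap \<epsilon> l (z $ 1) * F1 z)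
    = ((LINT z|lebesgue_on (rect (l - \<epsilon>) l c d). F z) - (LINT z|lebesgue_on (rect 0 \<epsilon> c d). F z)) / \<epsilon>"
proof -
  note c = pd_continuous(1,2)[OF F]
  have "(LINT z|lebesgue_on (rect 0 l c d). trap \<epsilon> l (z $ 1) * F1 z)
      = integral {c..d} (\<lambda>y. integral {0..l} (\<lambda>x. trap \<epsilon> l x * F1 (pt x y)))"
  proof -
    have "continuous_on A (\<lambda>z. trap \<epsilon> l (z $ 1) * F1 z)" for A
      by (intro continuous_on_mult trap_continuous e continuous_intros c)
    then show ?thesis
      using LINT_rect(2)[of 0 l c d "\<lambda>z. trap \<epsilon> l (z $ 1) * F1 z"] by simp
  qed
  also have "\<dots> = integral {c..d} (\<lambda>y. (integral {l - \<epsilon>..l} (\<lambda>x. F (pt x y)) - integral {0..\<epsilon>} (\<lambda>x. F (pt x y))) / \<epsilon>)"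
  proof -
    have "integral {0..l} (\<lambda>x. trap \<epsilon> l x * F1 (pt x y))
      = (integral {l - \<epsilon>..l} (\<lambda>x. F (pt x y)) - integral {0..\<epsilon>} (\<lambda>x. F (pt x y))) / \<epsilon>" for y
      by (rule trap_ibp[OF e]) (use F in \<open>simp add: pd1_def\<close>)
    then show ?thesis by simp
  qed
  also have "\<dots> = (integral {c..d} (\<lambda>y. integral {l - \<epsilon>..l} (\<lambda>x. F (pt x y))) - integral {c..d} (\<lambda>y. integral {0..\<epsilon>} (\<lambda>x. F (pt x y)))) / \<epsilon>"
  proof -
    have i: "(\<lambda>y. integral {a..b} (\<lambda>x. F (pt x y))) integrable_on {c..d}" for a b
    proof -
      have "continuous_on ({c..d} \<times> cbox a b) (\<lambda>(y, x). F (pt x y))"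
        unfolding case_prod_beta'
        by (rule continuous_on_compose2[OF c(1)[of UNIV]]) (auto intro!: continuous_intros)
      from integral_continuous_on_param[OF this] show ?thesis
        by (simp add: integrable_continuous_real)
    qed
    show ?thesis using i by (simp add: integral_diff)
  qed
  also have "\<dots> = ((LINT z|lebesgue_on (rect (l - \<epsilon>) l c d). F z) - (LINT z|lebesgue_on (rect 0 \<epsilon> c d). F z)) / \<epsilon>"
    by (simp add: LINT_rect(2) c)
  finally show ?thesis .
qed

section \<open>Integration by parts on the upper half strip\<close>

locale half_strip = rectangle 0 l 0 "1 / 2" for l +
  assumes l_pos: "0 < l"
begin

text \<open>The weight vanishes to second order at \<open>y = 1/2\<close>, so the free edge contributes no boundary term,
  and its second derivative is the constant \<open>2\<close>.\<close>

definition wt :: "real ^ 2 \<Rightarrow> real"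
  where "wt z = (1 / 2 - z $ 2)\<^sup>2"

definition wt' :: "real ^ 2 \<Rightarrow> real"
  where "wt' z = 1 - 2 * z $ 2"

lemma wt_continuous: "continuous_on A wt" "continuous_on A wt'"
  unfolding wt_def[abs_def] wt'_def[abs_def] by (intro continuous_intros)+

lemma wt_pd: "pd1 wt (\<lambda>_. 0)" "pd2 wt (\<lambda>z. - wt' z)" "pd2 wt' (\<lambda>_. - 2)"
  unfolding pd1_def pd2_def
  by (auto intro!: wt_continuous continuous_intros derivative_eq_intros simp: wt_def wt'_def)

text \<open>The first identity is the divergence form of the Jacobian, tested with the cut-off times
  the weight. The second turns the remaining term, once Q_x is replaced by P_y, into the integral of
  the cut-off times P^2.\<close>

lemma half_strip_identity_smooth:
  assumes P: "C2 P P1 P2 P12 P21" and Q: "C2 Q Q1 Q2 Q12 Q21" and P0: "\<And>x. P (pt x 0) = 0"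
    and e: "0 < \<epsilon>" "2 * \<epsilon> \<le> l"
  shows "(LINT z|M. trap \<epsilon> l (z $ 1) * wt z * (P1 z * Q2 z)) - (LINT z|M. trap \<epsilon> l (z $ 1) * wt z * (P2 z * Q1 z))
      = ((LINT z|lebesgue_on (rect (l - \<epsilon>) l 0 (1/2)). wt z * (P z * Q2 z))
        - (LINT z|lebesgue_on (rect 0 \<epsilon> 0 (1/2)). wt z * (P z * Q2 z))) / \<epsilon>
        - (LINT z|M. trap \<epsilon> l (z $ 1) * wt' z * (P z * Q1 z))"
    and "(LINT z|M. trap \<epsilon> l (z $ 1) * wt' z * (P z * P2 z)) = (LINT z|M. trap \<epsilon> l (z $ 1) * (P z * P z))"
proof -
  have Mr: "M = lebesgue_on (rect 0 l 0 (1/2))" by (simp add: M_def S_def)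
  note pd = P[unfolded C2_def] Q[unfolded C2_def]
  have pc: "continuous_on UNIV P" "continuous_on UNIV P1" "continuous_on UNIV P2" "continuous_on UNIV Q1"
    "continuous_on UNIV Q2" "continuous_on UNIV Q12" "continuous_on UNIV Q21"
    using pd by (auto intro: pd_continuous)
  have tc: "continuous_on UNIV (\<lambda>z::real^2. trap \<epsilon> l (z $ 1))"
    using e by (intro trap_continuous continuous_intros)
  note ci = cont_integrable continuous_on_mult continuous_on_diff continuous_on_minus continuous_on_add continuous_on_const tc pc wt_continuous
  have tp: "pd2 (\<lambda>z. trap \<epsilon> l (z $ 1)) (\<lambda>_. 0)"
    using tc by (simp add: pd2_def)
  define A1 A2 A3 A4 where "A1 = (LINT z|M. trap \<epsilon> l (z $ 1) * wt z * (P1 z * Q2 z))"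
    and "A2 = (LINT z|M. trap \<epsilon> l (z $ 1) * wt z * (P z * Q21 z))"
    and "A3 = (LINT z|M. trap \<epsilon> l (z $ 1) * wt z * (P2 z * Q1 z))"
    and "A4 = (LINT z|M. trap \<epsilon> l (z $ 1) * wt z * (P z * Q12 z))"
  define A5 where "A5 = (LINT z|M. trap \<epsilon> l (z $ 1) * wt' z * (P z * Q1 z))"
  \<comment> \<open>The cut-off is not differentiable in x and so stays outside the product;
    \<open>trap_LINT\<close> supplies its contribution, the two layer integrals.\<close>
  have "pd1 (\<lambda>z. wt z * (P z * Q2 z)) (\<lambda>z. 0 * (P z * Q2 z) + wt z * (P1 z * Q2 z + P z * Q21 z))"
    using pd by (intro pd1_mult wt_pd) auto
  from trap_LINT[OF e this, of 0 "1/2", folded Mr]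
  have 1: "A1 + A2 = ((LINT z|lebesgue_on (rect (l - \<epsilon>) l 0 (1/2)). wt z * (P z * Q2 z))
        - (LINT z|lebesgue_on (rect 0 \<epsilon> 0 (1/2)). wt z * (P z * Q2 z))) / \<epsilon>"
    unfolding A1_def A2_def
    by (subst Bochner_Integration.integral_add[symmetric]) (auto intro!: ci simp: algebra_simps)
  \<comment> \<open>In the y-direction the cut-off is a constant factor. The boundary terms vanish
    since \<open>P\<close> is 0 at y = 0 and \<open>wt\<close> is 0 at y = 1/2.\<close>
  have "pd2 (\<lambda>z. trap \<epsilon> l (z $ 1) * (wt z * (P z * Q1 z)))
     (\<lambda>z. 0 * (wt z * (P z * Q1 z)) + trap \<epsilon> l (z $ 1) * (- wt' z * (P z * Q1 z) + wt z * (P2 z * Q1 z + P z * Q12 z)))"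
    using pd by (intro pd2_mult wt_pd tp) auto
  from LINT_pd2[OF this, of 0 "1/2" 0 l, folded Mr]
  have "(LINT z|M. trap \<epsilon> l (z $ 1) * wt z * (P2 z * Q1 z) + trap \<epsilon> l (z $ 1) * wt z * (P z * Q12 z)
      - trap \<epsilon> l (z $ 1) * wt' z * (P z * Q1 z)) = 0"
    by (simp add: P0 wt_def algebra_simps)
  then have 2: "A3 + A4 - A5 = 0"
    unfolding A3_def A4_def A5_def
    by (subst (asm) Bochner_Integration.integral_diff, (intro ci)+)
       (subst (asm) Bochner_Integration.integral_add, (intro ci)+)
  have 3: "A4 = A2"
    unfolding A2_def A4_def
  proof (rule integral_cong_AE)
    show "AE z in M. trap \<epsilon> l (z $ 1) * wt z * (P z * Q12 z) = trap \<epsilon> l (z $ 1) * wt z * (P z * Q21 z)"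
      using C2_mixed[of Q Q1 Q2 Q12 Q21] pd by auto
  qed (intro cont_measurable ci)+
  show "A1 - A3 = ((LINT z|lebesgue_on (rect (l - \<epsilon>) l 0 (1/2)). wt z * (P z * Q2 z))
        - (LINT z|lebesgue_on (rect 0 \<epsilon> 0 (1/2)). wt z * (P z * Q2 z))) / \<epsilon> - A5"
    using 1 2 3 by simp
  \<comment> \<open>Here \<open>wt'\<close> vanishes at y = 1/2, and its y-derivative -2 is what
    produces the term P^2.\<close>
  have "pd2 (\<lambda>z. trap \<epsilon> l (z $ 1) * (wt' z * (P z * P z)))
     (\<lambda>z. 0 * (wt' z * (P z * P z)) + trap \<epsilon> l (z $ 1) * (- 2 * (P z * P z) + wt' z * (P2 z * P z + P z * P2 z)))"
    using pd by (intro pd2_mult wt_pd tp) auto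
  from LINT_pd2[OF this, of 0 "1/2" 0 l, folded Mr]
  have "(LINT z|M. 2 * (trap \<epsilon> l (z $ 1) * wt' z * (P z * P2 z) - trap \<epsilon> l (z $ 1) * (P z * P z))) = 0"
    by (simp add: P0 wt'_def algebra_simps)
  then show "(LINT z|M. trap \<epsilon> l (z $ 1) * wt' z * (P z * P2 z)) = (LINT z|M. trap \<epsilon> l (z $ 1) * (P z * P z))"
    by (simp, subst (asm) Bochner_Integration.integral_diff, (intro ci)+) simp
qed

text \<open>The zero determinant cancels the two Jacobian terms, and \<open>curl\<close> lets the
  second smooth identity evaluate the last term. Neither relation holds for the approximants, so
  both are used only after the limit.\<close>

lemma half_strip_identity:
  assumes P: "\<And>n. C2 (P n) (P1 n) (P2 n) (P12 n) (P21 n)" and P0: "\<And>n x. P n (pt x 0) = 0"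
    and plim: "L2lim M P p" "L2lim M P1 p1" "L2lim M P2 p2"
    and q: "strong q q1 q2" and curl: "AE z in M. p2 z = q1 z" and det: "AE z in M. p1 z * q2 z = p2 z * q1 z"
    and e: "0 < \<epsilon>" "2 * \<epsilon> \<le> l"
  shows "(LINT z|M. trap \<epsilon> l (z $ 1) * (p z * p z))
    = ((LINT z|lebesgue_on (rect (l - \<epsilon>) l 0 (1/2)). wt z * (p z * q2 z))
        - (LINT z|lebesgue_on (rect 0 \<epsilon> 0 (1/2)). wt z * (p z * q2 z))) / \<epsilon>"
proof -
  obtain Q Q1 Q2 Q12 Q21 where Q: "\<And>n. C2 (Q n) (Q1 n) (Q2 n) (Q12 n) (Q21 n)"
    and qlim: "L2lim M Q q" "L2lim M Q1 q1" "L2lim M Q2 q2"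
    using q unfolding strong_def by blast
  have tc: "continuous_on UNIV (\<lambda>z::real^2. trap \<epsilon> l (z $ 1))"
    using e by (intro trap_continuous continuous_intros)
  note c = tc wt_continuous continuous_on_mult
  note mc = cont_measurable[OF tc] cont_measurable[OF wt_continuous(1)] cont_measurable[OF wt_continuous(2)]
  note [measurable] = mc L2limD(1)[OF plim(1)] L2limD(1)[OF plim(2)] L2limD(1)[OF plim(3)] L2limD(1)[OF qlim(2)] L2limD(1)[OF qlim(3)]
  have edge: "(\<lambda>n. LINT z|lebesgue_on (rect a b 0 (1/2)). wt z * (P n z * Q2 n z)) \<longlonglongrightarrow>
      (LINT z|lebesgue_on (rect a b 0 (1/2)). wt z * (p z * q2 z))" if ab: "0 \<le> a" "a \<le> b" "b \<le> l" for a b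
  proof -
    interpret sub: rectangle a b 0 "1/2" using ab by unfold_locales auto
    have sub: "rect a b 0 (1/2) \<subseteq> S" using ab by (auto simp: S_def mem_rect)
    have M': "sub.M = lebesgue_on (rect a b 0 (1/2))" by (simp add: sub.M_def sub.S_def)
    show ?thesis
      using sub.L2lim_mult_cont(1)[OF _ _ wt_continuous(1)] sub_L2lim[OF sub] plim(1) qlim(3) unfolding M' by blast
  qed
  have 1: "(LINT z|M. trap \<epsilon> l (z $ 1) * wt z * (p1 z * q2 z)) - (LINT z|M. trap \<epsilon> l (z $ 1) * wt z * (p2 z * q1 z))
      = ((LINT z|lebesgue_on (rect (l - \<epsilon>) l 0 (1/2)). wt z * (p z * q2 z))
        - (LINT z|lebesgue_on (rect 0 \<epsilon> 0 (1/2)). wt z * (p z * q2 z))) / \<epsilon>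
        - (LINT z|M. trap \<epsilon> l (z $ 1) * wt' z * (p z * q1 z))" (is "?l = ?r")
  proof (rule LIMSEQ_unique)
    show "(\<lambda>n. (LINT z|M. trap \<epsilon> l (z $ 1) * wt z * (P1 n z * Q2 n z)) - (LINT z|M. trap \<epsilon> l (z $ 1) * wt z * (P2 n z * Q1 n z))) \<longlonglongrightarrow> ?l"
      by (intro tendsto_diff L2lim_mult_cont(1) plim qlim c)
    show "(\<lambda>n. (LINT z|M. trap \<epsilon> l (z $ 1) * wt z * (P1 n z * Q2 n z)) - (LINT z|M. trap \<epsilon> l (z $ 1) * wt z * (P2 n z * Q1 n z))) \<longlonglongrightarrow> ?r"
      unfolding half_strip_identity_smooth(1)[OF P Q P0 e]
      by (intro tendsto_diff tendsto_divide tendsto_const edge L2lim_mult_cont(1) plim qlim c) (use e in auto)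
  qed
  have 2: "(LINT z|M. trap \<epsilon> l (z $ 1) * wt' z * (p z * p2 z)) = (LINT z|M. trap \<epsilon> l (z $ 1) * (p z * p z))"
  proof (rule LIMSEQ_unique)
    show "(\<lambda>n. LINT z|M. trap \<epsilon> l (z $ 1) * wt' z * (P n z * P2 n z)) \<longlonglongrightarrow> (LINT z|M. trap \<epsilon> l (z $ 1) * wt' z * (p z * p2 z))"
      by (intro L2lim_mult_cont(1) plim c)
    show "(\<lambda>n. LINT z|M. trap \<epsilon> l (z $ 1) * wt' z * (P n z * P2 n z)) \<longlonglongrightarrow> (LINT z|M. trap \<epsilon> l (z $ 1) * (p z * p z))"
      unfolding half_strip_identity_smooth(2)[OF P Q P0 e] by (intro L2lim_mult_cont(1) plim c)
  qed
  have 3: "(LINT z|M. trap \<epsilon> l (z $ 1) * wt z * (p1 z * q2 z)) = (LINT z|M. trap \<epsilon> l (z $ 1) * wt z * (p2 z * q1 z))"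
    by (rule integral_cong_AE) (measurable, use det in auto)
  have 4: "(LINT z|M. trap \<epsilon> l (z $ 1) * wt' z * (p z * q1 z)) = (LINT z|M. trap \<epsilon> l (z $ 1) * wt' z * (p z * p2 z))"
    by (rule integral_cong_AE) (measurable, use curl in auto)
  show ?thesis using 1 2 3 4 by simp
qed

text \<open>Cauchy-Schwarz on a layer. The factor \<epsilon> gained from \<open>p\<close> is there
  to cancel the 1/\<epsilon> of the cut-off.\<close>

lemma edge_estimate:
  assumes p: "p \<in> borel_measurable M" "integrable M (\<lambda>z. (p z)\<^sup>2)"
    and q: "q \<in> borel_measurable M" "integrable M (\<lambda>z. (q z)\<^sup>2)"
    and ab: "0 \<le> a" "a \<le> b" "b \<le> l" and e: "0 < \<epsilon>"
    and K: "(LINT z|lebesgue_on (rect a b 0 (1/2)). (p z)\<^sup>2) \<le> (K * \<epsilon>)\<^sup>2" "0 \<le> K"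
  shows "\<bar>LINT z|lebesgue_on (rect a b 0 (1/2)). wt z * (p z * q z)\<bar>
    \<le> K * \<epsilon> * sqrt (LINT z|lebesgue_on (rect a b 0 (1/2)). (q z)\<^sup>2)"
proof -
  let ?N = "lebesgue_on (rect a b 0 (1/2))"
  have sub: "rect a b 0 (1/2) \<subseteq> S" using ab by (auto simp: S_def mem_rect)
  have pN: "p \<in> borel_measurable ?N" "integrable ?N (\<lambda>z. (p z)\<^sup>2)"
    and qN: "q \<in> borel_measurable ?N" "integrable ?N (\<lambda>z. (q z)\<^sup>2)"
    using p q sub_integrable[OF sub] unfolding sub_space[OF sub] by (auto intro: measurable_restrict_space1)
  have i: "integrable ?N (\<lambda>z. p z * q z)" by (rule integrable_mult_square[OF pN(1) qN(1) pN(2) qN(2)])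
  have w: "0 \<le> wt z \<and> wt z \<le> 1" if "z \<in> rect a b 0 (1/2)" for z
  proof -
    have "\<bar>1 / 2 - z $ 2\<bar> \<le> 1" using that by (auto simp: mem_rect)
    then show ?thesis using power_le_one[of "\<bar>1 / 2 - z $ 2\<bar>" 2] by (simp add: wt_def)
  qed
  have "\<bar>LINT z|?N. wt z * (p z * q z)\<bar> \<le> (LINT z|?N. \<bar>wt z * (p z * q z)\<bar>)"
    by (rule integral_abs_bound)
  also have "\<dots> \<le> (LINT z|?N. \<bar>p z * q z\<bar>)"
  proof (rule integral_mono_AE')
    show "AE z in ?N. \<bar>wt z * (p z * q z)\<bar> \<le> \<bar>p z * q z\<bar>"
      by (rule AE_I2) (use w in \<open>auto simp: abs_mult intro!: mult_left_le_one_le\<close>)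
  qed (use i in auto)
  also have "\<dots> \<le> sqrt (LINT z|?N. (p z)\<^sup>2) * sqrt (LINT z|?N. (q z)\<^sup>2)"
    by (rule Cauchy_Schwarz_LINT[OF pN(1) qN(1) pN(2) qN(2)])
  also have "\<dots> \<le> K * \<epsilon> * sqrt (LINT z|?N. (q z)\<^sup>2)"
  proof (rule mult_right_mono)
    have "0 \<le> K * \<epsilon>" using K(2) e by simp
    then show "sqrt (LINT z|?N. (p z)\<^sup>2) \<le> K * \<epsilon>"
      using real_sqrt_le_mono[OF K(1)] by simp
  qed simp
  finally show ?thesis .
qed

text \<open>Absolute continuity of the integral: the indicators of the layers tend to 0 at each
  interior point, dominated by |g|.\<close>

lemma shrinking_LINT:
  fixes g :: "real ^ 2 \<Rightarrow> real"
  assumes g: "integrable M g" and ab: "\<And>n. 0 \<le> a n" "\<And>n. b n \<le> l"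
    and out: "\<And>x. 0 < x \<Longrightarrow> x < l \<Longrightarrow> \<forall>\<^sub>F n in sequentially. \<not> (a n < x \<and> x < b n)"
  shows "(\<lambda>n. LINT z|lebesgue_on (rect (a n) (b n) 0 (1/2)). g z) \<longlonglongrightarrow> 0"
proof -
  have sub: "rect (a n) (b n) 0 (1/2) \<subseteq> S" for n using ab[of n] by (auto simp: S_def mem_rect)
  have "(\<lambda>n. LINT z|M. indicator (rect (a n) (b n) 0 (1/2)) z * g z) \<longlonglongrightarrow> (LINT z|M. 0)"
  proof (rule integral_dominated_convergence)
    show "integrable M (\<lambda>z. \<bar>g z\<bar>)" using g by simp
    show "(\<lambda>z. indicator (rect (a n) (b n) 0 (1/2)) z * g z) \<in> borel_measurable M" for n
      using integrable_mult_indicator[OF sub_sets[OF sub] g, of n] by (simp add: borel_measurable_integrable)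
    show "AE z in M. norm (indicator (rect (a n) (b n) 0 (1/2)) z * g z) \<le> \<bar>g z\<bar>" for n
      by (auto simp: indicator_def)
    have "(\<lambda>n. indicator (rect (a n) (b n) 0 (1/2)) z * g z) \<longlonglongrightarrow> 0" if "z \<in> S" for z
    proof -
      have "\<forall>\<^sub>F n in sequentially. \<not> (a n < z $ 1 \<and> z $ 1 < b n)"
        using that by (intro out) (auto simp: S_def mem_rect)
      then have "\<forall>\<^sub>F n in sequentially. 0 = indicator (rect (a n) (b n) 0 (1/2)) z * g z"
        by eventually_elim (auto simp: mem_rect indicator_def)
      then show ?thesis by (rule Lim_transform_eventually[OF tendsto_const])
    qed
    then show "AE z in M. (\<lambda>n. indicator (rect (a n) (b n) 0 (1/2)) z * g z) \<longlonglongrightarrow> 0"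
      by (intro AE_I2) simp
  qed simp
  then show ?thesis by (simp add: sub_LINT[OF sub])
qed

text \<open>After the powers of \<epsilon> cancel, the weighted integral of p^2 is at most
  \<open>K\<close> times the norms of \<open>q2\<close> over the two layers. These tend to 0, while
  the cut-off tends to 1.\<close>

lemma half_strip_rigidity:
  assumes P: "\<And>n. C2 (P n) (P1 n) (P2 n) (P12 n) (P21 n)" and P0: "\<And>n x. P n (pt x 0) = 0"
    and plim: "L2lim M P p" "L2lim M P1 p1" "L2lim M P2 p2"
    and q: "strong q q1 q2" and curl: "AE z in M. p2 z = q1 z" and det: "AE z in M. p1 z * q2 z = p2 z * q1 z"
    and K: "\<And>\<epsilon>. 0 < \<epsilon> \<Longrightarrow> 2 * \<epsilon> \<le> l \<Longrightarrow> (LINT z|lebesgue_on (rect 0 \<epsilon> 0 (1/2)). (p z)\<^sup>2) \<le> (K * \<epsilon>)\<^sup>2"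
      "\<And>\<epsilon>. 0 < \<epsilon> \<Longrightarrow> 2 * \<epsilon> \<le> l \<Longrightarrow> (LINT z|lebesgue_on (rect (l - \<epsilon>) l 0 (1/2)). (p z)\<^sup>2) \<le> (K * \<epsilon>)\<^sup>2"
      "0 \<le> K"
  shows "AE z in M. p z = 0"
proof -
  \<comment> \<open>The shift by 2 ensures 2 e_n \<le> l already for n = 0.\<close>
  define e where "e n = l / real (n + 2)" for n
  have e: "0 < e n" "2 * e n \<le> l" for n
    using l_pos by (auto simp: e_def field_simps)
  have e0: "e \<longlonglongrightarrow> 0"
    unfolding e_def by real_asymp
  note pm = L2limD(1,2)[OF plim(1)]
  note qm = strongD(3,6)[OF q]
  define El Er where "El n = (LINT z|lebesgue_on (rect 0 (e n) 0 (1/2)). (q2 z)\<^sup>2)"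
    and "Er n = (LINT z|lebesgue_on (rect (l - e n) l 0 (1/2)). (q2 z)\<^sup>2)" for n
  have El: "El \<longlonglongrightarrow> 0"
    unfolding El_def
  proof (rule shrinking_LINT[OF qm(2)])
    show "\<forall>\<^sub>F n in sequentially. \<not> (0 < x \<and> x < e n)" if "0 < x" for x
      using order_tendstoD(2)[OF e0 that] by eventually_elim auto
  qed (use e l_pos in \<open>auto intro: order_trans\<close>, smt (verit) e)
  have Er: "Er \<longlonglongrightarrow> 0"
    unfolding Er_def
  proof (rule shrinking_LINT[OF qm(2)])
    show "\<forall>\<^sub>F n in sequentially. \<not> (l - e n < x \<and> x < l)" if "x < l" for x
      using order_tendstoD(2)[OF e0, of "l - x"] that by (auto elim: eventually_mono)
    show "0 \<le> l - e n" for n using e[of n] by linarith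
  qed simp
  have bound: "(LINT z|M. trap (e n) l (z $ 1) * (p z * p z)) \<le> K * (sqrt (Er n) + sqrt (El n))" for n
  proof -
    have ab: "0 \<le> l - e n" "e n \<le> l" using e[of n] by linarith+
    have "\<bar>LINT z|lebesgue_on (rect (l - e n) l 0 (1/2)). wt z * (p z * q2 z)\<bar> \<le> K * e n * sqrt (Er n)"
      unfolding Er_def by (rule edge_estimate[OF pm qm]) (use e[of n] ab K in auto)
    moreover have "\<bar>LINT z|lebesgue_on (rect 0 (e n) 0 (1/2)). wt z * (p z * q2 z)\<bar> \<le> K * e n * sqrt (El n)"
      unfolding El_def by (rule edge_estimate[OF pm qm]) (use e[of n] ab K in auto)
    ultimately have "(LINT z|lebesgue_on (rect (l - e n) l 0 (1/2)). wt z * (p z * q2 z))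
        - (LINT z|lebesgue_on (rect 0 (e n) 0 (1/2)). wt z * (p z * q2 z)) \<le> e n * (K * (sqrt (Er n) + sqrt (El n)))"
      by (simp add: algebra_simps)
    then show ?thesis
      unfolding half_strip_identity[OF P P0 plim q curl det e]
      using e(1)[of n] by (simp add: pos_divide_le_eq mult.commute)
  qed
  have "(\<lambda>n. K * (sqrt (Er n) + sqrt (El n))) \<longlonglongrightarrow> K * (sqrt 0 + sqrt 0)"
    by (intro tendsto_intros El Er)
  then have up: "(\<lambda>n. K * (sqrt (Er n) + sqrt (El n))) \<longlonglongrightarrow> 0" by simp
  have "(\<lambda>n. LINT z|M. trap (e n) l (z $ 1) * (p z * p z)) \<longlonglongrightarrow> (LINT z|M. (p z)\<^sup>2)"
  proof (rule integral_dominated_convergence)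
    show "integrable M (\<lambda>z. (p z)\<^sup>2)" by (rule pm)
    show "(\<lambda>z. trap (e n) l (z $ 1) * (p z * p z)) \<in> borel_measurable M" for n
    proof -
      have "(\<lambda>z::real^2. trap (e n) l (z $ 1)) \<in> borel_measurable M"
        by (intro cont_measurable trap_continuous e continuous_intros)
      then show ?thesis using pm(1) by measurable
    qed
    show "(\<lambda>z. (p z)\<^sup>2) \<in> borel_measurable M" using pm(1) by measurable
    have "norm (trap (e n) l (z $ 1) * (p z * p z)) \<le> (p z)\<^sup>2" if "z \<in> S" for z n
    proof -
      have "0 \<le> trap (e n) l (z $ 1) \<and> trap (e n) l (z $ 1) \<le> 1"
        using that by (intro trap_bounds e) (auto simp: S_def mem_rect)
      then show ?thesis by (simp add: abs_mult power2_eq_square mult_left_le_one_le)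
    qed
    then show "AE z in M. norm (trap (e n) l (z $ 1) * (p z * p z)) \<le> (p z)\<^sup>2" for n
      by (intro AE_I2) simp
    have "(\<lambda>n. trap (e n) l (z $ 1) * (p z * p z)) \<longlonglongrightarrow> (p z)\<^sup>2" if z: "z \<in> S" for z
    proof -
      have pos: "0 < z $ 1" "0 < l - z $ 1" using z by (auto simp: S_def mem_rect)
      have "\<forall>\<^sub>F n in sequentially. (p z)\<^sup>2 = trap (e n) l (z $ 1) * (p z * p z)"
        using order_tendstoD(2)[OF e0 pos(1)] order_tendstoD(2)[OF e0 pos(2)]
      proof eventually_elim
        case (elim n)
        then have "1 \<le> z $ 1 / e n" "1 \<le> (l - z $ 1) / e n"
          using e(1)[of n] by (auto simp: pos_le_divide_eq)
        then have "trap (e n) l (z $ 1) = 1" by (simp add: trap_def)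
        then show ?case by (simp add: power2_eq_square)
      qed
      then show ?thesis by (rule Lim_transform_eventually[OF tendsto_const])
    qed
    then show "AE z in M. (\<lambda>n. trap (e n) l (z $ 1) * (p z * p z)) \<longlonglongrightarrow> (p z)\<^sup>2"
      by (intro AE_I2) simp
  qed
  then have "(LINT z|M. (p z)\<^sup>2) \<le> 0"
    by (rule LIMSEQ_le[OF _ up]) (use bound in blast)
  then have "(LINT z|M. (p z)\<^sup>2) = 0"
    by (intro antisym) auto
  then show ?thesis
    using integral_nonneg_eq_0_iff_AE[OF pm(2)] by simp
qed

end

section \<open>Rigidity of the transversal component\<close>

locale strip_rect = symmetric_rectangle 0 l "1 / 2" for l +
  assumes l_pos: "0 < l"
begin

text \<open>Since \<open>|p| \<le> 1\<close>, the corner condition forces the integral of \<open>\<sigma> q\<close> over the strip to be nearly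
  maximal, and \<open>p\<^sup>2 \<le> 1 - q\<^sup>2 \<le> 2 - 2 \<sigma> q\<close>.\<close>

lemma edge_gradient:
  assumes f: "strong f p q" and fc: "continuous_on (crect 0 l (- (1/2)) (1/2)) f"
    and odd: "\<And>x y. x \<in> {0..l} \<Longrightarrow> y \<in> {- (1/2)..1/2} \<Longrightarrow> f (pt x (- y)) = - f (pt x y)"
    and grad: "AE z in M. (p z)\<^sup>2 + (q z)\<^sup>2 \<le> 1"
    and ab: "0 \<le> a" "a \<le> b" "b \<le> l" and x0: "x0 = a \<or> x0 = b" and corner: "\<bar>f (pt x0 (1/2))\<bar> = 1/2"
  shows "(LINT z|lebesgue_on (rect a b 0 (1/2)). (p z)\<^sup>2) \<le> (2 * (b - a))\<^sup>2"
proof -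
  \<comment> \<open>\<sigma> is the sign of the corner value, which is known only up to
    sign.\<close>
  define \<sigma> where "\<sigma> = 2 * f (pt x0 (1/2))"
  have \<sigma>: "\<bar>\<sigma>\<bar> = 1" using corner by (simp add: \<sigma>_def abs_mult)
  then have \<sigma>2: "\<sigma> * \<sigma> = 1" by (metis abs_mult_self_eq mult.right_neutral)
  have half: "(1/2::real) \<in> {- (1/2)..1/2}" by simp
  have p1: "AE z in M. \<bar>p z\<bar> \<le> 1"
    using grad
  proof eventually_elim
    case (elim z)
    then have "(p z)\<^sup>2 \<le> 1" using zero_le_power2[of "q z"] by linarith
    then show ?case by (simp add: abs_square_le_1)
  qed
  let ?E = "rect a b (- (1/2)) (1/2)"
  have sub: "?E \<subseteq> S" using ab by (auto simp: S_def mem_rect)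
  \<comment> \<open>Along the long edge \<open>f\<close> is 1-Lipschitz, so its value stays within b
    - a of the corner value; oddness doubles the value and the error.\<close>
  have low: "1 - 2 * (b - a) \<le> \<sigma> * (f (pt x (1/2)) - f (pt x (- (1/2))))" if x: "x \<in> {a..b}" for x
  proof -
    have "\<bar>f (pt x (1/2)) - f (pt x0 (1/2))\<bar> \<le> b - a"
    proof (cases "x \<le> x0")
      case True
      then show ?thesis
        using strong_line1[OF f fc p1 _ _ _ _ half, of x x0] x ab x0 by (auto simp: abs_minus_commute)
    next
      case False
      then show ?thesis
        using strong_line1[OF f fc p1 _ _ _ _ half, of x0 x] x ab x0 by auto
    qed
    then have "\<bar>\<sigma> * (f (pt x (1/2)) - f (pt x0 (1/2)))\<bar> \<le> b - a"
      using \<sigma> by (simp add: abs_mult)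
    moreover have "\<sigma> * (f (pt x (1/2)) - f (pt x0 (1/2))) = \<sigma> * f (pt x (1/2)) - 1/2"
      using \<sigma>2 by (simp add: \<sigma>_def algebra_simps)
    moreover have "f (pt x (- (1/2))) = - f (pt x (1/2))"
      using odd[of x "1/2"] x ab by simp
    ultimately show ?thesis by (simp add: algebra_simps)
  qed
  have lines: "continuous_on {a..b} (\<lambda>x. f (pt x (1/2)) - f (pt x (- (1/2))))"
    using ab by (intro continuous_intros cont_line2[OF fc]) auto
  have "(b - a) * (1 - 2 * (b - a)) = integral {a..b} (\<lambda>x. 1 - 2 * (b - a))"
    using ab by simp
  also have "\<dots> \<le> integral {a..b} (\<lambda>x. \<sigma> * (f (pt x (1/2)) - f (pt x (- (1/2)))))"
    by (rule integral_le) (use low in \<open>auto intro!: integrable_continuous_real continuous_on_mult lines\<close>)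
  also have "\<dots> = \<sigma> * (LINT z|lebesgue_on ?E. q z)"
    using strong_cont_section2[OF f fc, of a b "- (1/2)" "1/2"] ab by simp
  finally have J: "(b - a) * (1 - 2 * (b - a)) \<le> \<sigma> * (LINT z|lebesgue_on ?E. q z)" .
  interpret E: finite_measure "lebesgue_on ?E" by (rule rect_finite_measure)
  note pi = sub_integrable[OF sub strongD(5)[OF f]]
  note qi = sub_integrable[OF sub strongD(9)[OF f]]
  have sub': "rect a b 0 (1/2) \<subseteq> S" "rect a b 0 (1/2) \<subseteq> ?E" using ab by (auto simp: S_def mem_rect)
  have "(LINT z|lebesgue_on (rect a b 0 (1/2)). (p z)\<^sup>2) \<le> (LINT z|lebesgue_on ?E. (p z)\<^sup>2)"
    unfolding sub_LINT[OF sub] sub_LINT[OF sub'(1)]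
  proof (rule integral_mono)
    show "integrable M (\<lambda>z. indicator (rect a b 0 (1/2)) z * (p z)\<^sup>2)" "integrable M (\<lambda>z. indicator ?E z * (p z)\<^sup>2)"
      using integrable_mult_indicator[OF sub_sets[OF sub'(1)] strongD(5)[OF f]]
        integrable_mult_indicator[OF sub_sets[OF sub] strongD(5)[OF f]] by simp_all
    show "indicator (rect a b 0 (1/2)) z * (p z)\<^sup>2 \<le> indicator ?E z * (p z)\<^sup>2" for z
      using sub'(2) by (auto simp: indicator_def)
  qed
  also have "\<dots> \<le> (LINT z|lebesgue_on ?E. 2 - 2 * (\<sigma> * q z))"
  proof (rule integral_mono_AE)
    show "AE z in lebesgue_on ?E. (p z)\<^sup>2 \<le> 2 - 2 * (\<sigma> * q z)"
      using sub_AE[OF sub grad]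
    proof eventually_elim
      case (elim z)
      have "0 \<le> (1 - \<sigma> * q z)\<^sup>2" by simp
      also have "\<dots> = 1 - 2 * (\<sigma> * q z) + (\<sigma> * \<sigma>) * (q z)\<^sup>2"
        by (simp add: power2_eq_square algebra_simps)
      finally show ?case using elim \<sigma>2 by simp
    qed
  qed (use pi qi in auto)
  also have "\<dots> = 2 * (b - a) - 2 * (\<sigma> * (LINT z|lebesgue_on ?E. q z))"
    using qi ab by (simp add: measure_restrict_space rect_measure)
  \<comment> \<open>The terms linear in b - a cancel. This gain of a second power is what the
    cut-off argument needs, and it is the origin of the constant 2.\<close>
  also have "\<dots> \<le> 2 * (b - a) - 2 * ((b - a) * (1 - 2 * (b - a)))"
    using J by linarith
  also have "\<dots> = (2 * (b - a))\<^sup>2" by (simp add: power2_eq_square algebra_simps)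
  finally show ?thesis .
qed

text \<open>The cut-off argument gives \<open>p = 0\<close> on the upper half, so \<open>f\<close>
  is constant along horizontal lines there and keeps its value from the left edge; the lower half
  follows by oddness.\<close>

lemma odd_developable_rigid:
  assumes f: "strong f p q" and p: "strong p p1 p2" and q: "strong q q1 q2"
    and fc: "continuous_on (crect 0 l (- (1/2)) (1/2)) f"
    and odd: "\<And>x y. x \<in> {0..l} \<Longrightarrow> y \<in> {- (1/2)..1/2} \<Longrightarrow> f (pt x (- y)) = - f (pt x y)"
    and left: "\<And>y. y \<in> {- (1/2)..1/2} \<Longrightarrow> f (pt 0 y) = y" and corner: "\<bar>f (pt l (1/2))\<bar> = 1/2"
    and grad: "AE z in M. (p z)\<^sup>2 + (q z)\<^sup>2 \<le> 1"
    and det: "AE z in M. p1 z * q2 z = p2 z * q1 z"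
    and x: "x \<in> {0..l}" and y: "y \<in> {- (1/2)..1/2}"
  shows "f (pt x y) = y"
proof -
  interpret H: half_strip l
    using l_pos by unfold_locales auto
  have HM: "H.M = lebesgue_on (rect 0 l 0 (1/2))" by (simp add: H.M_def H.S_def)
  have sub: "rect 0 l 0 (1/2) \<subseteq> S" by (auto simp: S_def mem_rect)
  \<comment> \<open>An x-derivative inherits oddness in y, by uniqueness of strong derivatives. The
    shape \<open>- 1 * p z + 0 * p z\<close> is the one in which \<open>strong_lin\<close> provides
    the negative.\<close>
  have "AE z in M. p (mirror z) = - 1 * p z + 0 * p z"
  proof (rule strong_unique(1)[OF strong_mirror[OF f] strong_lin[OF f f]])
    show "AE z in M. f (mirror z) = - 1 * f z + 0 * f z"
    proof (rule AE_I2)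
      fix z assume "z \<in> space M"
      then have "f (pt (z $ 1) (- (z $ 2))) = - f (pt (z $ 1) (z $ 2))"
        by (intro odd) (auto simp: S_def mem_rect)
      then show "f (mirror z) = - 1 * f z + 0 * f z" by (simp add: mirror_def)
    qed
  qed
  then have podd: "AE z in M. p (mirror z) = - p z" by simp
  obtain P P1 P2 P12 P21 where P: "\<And>n. C2 (P n) (P1 n) (P2 n) (P12 n) (P21 n)"
    and lim: "L2lim M P p" "L2lim M P1 p1" "L2lim M P2 p2" and P0: "\<And>n x. P n (pt x 0) = 0"
    using strong_odd[OF p podd] by metis
  have p0: "AE z in H.M. p z = 0"
  proof (rule H.half_strip_rigidity[OF P P0])
    show "L2lim H.M P p" "L2lim H.M P1 p1" "L2lim H.M P2 p2"
      unfolding HM by (intro sub_L2lim[OF sub] lim)+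
    show "H.strong q q1 q2"
      by (rule strong_sub[OF q sub]) (use l_pos in auto)
    show "AE z in H.M. p2 z = q1 z"
      unfolding HM by (rule sub_AE[OF sub strong_curl[OF f p q]])
    show "AE z in H.M. p1 z * q2 z = p2 z * q1 z"
      unfolding HM by (rule sub_AE[OF sub det])
    show "(LINT z|lebesgue_on (rect 0 \<epsilon> 0 (1/2)). (p z)\<^sup>2) \<le> (2 * \<epsilon>)\<^sup>2" if "0 < \<epsilon>" "2 * \<epsilon> \<le> l" for \<epsilon>
      using edge_gradient[OF f fc odd grad, of 0 \<epsilon> 0] left[of "1/2"] that by simp
    show "(LINT z|lebesgue_on (rect (l - \<epsilon>) l 0 (1/2)). (p z)\<^sup>2) \<le> (2 * \<epsilon>)\<^sup>2" if "0 < \<epsilon>" "2 * \<epsilon> \<le> l" for \<epsilon>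
      using edge_gradient[OF f fc odd grad, of "l - \<epsilon>" l l] corner that by simp
  qed simp
  have Hf: "H.strong f p q"
    by (rule strong_sub[OF f sub]) (use l_pos in auto)
  have Hfc: "continuous_on (crect 0 l 0 (1/2)) f"
    by (rule continuous_on_subset[OF fc]) (auto simp: mem_crect)
  have pos: "f (pt x y) = y" if y: "y \<in> {0..1/2}" for y
  proof -
    have "\<bar>f (pt x y) - f (pt 0 y)\<bar> \<le> 0 * (x - 0)"
      by (rule H.strong_line1[OF Hf Hfc]) (use p0 x y in \<open>auto elim: eventually_mono\<close>)
    then show ?thesis using left[of y] y by simp
  qed
  show ?thesis
  proof (cases "0 \<le> y")
    case True
    then show ?thesis using pos y by simp
  next
    case False
    then have "f (pt x (- y)) = - y" using pos[of "- y"] y by simp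
    then show ?thesis using odd[OF x y] by simp
  qed
qed

end

section \<open>Pointwise algebra of isometric immersions\<close>

text \<open>Bessel's inequality for the k-th unit vector: its residual after projection to the span
  of \<open>a\<close> and \<open>b\<close> has nonnegative square.\<close>

lemma orthonormal_row_bound:
  fixes a b :: "real ^ 3"
  assumes "a \<bullet> a = 1" "b \<bullet> b = 1" "a \<bullet> b = 0"
  shows "(a $ k)\<^sup>2 + (b $ k)\<^sup>2 \<le> 1"
proof -
  define e :: "real ^ 3" where "e = axis k 1"
  have e: "e \<bullet> e = 1" "e \<bullet> a = a $ k" "e \<bullet> b = b $ k" "a \<bullet> e = a $ k" "b \<bullet> e = b $ k"
    by (simp_all add: e_def inner_axis inner_axis')
  have "0 \<le> (e - (a $ k) *\<^sub>R a - (b $ k) *\<^sub>R b) \<bullet> (e - (a $ k) *\<^sub>R a - (b $ k) *\<^sub>R b)" by simp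
  also have "\<dots> = 1 - (a $ k)\<^sup>2 - (b $ k)\<^sup>2"
    using assms by (simp add: inner_diff_left inner_diff_right e inner_commute[of b a] power2_eq_square algebra_simps)
  finally show ?thesis by simp
qed

text \<open>With n = g x h of norm 1, Lagrange's identity gives a x n = 0, and n x (a x n) = a - (n
  . a) n then yields the claim.\<close>

lemma normal_multiple:
  fixes g h a :: "real ^ 3"
  assumes "g \<bullet> g = 1" "h \<bullet> h = 1" "g \<bullet> h = 0" "a \<bullet> g = 0" "a \<bullet> h = 0"
  shows "a = (a \<bullet> cross3 g h) *\<^sub>R cross3 g h"
proof -
  define n where "n = cross3 g h"
  have "(norm n)\<^sup>2 = 1"
    using norm_cross[of g h] assms by (simp add: n_def power2_norm_eq_inner)
  then have n: "n \<bullet> n = 1" by (simp add: power2_norm_eq_inner)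
  have "cross3 a n = 0"
    unfolding n_def by (simp add: Lagrange assms)
  then have "0 = cross3 n (cross3 a n)" by simp
  also have "\<dots> = (n \<bullet> n) *\<^sub>R a - (n \<bullet> a) *\<^sub>R n" by (simp add: Lagrange)
  finally show ?thesis using n by (simp add: n_def inner_commute)
qed

text \<open>All three vectors are multiples of one unit normal n, and the inner product relation is
  a relation between the multipliers; multiply it by the square of n_k. This passes the Gauss
  equation from vectors to single components.\<close>

lemma normal_components:
  fixes g h a b c :: "real ^ 3"
  assumes g: "g \<bullet> g = 1" "h \<bullet> h = 1" "g \<bullet> h = 0"
    and "a \<bullet> g = 0" "a \<bullet> h = 0" "b \<bullet> g = 0" "b \<bullet> h = 0" "c \<bullet> g = 0" "c \<bullet> h = 0"
    and ab: "a \<bullet> b = c \<bullet> c"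
  shows "a $ k * b $ k = c $ k * c $ k"
proof -
  define n where "n = cross3 g h"
  have "(norm n)\<^sup>2 = 1"
    using norm_cross[of g h] g by (simp add: n_def power2_norm_eq_inner)
  then have n: "n \<bullet> n = 1" by (simp add: power2_norm_eq_inner)
  define \<alpha> \<beta> \<gamma> where "\<alpha> = a \<bullet> n" and "\<beta> = b \<bullet> n" and "\<gamma> = c \<bullet> n"
  have eq: "a = \<alpha> *\<^sub>R n" "b = \<beta> *\<^sub>R n" "c = \<gamma> *\<^sub>R n"
    unfolding \<alpha>_def \<beta>_def \<gamma>_def n_def by (intro normal_multiple assms)+
  have "\<alpha> * \<beta> = \<gamma> * \<gamma>"
    using ab unfolding eq by (simp add: n mult.commute)
  then show ?thesis
    unfolding eq by (simp add: algebra_simps)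
qed

context rectangle
begin

text \<open>\<open>g\<close> and \<open>h\<close> are the two columns of the gradient.\<close>

lemma isometric_components:
  fixes g h :: "3 \<Rightarrow> real ^ 2 \<Rightarrow> real"
  assumes g: "\<And>k. strong (g k) (g1 k) (g2 k)" and h: "\<And>k. strong (h k) (h1 k) (h2 k)"
    and curl: "\<And>k. AE z in M. g2 k z = h1 k z"
    and gg: "AE z in M. (\<Sum>k\<in>UNIV. g k z * g k z) = 1" and hh: "AE z in M. (\<Sum>k\<in>UNIV. h k z * h k z) = 1"
    and gh: "AE z in M. (\<Sum>k\<in>UNIV. g k z * h k z) = 0"
  shows "AE z in M. (g k z)\<^sup>2 + (h k z)\<^sup>2 \<le> 1"
    and "AE z in M. g1 k z * h2 k z = g2 k z * h1 k z"
proof -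
  define v :: "(3 \<Rightarrow> real ^ 2 \<Rightarrow> real) \<Rightarrow> real ^ 2 \<Rightarrow> real ^ 3" where "v w z = (\<chi> k. w k z)" for w z
  have inner: "v w z \<bullet> v w' z = (\<Sum>k\<in>UNIV. w k z * w' k z)" for w w' z
    by (simp add: v_def inner_vec_def)
  have curl': "AE z in M. v g2 z = v h1 z"
    using eventually_ball_finite[of UNIV "\<lambda>z k. g2 k z = h1 k z" "ae_filter M"] curl by (simp add: v_def vec_eq_iff)
  have orth: "AE z in M. v g z \<bullet> v g z = 1 \<and> v h z \<bullet> v h z = 1 \<and> v g z \<bullet> v h z = 0"
    using gg hh gh by (simp add: inner)
  have deriv: "AE z in M. v g1 z \<bullet> v g z + v g z \<bullet> v g1 z = 0" "AE z in M. v g2 z \<bullet> v g z + v g z \<bullet> v g2 z = 0"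
    "AE z in M. v h1 z \<bullet> v h z + v h z \<bullet> v h1 z = 0" "AE z in M. v h2 z \<bullet> v h z + v h z \<bullet> v h2 z = 0"
    "AE z in M. v g1 z \<bullet> v h z + v g z \<bullet> v h1 z = 0" "AE z in M. v g2 z \<bullet> v h z + v g z \<bullet> v h2 z = 0"
    using strong_inner_const[OF g g gg] strong_inner_const[OF h h hh] strong_inner_const[OF g h gh]
    by (simp_all only: inner sum.distrib)
  \<comment> \<open>Differentiating |g|^2 gives g1.g = g2.g = 0, and |h|^2 gives h1.h = h2.h = 0.
    With h1 = g2 the derivatives of g.h yield g1.h = -g.g2 = 0 and g.h2 = -g2.h = -h1.h = 0.\<close>
  have normal: "AE z in M. v g1 z \<bullet> v g z = 0 \<and> v g1 z \<bullet> v h z = 0 \<and> v h2 z \<bullet> v g z = 0 \<and> v h2 z \<bullet> v h z = 0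
      \<and> v g2 z \<bullet> v g z = 0 \<and> v g2 z \<bullet> v h z = 0 \<and> v h1 z = v g2 z"
    using deriv curl' by eventually_elim (auto simp: inner_commute)
  have gauss: "AE z in M. (\<Sum>k\<in>UNIV. g1 k z * h2 k z - g2 k z * h1 k z) = 0"
  proof (rule strong_gauss[OF g h])
    show "AE z in M. (\<Sum>k\<in>UNIV. g k z * h1 k z) = 0"
      unfolding inner[symmetric] using normal by eventually_elim (simp add: inner_commute)
    show "AE z in M. (\<Sum>k\<in>UNIV. g k z * h2 k z) = 0"
      unfolding inner[symmetric] using normal by eventually_elim (simp add: inner_commute)
  qed
  then have gauss': "AE z in M. v g1 z \<bullet> v h2 z = v g2 z \<bullet> v h1 z"
    by (simp add: inner sum_subtractf)
  show "AE z in M. (g k z)\<^sup>2 + (h k z)\<^sup>2 \<le> 1"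
    using orth
  proof eventually_elim
    case (elim z)
    then show ?case using orthonormal_row_bound[of "v g z" "v h z" k] by (simp add: v_def)
  qed
  show "AE z in M. g1 k z * h2 k z = g2 k z * h1 k z"
    using orth normal gauss'
  proof eventually_elim
    case (elim z)
    then show ?case
      using normal_components[of "v g z" "v h z" "v g1 z" "v h2 z" "v g2 z" k] by (auto simp: v_def vec_eq_iff)
  qed
qed

end

section \<open>From weak to strong derivatives\<close>

lemma pderivative_bounded_linear:
  assumes L: "bounded_linear L" and f: "Ck (Suc k) f"
  shows "pderivative i (\<lambda>x. L (f x)) = (\<lambda>x. L (pderivative i f x))"
proof
  fix x
  show "pderivative i (\<lambda>x. L (f x)) x = L (pderivative i f x)"
    using pderivative_eq[OF bounded_linear.has_derivative[OF L Ck_Suc_D(1)[OF f]]] by (simp add: pderivative_def)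
qed

lemma smooth_C2:
  fixes f :: "real ^ 2 \<Rightarrow> real"
  assumes "smooth f"
  shows "C2 f (pderivative 1 f) (pderivative 2 f) (pderivative 2 (pderivative 1 f)) (pderivative 1 (pderivative 2 f))"
proof -
  have "Ck (Suc (Suc 0)) f" using assms unfolding smooth_def by blast
  then show ?thesis
    unfolding C2_def using Ck_pd[OF \<open>Ck (Suc (Suc 0)) f\<close>] Ck_pd[OF Ck_Suc_D(2)[OF \<open>Ck (Suc (Suc 0)) f\<close>]] by blast
qed

context rectangle
begin

text \<open>Weak derivatives come with integrability on compact sets only. Truncations to compact
  rectangles exhausting \<open>S\<close> are measurable and converge pointwise.\<close>

lemma locally_integrable_measurable:
  assumes "locally_integrable S f"
  shows "f \<in> borel_measurable M"
proof -
  define e where "e n = 1 / real (Suc n)" for n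
  have pos: "0 < e n" for n by (simp add: e_def)
  define K where "K n = crect (A + e n) (B - e n) (C + e n) (D - e n)" for n
  have K: "compact (K n)" "K n \<subseteq> S" for n
    using pos[of n] by (simp add: K_def crect_def) (use pos[of n] in \<open>auto simp: K_def S_def mem_rect mem_crect\<close>)
  have m: "(\<lambda>z. if z \<in> K n then f z else 0) \<in> borel_measurable M" for n
  proof -
    have "f \<in> borel_measurable (lebesgue_on (K n))"
      using assms K[of n] unfolding locally_integrable_def by (intro borel_measurable_integrable) blast
    then have "(\<lambda>z. if z \<in> K n then f z else 0) \<in> borel_measurable lebesgue"
      by (subst borel_measurable_if) (auto simp: K_def)
    then show ?thesis unfolding M_def by (rule measurable_restrict_space1)
  qed
  show ?thesis
  proof (rule borel_measurable_LIMSEQ_metric[OF m])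
    fix z assume "z \<in> space M"
    then have z: "A < z $ 1" "z $ 1 < B" "C < z $ 2" "z $ 2 < D" by (auto simp: S_def mem_rect)
    have l: "(\<lambda>n. r + e n) \<longlonglongrightarrow> r" "(\<lambda>n. r - e n) \<longlonglongrightarrow> r" for r
      unfolding e_def by real_asymp+
    have "\<forall>\<^sub>F n in sequentially. f z = (if z \<in> K n then f z else 0)"
      using order_tendstoD(2)[OF l(1) z(1)] order_tendstoD(1)[OF l(2) z(2)]
        order_tendstoD(2)[OF l(1) z(3)] order_tendstoD(1)[OF l(2) z(4)]
      by eventually_elim (simp add: K_def mem_crect)
    then show "(\<lambda>n. if z \<in> K n then f z else 0) \<longlonglongrightarrow> f z"
      by (rule Lim_transform_eventually[OF tendsto_const])
  qed
qed

lemma bump_integrable: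
  assumes f: "locally_integrable S f" and sub: "crect a b c d \<subseteq> S"
  shows "integrable M (\<lambda>z. bump n a b c d z *\<^sub>R f z)"
proof -
  let ?K = "crect a b c d"
  have "integrable (lebesgue_on ?K) f"
    using f sub unfolding locally_integrable_def by (auto simp: crect_def)
  moreover have K: "?K \<in> sets M"
    unfolding M_def using sub by (subst sets_restrict_space_iff) (auto simp: S_def)
  moreover have "lebesgue_on ?K = restrict_space M ?K"
    unfolding M_def using sub by (simp add: restrict_restrict_space S_def inf.absorb2)
  ultimately have i: "integrable M (\<lambda>z. indicator ?K z *\<^sub>R f z)"
    using sub by (simp add: integrable_restrict_space Int_absorb2)
  show ?thesis
  proof (rule Bochner_Integration.integrable_bound[OF i])
    show "(\<lambda>z. bump n a b c d z *\<^sub>R f z) \<in> borel_measurable M"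
      using cont_measurable[OF bump_continuous(1)] locally_integrable_measurable[OF f] by measurable
    show "AE z in M. norm (bump n a b c d z *\<^sub>R f z) \<le> norm (indicator ?K z *\<^sub>R f z)"
    proof (rule AE_I2)
      fix z
      show "norm (bump n a b c d z *\<^sub>R f z) \<le> norm (indicator ?K z *\<^sub>R f z)"
      proof (cases "z \<in> ?K")
        case True
        then show ?thesis using bump_bounds[of n a b c d z] by (simp add: mult_left_le_one_le)
      next
        case False
        then have "z \<notin> rect a b c d" by (auto simp: mem_rect mem_crect)
        then show ?thesis by (simp add: bump_eq_0)
      qed
    qed
  qed
qed

text \<open>A linear functional \<open>L\<close> reduces vector values to the scalar fundamental
  lemma. It is needed to identify gradients that stem from separate existential statements.\<close>

lemma weak_partial_unique:
  fixes f g g' :: "real ^ 2 \<Rightarrow> 'b::euclidean_space"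
  assumes g: "has_weak_partial S i f g" and g': "has_weak_partial S i f g'" and L: "bounded_linear L"
    and int: "integrable M (\<lambda>z. L (g z))" "integrable M (\<lambda>z. L (g' z))"
  shows "AE z in M. L (g z) = (L (g' z) :: real)"
proof (rule AE_eqI[OF int])
  fix n a b c d assume sub: "crect a b c d \<subseteq> S"
  have t: "test_function S (bump n a b c d)" by (rule bump_test_function[OF sub])
  have "(LINT z|M. bump n a b c d z *\<^sub>R g z) = (LINT z|M. bump n a b c d z *\<^sub>R g' z)"
  proof -
    have "(LINT z|M. pderivative i (bump n a b c d) z *\<^sub>R f z) = - (LINT z|M. bump n a b c d z *\<^sub>R w z)"
      if "has_weak_partial S i f w" for w
      using that t unfolding has_weak_partial_def M_def by blast
    from this[OF g] this[OF g'] show ?thesis by simp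
  qed
  then have "L (LINT z|M. bump n a b c d z *\<^sub>R g z) = L (LINT z|M. bump n a b c d z *\<^sub>R g' z)" by simp
  moreover have "L (LINT z|M. bump n a b c d z *\<^sub>R w z) = (LINT z|M. bump n a b c d z * L (w z))"
    if "locally_integrable S w" for w
    using integral_bounded_linear[OF L bump_integrable[OF that sub]]
    by (simp add: linear_scale[OF bounded_linear.linear[OF L]])
  ultimately show "(LINT z|M. bump n a b c d z * L (g z)) = (LINT z|M. bump n a b c d z * L (g' z))"
    using g g' unfolding has_weak_partial_def by simp
qed

lemma L2lim_component:
  fixes f :: "real ^ 2 \<Rightarrow> 'b::euclidean_space"
  assumes f: "f \<in> borel_measurable M" and V: "\<And>n. continuous_on UNIV (V n)"
    and L: "bounded_linear L" "\<And>x. \<bar>L x\<bar> \<le> norm x"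
    and lim: "(\<lambda>n. \<integral>\<^sup>+z. ennreal ((norm (V n z - f z))\<^sup>2) \<partial>M) \<longlonglongrightarrow> 0"
  shows "L2lim M (\<lambda>n z. L (V n z)) (\<lambda>z. L (f z))"
proof (rule L2limI_nn_integral)
  have VL: "continuous_on UNIV (\<lambda>z. L (V n z))" for n
    by (rule bounded_linear.continuous_on[OF L(1) V])
  show "(\<lambda>z. L (f z)) \<in> borel_measurable M"
    using measurable_compose[OF f borel_measurable_continuous_onI[OF bounded_linear.continuous_on[OF L(1) continuous_on_id]]] .
  show "(\<lambda>z. L (V n z)) \<in> borel_measurable M" for n by (rule cont_measurable[OF VL])
  show "integrable M (\<lambda>z. (L (V n z))\<^sup>2)" for n
    by (intro cont_integrable continuous_intros VL)
  have le: "(\<integral>\<^sup>+z. ennreal ((L (V n z) - L (f z))\<^sup>2) \<partial>M) \<le> (\<integral>\<^sup>+z. ennreal ((norm (V n z - f z))\<^sup>2) \<partial>M)" for n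
  proof (intro nn_integral_mono ennreal_leI)
    fix z
    have "\<bar>L (V n z) - L (f z)\<bar> \<le> norm (V n z - f z)"
      using L(2)[of "V n z - f z"] by (simp add: linear_diff[OF bounded_linear.linear[OF L(1)]])
    then show "(L (V n z) - L (f z))\<^sup>2 \<le> (norm (V n z - f z))\<^sup>2"
      by (metis abs_ge_zero power2_abs power_mono)
  qed
  show "(\<lambda>n. \<integral>\<^sup>+z. ennreal ((L (V n z) - L (f z))\<^sup>2) \<partial>M) \<longlonglongrightarrow> 0"
    by (rule tendsto_sandwich[OF _ _ tendsto_const lim]) (use le in auto)
qed

text \<open>Applied to \<open>u\<close>, whose approximants also carry the boundary values, and to
  its gradient, whose derivatives are the second derivatives of \<open>u\<close>. \<open>L\<close>
  picks an entry.\<close>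

lemma approx_component:
  fixes f :: "real ^ 2 \<Rightarrow> 'b::euclidean_space"
  assumes D: "\<And>i. has_weak_partial S i f (Df i)" and V: "\<And>n. smooth (V n)"
    and lim: "(\<lambda>n. \<integral>\<^sup>+z. ennreal ((norm (V n z - f z))\<^sup>2) \<partial>M) \<longlonglongrightarrow> 0"
    and Dlim: "\<And>i. (\<lambda>n. \<integral>\<^sup>+z. ennreal ((norm (pderivative i (V n) z - Df i z))\<^sup>2) \<partial>M) \<longlonglongrightarrow> 0"
    and L: "bounded_linear L" "\<And>x. \<bar>L x\<bar> \<le> norm x"
  shows "L2lim M (\<lambda>n z. L (V n z)) (\<lambda>z. L (f z))"
    and "L2lim M (\<lambda>n. pderivative i (\<lambda>z. L (V n z))) (\<lambda>z. L (Df i z))"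
    and "smooth (\<lambda>z. L (V n z))"
    and "strong (\<lambda>z. L (f z)) (\<lambda>z. L (Df 1 z)) (\<lambda>z. L (Df 2 z))"
proof -
  have V1: "Ck (Suc 0) (V n)" for n using V unfolding smooth_def by blast
  have f_loc: "locally_integrable S f" and D_loc: "locally_integrable S (Df i)" for i
    using D unfolding has_weak_partial_def by blast+
  show 1: "L2lim M (\<lambda>n z. L (V n z)) (\<lambda>z. L (f z))"
    by (rule L2lim_component[OF locally_integrable_measurable[OF f_loc] Ck_continuous[OF V1] L lim])
  show 2: "L2lim M (\<lambda>n. pderivative i (\<lambda>z. L (V n z))) (\<lambda>z. L (Df i z))" for i
    unfolding pderivative_bounded_linear[OF L(1) V1]
    by (rule L2lim_component[OF locally_integrable_measurable[OF D_loc] Ck_continuous[OF Ck_Suc_D(2)[OF V1]] L Dlim])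
  show 3: "smooth (\<lambda>z. L (V n z))" for n
    using V[of n] Ck_bounded_linear[OF L(1), of _ "V n"] unfolding smooth_def by simp
  show "strong (\<lambda>z. L (f z)) (\<lambda>z. L (Df 1 z)) (\<lambda>z. L (Df 2 z))"
    by (rule strongI[OF smooth_C2[OF 3] 1 2 2])
qed

lemma strong_cong:
  assumes v: "strong v v1 v2" and "w1 \<in> borel_measurable M" "w2 \<in> borel_measurable M"
    and "AE z in M. v1 z = w1 z" "AE z in M. v2 z = w2 z"
  shows "strong v w1 w2"
proof -
  obtain V V1 V2 V12 V21 where V: "\<And>n. C2 (V n) (V1 n) (V2 n) (V12 n) (V21 n)"
    and lim: "L2lim M V v" "L2lim M V1 v1" "L2lim M V2 v2"
    using v unfolding strong_def by blast
  show ?thesis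
    by (rule strongI[OF V lim(1) L2lim_cong_AE[OF lim(2) assms(2,4)] L2lim_cong_AE[OF lim(3) assms(3,5)]])
qed

end

lemma closure_strip: "0 < l \<Longrightarrow> closure (strip l) = crect 0 l (- (1/2)) (1/2)"
proof -
  assume "0 < l"
  then have "pt (l / 2) 0 \<in> rect 0 l (- (1/2)) (1/2)" by (simp add: mem_rect)
  then have "box (pt 0 (- (1/2))) (pt l (1/2)) \<noteq> {}" unfolding rect_def by blast
  moreover have "strip l = box (pt 0 (- (1/2))) (pt l (1/2))" by (simp add: strip_eq_rect rect_def)
  ultimately show ?thesis by (simp add: closure_box crect_def)
qed

lemma L2lim_trace_L1:
  fixes V :: "nat \<Rightarrow> real \<Rightarrow> real" and g :: "real \<Rightarrow> real"
  assumes V: "\<And>n. continuous_on UNIV (V n)" and g: "continuous_on UNIV g" and "a < b"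
    and lim: "(\<lambda>n. \<integral>\<^sup>+t. ennreal ((V n t - g t)\<^sup>2) \<partial>lebesgue_on {a<..<b}) \<longlonglongrightarrow> 0"
  shows "(\<lambda>n. integral {a..b} (\<lambda>t. \<bar>V n t - g t\<bar>)) \<longlonglongrightarrow> 0"
proof -
  let ?N = "lebesgue_on {a<..<b}"
  have i: "integrable ?N h" if "continuous_on UNIV h" for h :: "real \<Rightarrow> real"
  proof -
    have "integrable (lebesgue_on {a..b}) h"
      by (intro continuous_imp_integrable_real continuous_on_subset[OF that]) simp
    moreover have "{a<..<b} \<subseteq> {a..b}" by auto
    ultimately show ?thesis
      using set_integrable_subset[of lebesgue "{a..b}" h "{a<..<b}"]
      by (simp add: integrable_restrict_space set_integrable_def)
  qed
  interpret N: finite_measure ?N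
    by (simp add: finite_measure_lebesgue_on)
  have "L2lim ?N V g"
    by (rule L2limI_nn_integral[OF _ _ _ lim])
      (intro borel_measurable_integrable i V g continuous_on_power)+
  from N.L2lim_L1(1)[OF this] show ?thesis
    by (subst (asm) lebesgue_integral_eq_integral)
      (auto intro!: i continuous_intros V g simp: integral_open_interval_real)
qed

section \<open>Symmetric clamped isometric deformations\<close>

theorem corollary5p2:
  fixes l :: real and u :: "real ^ 2 \<Rightarrow> real ^ 3"
  assumes "l > 0"
    and "u \<in> clamped_iso l"
    and "continuous_on (closure (strip l)) u"
    and "symmetric_deformation l u"
    and "norm (u (vector [l, 1/2]) - u (vector [l, - 1/2])) = 1"
  shows "cylindrical l u"
proof -
  interpret R: strip_rect l
    using \<open>l > 0\<close> by unfold_locales auto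
  have S: "R.S = strip l" by (simp add: R.S_def strip_eq_rect)
  have M: "R.M = lebesgue_on (strip l)" by (simp add: R.M_def S)
  define K where "K = crect 0 l (- (1/2)) (1/2)"
  have K: "closure (strip l) = K" using closure_strip[OF \<open>l > 0\<close>] by (simp add: K_def)
  have K_iff: "pt x y \<in> K \<longleftrightarrow> x \<in> {0..l} \<and> y \<in> {- (1/2)..1/2}" for x y
    by (auto simp: K_def mem_crect)

  \<comment> \<open>Three gradients of \<open>u\<close> arise from separate existentials:
    \<open>G'\<close> has orthonormal columns, \<open>Du\<close> is the limit along the approximants
    of \<open>u\<close>, and \<open>G\<close> has approximants of its own. They are shown to agree
    almost everywhere below, and \<open>G\<close> is kept.\<close>
  obtain G' where G': "has_weak_gradient R.S u G'" and iso: "AE z in R.M. transpose (G' z) ** G' z = mat 1"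
    using assms(2) unfolding clamped_iso_def W22_iso_def S M by blast
  obtain Du w where Du: "\<And>i. has_weak_partial R.S i u (Du i)" and w: "\<And>n. smooth (w n)"
    and wlim: "(\<lambda>n. \<integral>\<^sup>+z. ennreal ((norm (w n z - u z))\<^sup>2) \<partial>R.M) \<longlonglongrightarrow> 0"
      "\<And>i. (\<lambda>n. \<integral>\<^sup>+z. ennreal ((norm (pderivative i (w n) z - Du i z))\<^sup>2) \<partial>R.M) \<longlonglongrightarrow> 0"
    and wtrace: "(\<lambda>n. \<integral>\<^sup>+t. ennreal ((norm (w n (pt 0 t) - vector [pt 0 t $ 1, pt 0 t $ 2, 0]))\<^sup>2)
              \<partial>lebesgue_on {- 1/2<..<1/2}) \<longlonglongrightarrow> 0"
    using assms(2) unfolding clamped_iso_def left_trace_def S M pt_def by blast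
  obtain G where G: "has_weak_gradient R.S u G" and
    Gtrace: "left_trace l G (\<lambda>x. vector [vector [1, 0], vector [0, 1], vector [0, 0]])"
    using assms(2) unfolding clamped_iso_def S by blast
  obtain DG v where DG: "\<And>i. has_weak_partial R.S i G (DG i)" and v: "\<And>n. smooth (v n)"
    and vlim: "(\<lambda>n. \<integral>\<^sup>+z. ennreal ((norm (v n z - G z))\<^sup>2) \<partial>R.M) \<longlonglongrightarrow> 0"
      "\<And>i. (\<lambda>n. \<integral>\<^sup>+z. ennreal ((norm (pderivative i (v n) z - DG i z))\<^sup>2) \<partial>R.M) \<longlonglongrightarrow> 0"
    using Gtrace unfolding left_trace_def S M by blast

  have L: "bounded_linear (\<lambda>x::real^3. x $ k)" "\<bar>x $ k\<bar> \<le> norm x" for k and x :: "real ^ 3"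
    by (simp_all add: bounded_linear_vec_nth component_le_norm_cart)
  have LL: "bounded_linear (\<lambda>m::real^2^3. m $ k $ j)" "\<bar>m $ k $ j\<bar> \<le> norm m" for k j and m :: "real ^ 2 ^ 3"
  proof -
    show "bounded_linear (\<lambda>m::real^2^3. m $ k $ j)"
      by (rule bounded_linear_compose[OF bounded_linear_vec_nth bounded_linear_vec_nth])
    show "\<bar>m $ k $ j\<bar> \<le> norm m"
      using component_le_norm_cart[of "m $ k" j] Finite_Cartesian_Product.norm_nth_le[of m k] by linarith
  qed
  have sG: "R.strong (\<lambda>z. G z $ k $ j) (\<lambda>z. DG 1 z $ k $ j) (\<lambda>z. DG 2 z $ k $ j)" for k j
    by (rule R.approx_component(4)[OF DG v vlim LL])
  note wk = R.approx_component[OF Du w wlim L]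
  have Gpart: "has_weak_partial R.S i u (\<lambda>z. column i (G z))" "has_weak_partial R.S i u (\<lambda>z. column i (G' z))" for i
    using G G' unfolding has_weak_gradient_def by blast+
  have iDu: "integrable R.M (\<lambda>z. Du i z $ k)" for i k
    using exhaust_2[of i] R.strongD(8,9)[OF wk(4)] by auto
  have col: "column i m $ k = m $ k $ i" for i k and m :: "real ^ 2 ^ 3"
    by (simp add: column_def)
  have "AE z in R.M. Du i z $ k = G z $ k $ i" for i k
    using R.weak_partial_unique[OF Du Gpart(1) L(1) iDu] R.strongD(7)[OF sG] by (simp add: col)
  then have sU: "R.strong (\<lambda>z. u z $ k) (\<lambda>z. G z $ k $ 1) (\<lambda>z. G z $ k $ 2)" for k
    by (intro R.strong_cong[OF wk(4)] R.strongD(1)[OF sG])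

  have iso': "AE z in R.M. (\<Sum>k\<in>UNIV. G' z $ k $ i * G' z $ k $ j) = (if i = j then 1 else 0)" for i j
    using iso
  proof eventually_elim
    case (elim z)
    then have "(transpose (G' z) ** G' z) $ i $ j = mat 1 $ i $ j" by simp
    then show ?case by (simp add: matrix_matrix_mult_def transpose_def mat_def)
  qed
  have G'm: "(\<lambda>z. G' z $ k $ i) \<in> borel_measurable R.M" for k i
  proof -
    have "(\<lambda>z. column i (G' z)) \<in> borel_measurable R.M"
      using Gpart(2) unfolding has_weak_partial_def by (blast intro: R.locally_integrable_measurable)
    from measurable_compose[OF this borel_measurable_continuous_onI[OF bounded_linear.continuous_on[OF L(1) continuous_on_id], of k]]
    show ?thesis by (simp add: col)
  qed
  \<comment> \<open>The columns of \<open>G'\<close> are unit vectors, so its entries are bounded;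
    this provides the integrability that uniqueness requires.\<close>
  have "AE z in R.M. norm (G' z $ k $ i) \<le> 1" for k i
    using iso'[of i i]
  proof eventually_elim
    case (elim z)
    have "(G' z $ k $ i)\<^sup>2 \<le> (\<Sum>k\<in>UNIV. (G' z $ k $ i)\<^sup>2)"
      by (rule member_le_sum) auto
    then have "(G' z $ k $ i)\<^sup>2 \<le> 1" using elim by (simp add: power2_eq_square)
    then show ?case by (simp add: abs_square_le_1)
  qed
  then have iG': "integrable R.M (\<lambda>z. G' z $ k $ i)" for k i
    by (intro R.integrable_const_bound[where B = 1] G'm)
  have "AE z in R.M. G z $ k $ i = G' z $ k $ i" for k i
    using R.weak_partial_unique[OF Gpart(1) Gpart(2) L(1), of i k] R.strongD(7)[OF sG] iG' by (simp add: col)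
  then have eqG: "AE z in R.M. \<forall>k. G z $ k $ i = G' z $ k $ i" for i
    using eventually_ball_finite[of UNIV "\<lambda>z k. G z $ k $ i = G' z $ k $ i" "ae_filter R.M"] by simp
  have orth: "AE z in R.M. (\<Sum>k\<in>UNIV. G z $ k $ i * G z $ k $ j) = (if i = j then 1 else 0)" for i j
    using eqG[of i] eqG[of j] iso'[of i j] by eventually_elim simp

  note comp = R.isometric_components[of "\<lambda>k z. G z $ k $ 1" _ _ "\<lambda>k z. G z $ k $ 2",
      OF sG sG R.strong_curl[OF sU sG sG] orth[of 1 1, simplified] orth[of 2 2, simplified] orth[of 1 2, simplified]]

  have uc: "continuous_on K (\<lambda>z. u z $ k)" for k
    using assms(3) unfolding K by (rule continuous_on_component)
  have mirror_K: "mirror z \<in> K \<longleftrightarrow> z \<in> K" for z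
    by (auto simp: mirror_def K_def mem_crect)
  have umc: "continuous_on K (\<lambda>z. u (mirror z) $ k)" for k
    by (rule continuous_on_compose2[OF uc continuous_on_mirror]) (use mirror_K in auto)
  \<comment> \<open>Symmetry is assumed in the open strip only; continuity extends it to the
    closure, where the corners and the edge x = l lie.\<close>
  have sym: "u z $ 1 = u (mirror z) $ 1 \<and> u z $ 2 = - u (mirror z) $ 2 \<and> u z $ 3 = u (mirror z) $ 3"
    if "z \<in> K" for z
  proof -
    have strip: "u z $ 1 - u (mirror z) $ 1 = 0 \<and> u z $ 2 + u (mirror z) $ 2 = 0 \<and> u z $ 3 - u (mirror z) $ 3 = 0"
      if "z \<in> strip l" for z
    proof -
      have "u z = vector [u (mirror z) $ 1, - u (mirror z) $ 2, u (mirror z) $ 3]"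
        using assms(4) that unfolding symmetric_deformation_def mirror_def pt_def by blast
      then have "u z $ 1 = u (mirror z) $ 1" "u z $ 2 = - u (mirror z) $ 2" "u z $ 3 = u (mirror z) $ 3"
        by (metis vector_3)+
      then show ?thesis by simp
    qed
    have ext: "f z = 0" if f: "continuous_on K f" "\<And>z. z \<in> strip l \<Longrightarrow> f z = 0" for f :: "real ^ 2 \<Rightarrow> real"
      using continuous_constant_on_closure[of "strip l" f 0 z] f \<open>z \<in> K\<close> unfolding K by blast
    have "u z $ 1 - u (mirror z) $ 1 = 0"
      by (rule ext) (intro continuous_on_diff uc umc, use strip in blast)
    moreover have "u z $ 2 + u (mirror z) $ 2 = 0"
      by (rule ext) (intro continuous_on_add uc umc, use strip in blast)
    moreover have "u z $ 3 - u (mirror z) $ 3 = 0"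
      by (rule ext) (intro continuous_on_diff uc umc, use strip in blast)
    ultimately show ?thesis by simp
  qed

  \<comment> \<open>The same sequence \<open>w\<close> converges to \<open>u\<close> inside and to
    the clamped data on the left edge, so \<open>section1_trace\<close> makes the continuous
    representative attain the data pointwise.\<close>
  have left: "u (pt 0 y) $ 2 = y" if "y \<in> {- (1/2)..1/2}" for y
  proof (rule R.section1_trace[of "\<lambda>z. u z $ 2" "\<lambda>n z. w n z $ 2" _ _ "\<lambda>y. y"])
    show "pd1 (\<lambda>z. w n z $ 2) (pderivative 1 (\<lambda>z. w n z $ 2))" for n
      using smooth_C2[OF wk(3)] unfolding C2_def by blast
    show "L2lim R.M (\<lambda>n z. w n z $ 2) (\<lambda>z. u z $ 2)" by (rule wk(1))
    show "L2lim R.M (\<lambda>n. pderivative 1 (\<lambda>z. w n z $ 2)) (\<lambda>z. Du 1 z $ 2)" by (rule wk(2))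
    have c: "continuous_on UNIV (\<lambda>t. w n (pt 0 t) $ 2)" for n
    proof -
      have "Ck 0 (\<lambda>z. w n z $ 2)" using wk(3) unfolding smooth_def by blast
      then have "continuous_on UNIV (\<lambda>z. w n z $ 2)" by simp
      then show ?thesis by (rule continuous_on_compose2) (auto intro: continuous_intros)
    qed
    have "(\<lambda>n. integral {- 1/2..1/2} (\<lambda>t. \<bar>w n (pt 0 t) $ 2 - t\<bar>)) \<longlonglongrightarrow> 0"
    proof (rule L2lim_trace_L1[OF c])
      have le: "(\<integral>\<^sup>+t. ennreal ((w n (pt 0 t) $ 2 - t)\<^sup>2) \<partial>lebesgue_on {- 1/2<..<1/2})
        \<le> (\<integral>\<^sup>+t. ennreal ((norm (w n (pt 0 t) - vector [pt 0 t $ 1, pt 0 t $ 2, 0]))\<^sup>2) \<partial>lebesgue_on {- 1/2<..<1/2})" for n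
      proof (intro nn_integral_mono ennreal_leI)
        fix t :: real
        have "\<bar>w n (pt 0 t) $ 2 - t\<bar> \<le> norm (w n (pt 0 t) - vector [pt 0 t $ 1, pt 0 t $ 2, 0])"
          using L(2)[of "w n (pt 0 t) - vector [pt 0 t $ 1, pt 0 t $ 2, 0]" 2] by simp
        then show "(w n (pt 0 t) $ 2 - t)\<^sup>2 \<le> (norm (w n (pt 0 t) - vector [pt 0 t $ 1, pt 0 t $ 2, 0]))\<^sup>2"
          by (metis abs_ge_zero power2_abs power_mono)
      qed
      show "(\<lambda>n. \<integral>\<^sup>+t. ennreal ((w n (pt 0 t) $ 2 - t)\<^sup>2) \<partial>lebesgue_on {- 1/2<..<1/2}) \<longlonglongrightarrow> 0"
        by (rule tendsto_sandwich[OF _ _ tendsto_const wtrace]) (use le in auto)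
    qed (auto intro: continuous_intros)
    then show "(\<lambda>n. integral {- (1/2)..1/2} (\<lambda>y. \<bar>w n (pt 0 y) $ 2 - y\<bar>)) \<longlonglongrightarrow> 0" by simp
    show "continuous_on (crect 0 l (- (1/2)) (1/2)) (\<lambda>z. u z $ 2)"
      using uc by (simp add: K_def)
  qed (use that \<open>l > 0\<close> in \<open>auto intro: continuous_intros\<close>)

  have corner: "\<bar>u (pt l (1/2)) $ 2\<bar> = 1/2"
  proof -
    have "pt l (1/2) \<in> K" using \<open>l > 0\<close> by (simp add: K_iff)
    \<comment> \<open>By symmetry the two corners differ in the second coordinate only, by twice its
      value.\<close>
    from sym[OF this] have "u (pt l (1/2)) - u (pt l (- 1/2)) = (2 * u (pt l (1/2)) $ 2) *\<^sub>R axis 2 1"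
      by (simp add: vec_eq_iff forall_3 axis_def)
    then have "norm (u (pt l (1/2)) - u (pt l (- 1/2))) = \<bar>2 * u (pt l (1/2)) $ 2\<bar>" by simp
    then show ?thesis using assms(5) by (simp add: pt_def)
  qed

  have u2: "u (pt x y) $ 2 = y" if "x \<in> {0..l}" "y \<in> {- (1/2)..1/2}" for x y
  proof (rule R.odd_developable_rigid[OF sU sG sG])
    show "continuous_on (crect 0 l (- (1/2)) (1/2)) (\<lambda>z. u z $ 2)"
      using uc by (simp add: K_def)
    show "u (pt x (- y)) $ 2 = - u (pt x y) $ 2" if "x \<in> {0..l}" "y \<in> {- (1/2)..1/2}" for x y
      using sym[of "pt x y"] that by (simp add: K_iff)
    show "AE z in R.M. (G z $ 2 $ 1)\<^sup>2 + (G z $ 2 $ 2)\<^sup>2 \<le> 1" by (rule comp(1))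
    show "AE z in R.M. DG 1 z $ 2 $ 1 * DG 2 z $ 2 $ 2 = DG 2 z $ 2 $ 1 * DG 1 z $ 2 $ 2" by (rule comp(2))
  qed (use left corner that in auto)

  \<comment> \<open>Comparing with the explicit function y shows that the second component of
    \<open>u\<close> has gradient (0, 1) almost everywhere.\<close>
  have "C2 (\<lambda>z. z $ 2) (\<lambda>_. 0) (\<lambda>_. 1) (\<lambda>_. 0) (\<lambda>_. 0)"
    unfolding C2_def pd1_def pd2_def by (auto intro!: continuous_intros derivative_eq_intros)
  then have "R.strong (\<lambda>z. z $ 2) (\<lambda>_. 0) (\<lambda>_. 1)" by (rule R.strong_C2)
  moreover have "AE z in R.M. u z $ 2 = z $ 2"
  proof (rule AE_I2)
    fix z assume "z \<in> space R.M"
    then have "z $ 1 \<in> {0..l}" "z $ 2 \<in> {- (1/2)..1/2}" by (auto simp: S strip_def)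
    from u2[OF this] show "u z $ 2 = z $ 2" by simp
  qed
  ultimately have "AE z in R.M. G z $ 2 $ 2 = 1"
    by (rule R.strong_unique(2)[OF sU])
  \<comment> \<open>The second column of \<open>G\<close> is a unit vector whose middle entry is 1,
    so its other entries are 0. The bound by 0 is the form that \<open>strong_line2\<close> takes
    with \<open>K = 0\<close>.\<close>
  then have flat2: "AE z in R.M. \<bar>G z $ k $ 2\<bar> \<le> 0" if "k \<noteq> 2" for k
    using orth[of 2 2]
  proof eventually_elim
    case (elim z)
    then have "(G z $ 1 $ 2)\<^sup>2 + (G z $ 3 $ 2)\<^sup>2 = 0"
      by (simp add: sum_3 power2_eq_square)
    then have "G z $ 1 $ 2 = 0" "G z $ 3 $ 2 = 0" by (simp_all add: sum_power2_eq_zero_iff)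
    then show ?case using exhaust_3[of k] that by auto
  qed
  have const: "u (pt x y) $ k = u (pt x 0) $ k" if "k \<noteq> 2" "x \<in> {0..l}" "y \<in> {- (1/2)..1/2}" for k x y
  proof -
    have c: "continuous_on (crect 0 l (- (1/2)) (1/2)) (\<lambda>z. u z $ k)"
      using uc by (simp add: K_def)
    \<comment> \<open>The Lipschitz constant 0 along vertical lines makes the other two components
      independent of y.\<close>
    note line = R.strong_line2[OF sU c flat2[OF that(1)] \<open>l > 0\<close> _ _ _ that(2)]
    show ?thesis
      using line[of 0 y] line[of y 0] that(3) by (cases "0 \<le> y") auto
  qed
  show ?thesis
    unfolding cylindrical_def
  proof
    fix z assume "z \<in> strip l"
    then have z: "z $ 1 \<in> {0..l}" "z $ 2 \<in> {- (1/2)..1/2}" by (auto simp: strip_def)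
    have "u z $ 1 = u (pt (z $ 1) 0) $ 1" "u z $ 2 = z $ 2" "u z $ 3 = u (pt (z $ 1) 0) $ 3"
      using const[OF _ z, of 1] const[OF _ z, of 3] u2[OF z] by simp_all
    then show "u z = vector [u (vector [z $ 1, 0]) $ 1, z $ 2, u (vector [z $ 1, 0]) $ 3]"
      by (simp add: vec_eq_iff forall_3 flip: pt_def)
  qed
qed

end
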